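(* For all integers $m\ge 0$ and $k\ge 1$, $H_m^k=X_m^k$, and there exists a constant $C_{m,k}>0$ such that for all $u\in H_m^k$ $$C_{m,k}\,\|u\|_{m,k}^2\le \left(m+\tfrac12\right)^{2k}\int_{-1}^1|u|^2+\int_{-1}^1\omega^{2(m+k)}\,|(\omega^{-m}u)^{(k)}|^2\le 2^{1-2k}\,\|u\|_{m,k}^2 .$$
   Context: All functions are real valued on $(-1,1)$; derivatives are understood in the sense of distributions on $(-1,1)$. Let $\omega(t)=\sqrt{1-t^2}$. Legendre polynomials: $P_n(t)=\frac{(-1)^n}{2^n n!}\frac{d^n}{dt^n}\big((1-t^2)^n\big)$, $n\ge 0$. For integers $0\le m\le n$, the normalized associated Legendre functions are $Q_n^m:=c_{n,m}\,\omega^m P_n^{(m)}$ with $c_{n,m}=\left(\frac{2n+1}{2}\frac{(n-m)!}{(n+m)!}\right)^{1/2}$; for each fixed $m\ge0$, $\{Q_n^m : n\ge m\}$ is an orthonormal basis of $L^2(-1,1)$. For integer $m\ge 0$ and real $s\ge 0$, $H_m^s$ is the set of $u\in L^2(-1,1)$ with $\|u\|_{m,s}^2:=\sum_{n=m}^\infty (2n+1)^{2s}|(u,Q_n^m)_{L^2(-1,1)}|^2<\infty$. For integers $m,k\ge0$, $X_m^k:=\{u\in L^2(-1,1) : \omega^{m+k}(\omega^{-m}u)^{(k)}\in L^2(-1,1)\}$. *)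

theory Defs
  imports "HOL-Analysis.Analysis" "HOL-Computational_Algebra.Polynomial"
begin

definition omega :: "real \<Rightarrow> real"
  where "omega t = sqrt (1 - t^2)"

abbreviation mu :: "real measure"
  where "mu \<equiv> lebesgue_on {-1<..<1}"

text \<open>
  Elements of \<open>L\<^sup>2(-1,1)\<close> are represented by functions, not by classes modulo equality almost
  everywhere; values outside \<open>(-1,1)\<close> are irrelevant. All sets and quantities below depend only on
  the class of the function.
\<close>

definition L2 :: "(real \<Rightarrow> real) set"
  where "L2 = {u \<in> borel_measurable mu. integrable mu (\<lambda>t. (u t)^2)}"

definition L2_inner :: "(real \<Rightarrow> real) \<Rightarrow> (real \<Rightarrow> real) \<Rightarrow> real"
  where "L2_inner u v = (\<integral>t. u t * v t \<partial>mu)"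

definition Legendre_poly :: "nat \<Rightarrow> real poly"
  where "Legendre_poly n =
    smult ((-1)^n / (2^n * fact n)) ((pderiv ^^ n) ([:1, 0, -1:]^n))"

definition assoc_Legendre :: "nat \<Rightarrow> nat \<Rightarrow> real \<Rightarrow> real"
  where "assoc_Legendre m n t =
    sqrt ((2 * real n + 1) / 2 * (fact (n - m) / fact (n + m)))
      * omega t ^ m * poly ((pderiv ^^ m) (Legendre_poly n)) t"

definition H_space :: "nat \<Rightarrow> real \<Rightarrow> (real \<Rightarrow> real) set"
  where "H_space m s = {u \<in> L2.
    (\<lambda>n. (2 * real n + 1) powr (2 * s) * \<bar>L2_inner u (assoc_Legendre m n)\<bar>^2)
      summable_on {m..}}"

definition H_norm :: "nat \<Rightarrow> real \<Rightarrow> (real \<Rightarrow> real) \<Rightarrow> real"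
  where "H_norm m s u = sqrt (\<Sum>\<^sub>\<infinity>n\<in>{m..}.
    (2 * real n + 1) powr (2 * s) * \<bar>L2_inner u (assoc_Legendre m n)\<bar>^2)"

text \<open>
  Test functions are extended by zero to the whole line, so that smoothness on the line is the same
  as smoothness on \<open>(-1,1)\<close>.
\<close>

definition test_functions :: "(real \<Rightarrow> real) set"
  where "test_functions = {\<phi>.
    (\<forall>n x. (deriv ^^ n) \<phi> field_differentiable at x) \<and>
    (\<exists>a b. -1 < a \<and> b < 1 \<and> (\<forall>x. x \<notin> {a..b} \<longrightarrow> \<phi> x = 0))}"

definition locally_integrable :: "(real \<Rightarrow> real) \<Rightarrow> bool"
  where "locally_integrable f \<longleftrightarrow>
    (\<forall>a b. -1 < a \<and> b < 1 \<longrightarrow> integrable (lebesgue_on {a..b}) f)"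

text \<open>
  Only the values of a distribution on \<open>test_functions\<close> matter. Continuity need not be imposed on
  the type: every distribution used below arises from a locally integrable function by
  differentiation and multiplication with a function that is smooth on \<open>(-1,1)\<close>.
\<close>

type_synonym distr = "(real \<Rightarrow> real) \<Rightarrow> real"

definition distr_of :: "(real \<Rightarrow> real) \<Rightarrow> distr"
  where "distr_of f \<phi> = (\<integral>t. f t * \<phi> t \<partial>mu)"

definition distr_deriv :: "nat \<Rightarrow> distr \<Rightarrow> distr"
  where "distr_deriv k T \<phi> = (-1)^k * T ((deriv ^^ k) \<phi>)"

definition distr_mult :: "(real \<Rightarrow> real) \<Rightarrow> distr \<Rightarrow> distr"
  where "distr_mult a T \<phi> = T (\<lambda>t. a t * \<phi> t)"

definition represented_by :: "distr \<Rightarrow> (real \<Rightarrow> real) \<Rightarrow> bool"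
  where "represented_by T g \<longleftrightarrow>
    locally_integrable g \<and> (\<forall>\<phi>\<in>test_functions. T \<phi> = distr_of g \<phi>)"

text \<open>
  The function identified with a regular distribution. It is determined up to equality almost
  everywhere on \<open>(-1,1)\<close>, and unspecified if the distribution is not regular.
\<close>

definition distr_fun :: "distr \<Rightarrow> real \<Rightarrow> real"
  where "distr_fun T = (SOME g. represented_by T g)"

text \<open>The distribution \<open>(\<omega>\<^sup>-\<^sup>m u)\<^sup>(\<^sup>k\<^sup>)\<close>.\<close>

definition weighted_deriv :: "nat \<Rightarrow> nat \<Rightarrow> (real \<Rightarrow> real) \<Rightarrow> distr"
  where "weighted_deriv m k u = distr_deriv k (distr_of (\<lambda>t. u t / omega t ^ m))"

definition X_space :: "nat \<Rightarrow> nat \<Rightarrow> (real \<Rightarrow> real) set"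
  where "X_space m k = {u \<in> L2. \<exists>f\<in>L2.
    represented_by (distr_mult (\<lambda>t. omega t ^ (m + k)) (weighted_deriv m k u)) f}"

text \<open>
  If \<open>u \<in> X_space m k\<close>, then \<open>weighted_deriv m k u\<close> is a regular distribution, since \<open>omega\<close> is
  smooth and positive on \<open>(-1,1)\<close>; thus the second integral below is meaningful and finite.
\<close>

definition energy :: "nat \<Rightarrow> nat \<Rightarrow> (real \<Rightarrow> real) \<Rightarrow> real"
  where "energy m k u =
    (real m + 1/2)^(2*k) * (\<integral>t. \<bar>u t\<bar>^2 \<partial>mu)
    + (\<integral>t. omega t ^ (2*(m + k)) * \<bar>distr_fun (weighted_deriv m k u) t\<bar>^2 \<partial>mu)"

end

theory Submission
  imports Defs "HOL-Real_Asymp.Real_Asymp"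
begin

text \<open>
  Let \<open>Q n m\<close> denote \<open>assoc_Legendre m n\<close> and \<open>P n\<close> denote \<open>Legendre_poly n\<close>. On \<open>(-1,1)\<close> the
  function \<open>Q n m / omega^m\<close> is a multiple of the \<open>m\<close>-th derivative of \<open>P n\<close>. Differentiating \<open>k\<close> times
  and multiplying by \<open>omega^(m+k)\<close> therefore gives a multiple of \<open>Q n (m+k)\<close>; the multiple is \<open>sqrt r\<close>
  with \<open>r = deriv_factor m k n\<close>, the product of \<open>(n-m-j)(n+m+j+1)\<close> over \<open>j < k\<close>. So if \<open>u\<close> has the
  coefficients \<open>a n\<close>, then \<open>omega^(m+k) (u/omega^m)^(k)\<close> must have the coefficients \<open>sqrt r * a n\<close> in the
  orthonormal basis \<open>Q n (m+k)\<close>, and by Parseval the energy is the sum of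
  \<open>((m+1/2)^(2k) + r) (a n)^2\<close>. Both summands of the weight are at most
  \<open>(n+1/2)^(2k) = 2^(-2k) (2n+1)^(2k)\<close>, because \<open>(n-m-j)(n+m+j+1) = (n+1/2)^2 - (m+j+1/2)^2\<close>; this is the
  upper bound. For \<open>n \<ge> m+k\<close> the factor \<open>r\<close> is bounded below by a multiple of \<open>(2n+1)^(2k)\<close>, and for the
  finitely many \<open>n\<close> with \<open>m \<le> n < m+k\<close>, where \<open>r = 0\<close>, the summand \<open>(m+1/2)^(2k) > 0\<close> suffices; this is
  the lower bound.

  Two points need analysis.

  The inclusion of \<open>H_space\<close> in \<open>X_space\<close> (\<open>H_subset_X\<close>): the theorem of Riesz and Fischer provides
  the function \<open>f\<close> with coefficients \<open>sqrt r * a n\<close>. Partial sums of \<open>u/omega^m\<close> are polynomials, which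
  can be integrated by parts against test functions, and both sides converge because \<open>u\<close> is the sum of
  its Legendre expansion (\<open>expansion\<close>). Completeness (\<open>assoc_Legendre_basis\<close>) follows from the
  approximation theorem of Weierstrass and the fundamental lemma of the calculus of variations. The
  same lemma makes the function in the definition of \<open>energy\<close> unique almost everywhere.

  The converse inclusion (\<open>X_coefficients\<close>): the coefficients of \<open>f = omega^(m+k) (u/omega^m)^(k)\<close> are
  found by testing with \<open>omega^(m+k)\<close> times a polynomial, which is no test function, for it reaches the
  end points. It is multiplied by smooth cutoffs \<open>exp (-1/(N (1-t^2) - 1))\<close>, extended by zero.
  A \<open>j\<close>-th derivative falling on the cutoff costs at most \<open>(1-t^2)^(-j)\<close>, uniformly in \<open>N\<close>. The
  polynomial that is differentiated contains the factor \<open>(1-t^2)^(m+k)\<close>, which leaves at least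
  \<open>(1-t^2)^m\<close> after \<open>k\<close> derivatives: enough to compensate \<open>1/omega^m\<close> and to apply dominated
  convergence. The limit is evaluated by the differentiated Legendre equation
  (\<open>higher_pderiv_weighted_Legendre_D\<close>).
\<close>

section \<open>Legendre polynomials and their derivatives\<close>

abbreviation weight_poly :: "real poly" where "weight_poly \<equiv> [:1, 0, -1:]"

lemma poly_weight_poly: "poly weight_poly t = 1 - t^2"
  by (simp add: power2_eq_square)

lemma poly_eqI_eval: "(\<And>x. poly p x = poly q x) \<Longrightarrow> p = (q::real poly)"
  by (simp add: poly_eq_poly_eq_iff[symmetric] fun_eq_iff)

lemma weight_poly_pderiv_power:
  "weight_poly * pderiv (weight_poly ^ n) = smult (- 2 * real n) ([:0, 1:] * weight_poly ^ n)"
proof (cases n)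
  case (Suc l)
  show ?thesis
    by (rule poly_eqI_eval) (simp add: Suc pderiv_power_Suc pderiv_pCons algebra_simps del:
        power_Suc, simp add: algebra_simps power2_eq_square)
qed (simp add: pderiv_1)

text \<open>
  With \<open>w = (1-t^2)^n\<close>, this is the equation \<open>(1-t^2) w' = -2nt w\<close> differentiated \<open>j+1\<close> times. It is
  the source of all differential equations for the Legendre polynomials used below.
\<close>

lemma Rodrigues_recurrence:
  "weight_poly * (pderiv ^^ Suc (Suc j)) (weight_poly ^ n) =
     smult (2 * (real j + 1 - real n)) ([:0, 1:] * (pderiv ^^ Suc j) (weight_poly ^ n))
     + smult ((real j + 1) * (real j - 2 * real n)) ((pderiv ^^ j) (weight_poly ^ n))"
proof (induction j)
  case 0
  have "pderiv (weight_poly * pderiv (weight_poly ^ n))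
      = pderiv (smult (- 2 * real n) ([:0, 1:] * weight_poly ^ n))"
    by (simp only: weight_poly_pderiv_power)
  hence *: "poly (pderiv (weight_poly * pderiv (weight_poly ^ n))) x
      = poly (pderiv (smult (- 2 * real n) ([:0, 1:] * weight_poly ^ n))) x" for x
    by simp
  show ?case
    by (rule poly_eqI_eval, insert *)
       (simp add: pderiv_mult pderiv_smult pderiv_add pderiv_minus pderiv_pCons algebra_simps)
next
  case (Suc j)
  define a b c where "a = (pderiv ^^ j) (weight_poly ^ n)" "b = pderiv a" "c = pderiv b"
  have "pderiv (weight_poly * c) = pderiv (smult (2 * (real j + 1 - real n)) ([:0, 1:] * b)
     + smult ((real j + 1) * (real j - 2 * real n)) a)"
    using Suc by (simp add: a_b_c_def)
  hence *: "poly (pderiv (weight_poly * c)) x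
      = poly (pderiv (smult (2 * (real j + 1 - real n)) ([:0, 1:] * b)
     + smult ((real j + 1) * (real j - 2 * real n)) a)) x" for x
    by simp
  have "weight_poly * pderiv c = smult (2 * (real (Suc j) + 1 - real n)) ([:0, 1:] * c)
     + smult ((real (Suc j) + 1) * (real (Suc j) - 2 * real n)) b"
    by (rule poly_eqI_eval, insert *)
       (simp add: pderiv_mult pderiv_smult pderiv_add pderiv_minus pderiv_pCons algebra_simps flip:
           a_b_c_def(2,3))
  then show ?case by (simp add: a_b_c_def)
qed

abbreviation Legendre_D :: "nat \<Rightarrow> nat \<Rightarrow> real poly"
  where "Legendre_D m n \<equiv> (pderiv ^^ m) (Legendre_poly n)"

lemma higher_pderiv_smult': "(pderiv ^^ j) (smult c p) = smult c ((pderiv ^^ j) (p :: real poly))"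
  by (induction j arbitrary: p) (simp_all add: pderiv_smult)

lemma Legendre_D_eq:
  "Legendre_D m n = smult ((-1)^n / (2^n * fact n)) ((pderiv ^^ (m + n)) (weight_poly ^ n))"
  by (simp add: Legendre_poly_def higher_pderiv_smult' funpow_add)

text \<open>
  Legendre's differential equation, differentiated \<open>m\<close> times.
\<close>

lemma Legendre_equation:
  "weight_poly * Legendre_D (Suc (Suc m)) n = smult (2 * (real m + 1)) ([:0, 1:] * Legendre_D (Suc m) n)
     - smult ((real n - real m) * (real n + real m + 1)) (Legendre_D m n)"
proof -
  have "Legendre_D i n = smult ((-1)^n / (2^n * fact n)) ((pderiv ^^ (i + n)) (weight_poly ^ n))" for i
    by (rule Legendre_D_eq)
  then show ?thesis
    using arg_cong[OF Rodrigues_recurrence[of "m + n" n], of "smult ((-1)^n / (2^n * fact n))"]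
    by (simp only: add_Suc mult_smult_right smult_add_right smult_smult)
       (simp add: algebra_simps smult_add_left smult_diff_left flip: smult_minus_left)
qed

text \<open>
  The self-adjoint form of the equation: multiplication by \<open>(1-t^2)^m\<close> turns its first two terms into
  one derivative. It moves a derivative from \<open>P^(m+1)\<close> back to \<open>P^(m)\<close>, at the price of an eigenvalue.
\<close>

lemma pderiv_weighted_Legendre_D:
  "pderiv (weight_poly ^ Suc m * Legendre_D (Suc m) n)
    = smult (- ((real n - real m) * (real n + real m + 1))) (weight_poly ^ m * Legendre_D m n)"
proof (rule poly_eqI_eval)
  fix x
  define A B C where "A = poly (Legendre_D m n) x" "B = poly (Legendre_D (Suc m) n) x"
      "C = poly (Legendre_D (Suc (Suc m)) n) x"
  define s where "s = poly weight_poly x"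
  have "s * C = 2 * (real m + 1) * x * B - (real n - real m) * (real n + real m + 1) * A"
    using arg_cong[OF Legendre_equation[of m n], of "\<lambda>p. poly p x"]
    unfolding A_B_C_def s_def by (simp add: algebra_simps)
  moreover have "poly (pderiv (weight_poly ^ Suc m * Legendre_D (Suc m) n)) x
      = s ^ m * (s * C) - 2 * (real m + 1) * x * s ^ m * B"
  proof -
    have "poly (pderiv weight_poly) x = - 2 * x" by (simp add: pderiv_pCons)
    then show ?thesis
      by (simp only: pderiv_mult pderiv_power_Suc poly_add poly_mult poly_power poly_smult)
         (simp add: A_B_C_def s_def[symmetric] algebra_simps del: poly_pCons)
  qed
  ultimately have "poly (pderiv (weight_poly ^ Suc m * Legendre_D (Suc m) n)) x
      = - ((real n - real m) * (real n + real m + 1)) * (s ^ m * A)"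
    by (simp only:) (simp add: algebra_simps)
  then show "poly (pderiv (weight_poly ^ Suc m * Legendre_D (Suc m) n)) x
      = poly (smult (- ((real n - real m) * (real n + real m
          + 1))) (weight_poly ^ m * Legendre_D m n)) x"
    by (simp only: A_B_C_def s_def poly_smult poly_mult poly_power)
qed

text \<open>
  The product of the eigenvalues met in lowering the order of the derivative from \<open>m+k\<close> to \<open>m\<close>. The
  factors are real, so that the product vanishes, rather than being truncated, for \<open>m \<le> n < m+k\<close>.
\<close>

definition deriv_factor :: "nat \<Rightarrow> nat \<Rightarrow> nat \<Rightarrow> real"
  where "deriv_factor m k n = (\<Prod>j<k. (real n - real (m + j)) * (real n + real (m + j) + 1))"

lemma higher_pderiv_weighted_Legendre_D:
  "(pderiv ^^ k) (weight_poly ^ (m + k) * Legendre_D (m + k) n)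
    = smult ((-1) ^ k * deriv_factor m k n) (weight_poly ^ m * Legendre_D m n)"
proof (induction k)
  case (Suc k)
  have "(pderiv ^^ Suc k) (weight_poly ^ (m + Suc k) * Legendre_D (m + Suc k) n)
      = (pderiv ^^ k) (pderiv (weight_poly ^ Suc (m + k) * Legendre_D (Suc (m + k)) n))"
    by (simp only: funpow_Suc_right o_apply add_Suc_right)
  also have "\<dots> = smult (- ((real n - real (m + k)) * (real n + real (m + k) + 1)))
      ((pderiv ^^ k) (weight_poly ^ (m + k) * Legendre_D (m + k) n))"
    by (simp only: pderiv_weighted_Legendre_D higher_pderiv_smult')
  finally show ?case
    by (simp only: Suc smult_smult) (simp add: deriv_factor_def algebra_simps)
qed (simp add: deriv_factor_def)

lemma degree_Legendre_D: "m \<le> n \<Longrightarrow> degree (Legendre_D m n) = n - m"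
proof -
  have 1: "degree ((pderiv ^^ j) p) = degree p - j" for j and p :: "real poly"
    by (induction j) (simp_all add: degree_pderiv)
  have "degree (weight_poly ^ n) = 2 * n" by (simp add: degree_power_eq)
  then show ?thesis by (simp add: Legendre_D_eq 1)
qed

text \<open>
  The leading coefficient of \<open>(1-t^2)^n\<close> is \<open>(-1)^n\<close>; its sign cancels the one in Rodrigues' formula.
\<close>

lemma Legendre_D_diag: "Legendre_D n n = [:fact (2 * n) / (2 ^ n * fact n):]"
proof -
  have "lead_coeff (weight_poly ^ n) = (-1) ^ n" by (simp add: lead_coeff_power)
  moreover have "degree (weight_poly ^ n) = 2 * n" by (simp add: degree_power_eq)
  ultimately have c: "coeff (weight_poly ^ n) (2 * n) = (-1) ^ n" by simp
  have "degree (Legendre_D n n) = 0" by (simp add: degree_Legendre_D)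
  then obtain a where a: "Legendre_D n n = [:a:]" by (meson degree_eq_zeroE)
  have "a = coeff (Legendre_D n n) 0" by (simp add: a)
  also have "\<dots> = fact (2 * n) / (2 ^ n * fact n)"
    unfolding Legendre_D_eq using c
    by (simp add: coeff_higher_pderiv pochhammer_fact mult_2[symmetric] flip: power_mult_distrib)
  finally show ?thesis using a by simp
qed

lemma Legendre_D_eq_0:
  assumes "n < m"
  shows "Legendre_D m n = 0"
proof -
  obtain j where j: "m = j + Suc n" using assms by (metis add.commute less_iff_Suc_add add_Suc_right)
  have "Legendre_D (Suc n) n = 0" using Legendre_D_diag[of n] by (simp add: pderiv_pCons)
  then show ?thesis unfolding j funpow_add o_apply by simp
qed

section \<open>Orthonormality of the associated Legendre functions\<close>

lemma mu_FTC:
  fixes F f :: "real \<Rightarrow> real"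
  assumes F: "\<And>x. (F has_real_derivative f x) (at x)" and f: "continuous_on UNIV f"
  shows "integrable mu f" "(\<integral>t. f t \<partial>mu) = F 1 - F (-1)"
proof -
  have fm [measurable]: "f \<in> borel_measurable lebesgue"
    using borel_measurable_continuous_onI[OF f] by (simp add: measurable_completion)
  have "has_bochner_integral lborel (\<lambda>x. f x * indicator {-1..1} x) (F 1 - F (-1))"
    by (rule has_bochner_integral_FTC_Icc_real)
       (use F f in \<open>auto intro: continuous_on_interior simp: continuous_on_eq_continuous_at\<close>)
  then have "has_bochner_integral lebesgue (\<lambda>x. f x * indicator {-1..1} x) (F 1 - F (-1))"
    by (auto simp: has_bochner_integral_iff integrable_completion integral_completion
        dest: borel_measurable_integrable)
  moreover have "AE x in lebesgue. f x * indicator {-1..1} x = f x * indicator {-1<..<1} x"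
  proof -
    have "{-1, 1::real} \<in> null_sets lebesgue"
      by (simp add: negligible_iff_null_sets[symmetric])
    then show ?thesis
      by (rule AE_I') (auto simp: indicator_def split: if_splits)
  qed
  ultimately have "has_bochner_integral lebesgue (\<lambda>x. f x * indicator {-1<..<1} x) (F 1 - F (-1))"
    by (subst (asm) has_bochner_integral_cong_AE)
       (auto intro!: borel_measurable_times borel_measurable_indicator fm)
  then have "has_bochner_integral mu f (F 1 - F (-1))"
    by (simp add: has_bochner_integral_restrict_space mult.commute)
  then show "integrable mu f" "(\<integral>t. f t \<partial>mu) = F 1 - F (-1)"
    by (auto simp: has_bochner_integral_iff)
qed

lemma continuous_on_poly_real [continuous_intros]: "continuous_on S (poly (p :: real poly))"
  by (intro continuous_at_imp_continuous_on) auto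

lemma
  shows integrable_mu_poly: "integrable mu (poly p)"
    and integral_mu_pderiv: "(\<integral>t. poly (pderiv p) t \<partial>mu) = poly p 1 - poly p (-1)"
proof -
  show "(\<integral>t. poly (pderiv p) t \<partial>mu) = poly p 1 - poly p (-1)"
    by (rule mu_FTC(2)) (auto intro: poly_DERIV continuous_intros)
  have "continuous_on UNIV (poly p)" by (rule continuous_intros)
  obtain F where F: "\<And>x. (F has_real_derivative poly p x) (at x)"
  proof -
    define q where "q = (\<Sum>i\<le>degree p. monom (coeff p i / real (Suc i)) (Suc i))"
    have "pderiv q = (\<Sum>i\<le>degree p. monom (coeff p i) i)"
      by (simp add: q_def higher_pderiv_sum[of 1, simplified] pderiv_monom)
    also have "\<dots> = p" by (rule poly_as_sum_of_monoms)
    finally show ?thesis using that[of "poly q"] poly_DERIV[of q] by simp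
  qed
  from mu_FTC(1)[OF this] show "integrable mu (poly p)" by (auto intro: continuous_intros)
qed

lemma integral_poly_smult: "(\<integral>t. poly (smult c p) t \<partial>mu) = c * (\<integral>t. poly p t \<partial>mu)"
proof -
  have "poly (smult c p) = (\<lambda>t. c * poly p t)" by auto
  then show ?thesis by (simp only: integral_mult_right_zero)
qed

text \<open>
  The derivative of \<open>t (1-t^2)^(n+1)\<close> integrates to zero and relates the integrals for \<open>n\<close> and \<open>n+1\<close>.
\<close>

lemma integral_weight:
  "(\<integral>t. poly (weight_poly ^ n) t \<partial>mu) = 2 ^ (2 * n + 1) * (fact n)\<^sup>2 / fact (2 * n + 1)"
proof (induction n)
  case 0
  have "(\<integral>t. poly (pderiv [:0, 1:]) t \<partial>mu) = 2" by (subst integral_mu_pderiv) simp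
  then show ?case by (simp add: pderiv_pCons)
next
  case (Suc n)
  have "pderiv (weight_poly ^ Suc n * [:0, 1:])
      = smult (2 * real n + 3) (weight_poly ^ Suc n) - smult (2 * (real n + 1)) (weight_poly ^ n)"
  proof (rule poly_eqI_eval)
    fix x
    have "poly (pderiv weight_poly) x = - 2 * x" by (simp add: pderiv_pCons)
    moreover have "x * x = 1 - poly weight_poly x" by simp
    ultimately show "poly (pderiv (weight_poly ^ Suc n * [:0, 1:])) x =
        poly (smult (2 * real n + 3) (weight_poly ^ Suc n) - smult (2 * (real n
            + 1)) (weight_poly ^ n)) x"
      by (simp only: pderiv_mult pderiv_power_Suc poly_add poly_mult poly_power poly_smult poly_diff)
         (simp add: pderiv_pCons algebra_simps)
  qed
  then have "(\<integral>t. poly (smult (2 * real n + 3) (weight_poly ^ Suc n) - smult (2 * (real n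
      + 1)) (weight_poly ^ n)) t \<partial>mu) = 0"
    using integral_mu_pderiv[of "weight_poly ^ Suc n * [:0, 1:]"] by simp
  then have "(2 * real n + 3) * (\<integral>t. poly (weight_poly ^ Suc n) t \<partial>mu)
      = 2 * (real n + 1) * (\<integral>t. poly (weight_poly ^ n) t \<partial>mu)"
    using integrable_mu_poly[of "weight_poly ^ Suc n"] integrable_mu_poly[of "weight_poly ^ n"]
    by (simp only: poly_diff poly_smult Bochner_Integration.integral_diff
        Bochner_Integration.integrable_mult_right integral_mult_right_zero)
  then have "(\<integral>t. poly (weight_poly ^ Suc n) t \<partial>mu)
      = 2 * (real n + 1) / (2 * real n + 3) * (\<integral>t. poly (weight_poly ^ n) t \<partial>mu)"
    by (simp add: field_simps)
  also have "\<dots> = 2 ^ (2 * Suc n + 1) * (fact (Suc n))\<^sup>2 / fact (2 * Suc n + 1)"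
    unfolding Suc by (simp add: divide_simps power2_eq_square) (simp add: algebra_simps)
  finally show ?case .
qed

text \<open>
  The eigenvalue is the ratio of consecutive normalization factors; this makes \<open>deriv_factor\<close> telescope
  to a quotient of factorials.
\<close>

lemma fact_ratio_Suc:
  assumes "Suc m \<le> n"
  shows "fact (n + Suc m) / fact (n - Suc m)
    = (real n - real m) * (real n + real m + 1) * (fact (n + m) / fact (n - m))"
proof -
  obtain i where i: "n = Suc m + i" using assms le_Suc_ex by blast
  then have "n - m = Suc i" "n - Suc m = i" by simp_all
  then show ?thesis by (simp add: i divide_simps)
qed

lemma deriv_factor_eq:
  "m + k \<le> n \<Longrightarrow> deriv_factor m k n = (fact (n + (m + k)) / fact (n - (m + k))) / (fact (n
      + m) / fact (n - m))"
proof (induction k)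
  case (Suc k)
  have "deriv_factor m (Suc k) n = (real n - real (m + k)) * (real n + real (m + k)
      + 1) * deriv_factor m k n"
    by (simp add: deriv_factor_def)
  also have "\<dots> = ((real n - real (m + k)) * (real n + real (m + k) + 1) * (fact (n + (m
      + k)) / fact (n - (m + k)))) / (fact (n + m) / fact (n - m))"
    using Suc by simp
  also have "\<dots> = (fact (n + (m + Suc k)) / fact (n - (m + Suc k))) / (fact (n + m) / fact (n - m))"
    using Suc.prems fact_ratio_Suc[of "m + k" n] by (simp only: add_Suc_right)
  finally show ?case .
qed (simp add: deriv_factor_def)

definition Legendre_I :: "nat \<Rightarrow> nat \<Rightarrow> nat \<Rightarrow> real"
  where "Legendre_I m n l = (\<integral>t. poly (weight_poly ^ m * Legendre_D m n * Legendre_D m l) t \<partial>mu)"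

text \<open>
  Integration by parts without boundary term, followed by the self-adjoint equation. Symmetry in \<open>n\<close>
  and \<open>l\<close> then gives orthogonality, and iteration from \<open>m = 0\<close> to \<open>m = n\<close> gives the norms, since the
  \<open>n\<close>-th derivative of \<open>P n\<close> is constant.
\<close>

lemma Legendre_I_Suc:
  "Legendre_I (Suc m) n l = (real n - real m) * (real n + real m + 1) * Legendre_I m n l"
proof -
  let ?c = "(real n - real m) * (real n + real m + 1)"
  have "pderiv (weight_poly ^ Suc m * Legendre_D (Suc m) n * Legendre_D m l)
      = weight_poly ^ Suc m * Legendre_D (Suc m) n * Legendre_D (Suc m) l
          - smult ?c (weight_poly ^ m * Legendre_D m n * Legendre_D m l)"
    unfolding pderiv_mult[of "weight_poly ^ Suc m * Legendre_D (Suc m) n"] pderiv_weighted_Legendre_D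
    by (simp only: mult_smult_left mult_smult_right) (simp add: mult_ac)
  moreover have "poly (weight_poly ^ Suc m * Legendre_D (Suc m) n * Legendre_D m l) x
      = 0" if "x = 1 \<or> x = -1" for x
    using that by auto
  ultimately have "(\<integral>t. poly (weight_poly ^ Suc m * Legendre_D (Suc m) n * Legendre_D (Suc m) l
      - smult ?c (weight_poly ^ m * Legendre_D m n * Legendre_D m l)) t \<partial>mu) = 0"
    using integral_mu_pderiv[of "weight_poly ^ Suc m * Legendre_D (Suc m) n * Legendre_D m l"]
        by (metis diff_self)
  then show ?thesis
    unfolding Legendre_I_def
    using integrable_mu_poly[of "weight_poly ^ Suc m * Legendre_D (Suc m) n * Legendre_D (Suc m) l"]
      integrable_mu_poly[of "weight_poly ^ m * Legendre_D m n * Legendre_D m l"]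
    by (simp only: poly_diff poly_smult Bochner_Integration.integral_diff
        Bochner_Integration.integrable_mult_right integral_mult_right_zero)
qed

lemma Legendre_I_commute: "Legendre_I m n l = Legendre_I m l n"
  by (simp add: Legendre_I_def mult_ac)

lemma Legendre_I_orthogonal: "n \<noteq> l \<Longrightarrow> Legendre_I m n l = 0"
proof -
  assume "n \<noteq> l"
  have "((real n - real m) * (real n + real m + 1) - (real l - real m) * (real l + real m
      + 1)) * Legendre_I m n l = 0"
    using Legendre_I_Suc[of m n l] Legendre_I_Suc[of m l n] Legendre_I_commute[of m n l]
        Legendre_I_commute[of "Suc m" n l]
    by (simp add: algebra_simps)
  moreover have "(real n - real m) * (real n + real m + 1) - (real l - real m) * (real l + real m + 1)
      = (real n - real l) * (real n + real l + 1)"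
    by (simp add: algebra_simps)
  ultimately show ?thesis using \<open>n \<noteq> l\<close> by auto
qed

lemma Legendre_I_diag: "Legendre_I m n n = deriv_factor 0 m n * Legendre_I 0 n n"
  by (induction m) (simp_all add: Legendre_I_Suc deriv_factor_def)

lemma Legendre_I_norm:
  "m \<le> n \<Longrightarrow> Legendre_I m n n = 2 / (2 * real n + 1) * (fact (n + m) / fact (n - m))"
proof -
  assume mn: "m \<le> n"
  have "Legendre_I n n n = (fact (2 * n) / (2 ^ n * fact n))\<^sup>2 * (\<integral>t. poly (weight_poly ^ n) t \<partial>mu)"
  proof -
    have "weight_poly ^ n * [:c:] * [:c:] = smult (c\<^sup>2) (weight_poly ^ n)" for c
      by (simp add: power2_eq_square mult_ac)
    then show ?thesis
      unfolding Legendre_I_def Legendre_D_diag by (simp only: integral_poly_smult)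
  qed
  also have "\<dots> = fact (2 * n) * (2 / (2 * real n + 1))"
    unfolding integral_weight by (simp add: divide_simps power2_eq_square)
        (simp add: power_mult_distrib power_add power_mult power2_eq_square algebra_simps flip: mult_2)
  finally have "fact (2 * n) * Legendre_I 0 n n = fact (2 * n) * (2 / (2 * real n + 1))"
    using Legendre_I_diag[of n n] deriv_factor_eq[of 0 n n] by (simp flip: mult_2)
  then have "Legendre_I 0 n n = 2 / (2 * real n + 1)"
    by (metis mult_cancel_left fact_nonzero)
  then show ?thesis using Legendre_I_diag[of m n] mn by (simp add: deriv_factor_eq mult.commute)
qed

abbreviation "norm_const m n \<equiv> sqrt ((2 * real n + 1) / 2 * (fact (n - m) / fact (n + m)))"

lemma assoc_Legendre_eq:
  "assoc_Legendre m n t = norm_const m n * omega t ^ m * poly (Legendre_D m n) t"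
  by (simp add: assoc_Legendre_def)

lemma omega_sq: "t \<in> {-1<..<1} \<Longrightarrow> (omega t)\<^sup>2 = poly weight_poly t"
  by (auto simp: omega_def power2_eq_square[symmetric] abs_square_le_1)

lemma omega_pow2: "t \<in> {-1<..<1} \<Longrightarrow> omega t ^ m * omega t ^ m = poly (weight_poly ^ m) t"
  by (simp only: poly_power omega_sq[symmetric] power_mult[symmetric] power_add[symmetric] mult_2)

lemma assoc_Legendre_prod:
  "t \<in> {-1<..<1} \<Longrightarrow> assoc_Legendre m n t * assoc_Legendre m l t
     = norm_const m n * norm_const m l * poly (weight_poly ^ m * Legendre_D m n * Legendre_D m l) t"
  by (simp only: poly_mult omega_pow2[symmetric] assoc_Legendre_eq mult_ac)

lemma assoc_Legendre_orthonormal: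
  assumes "m \<le> n" "m \<le> l"
  shows "(\<integral>t. assoc_Legendre m n t * assoc_Legendre m l t \<partial>mu) = (if n = l then 1 else 0)"
proof -
  have "(\<integral>t. assoc_Legendre m n t * assoc_Legendre m l t \<partial>mu)
      = norm_const m n * norm_const m l * Legendre_I m n l"
    unfolding Legendre_I_def integral_mult_right_zero[symmetric]
    by (rule Bochner_Integration.integral_cong) (simp_all add: assoc_Legendre_prod del: poly_mult)
  also have "\<dots> = (if n = l then 1 else 0)"
    using assms by (auto simp: Legendre_I_orthogonal Legendre_I_norm)
  finally show ?thesis .
qed

lemma norm_const_pos: "norm_const m n > 0"
  by (intro real_sqrt_gt_zero mult_pos_pos divide_pos_pos) auto

lemma deriv_factor_zero:
  assumes "m \<le> n" "n < m + k"
  shows "deriv_factor m k n = 0"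
proof -
  have "n - m \<in> {..<k}" "real n - real (m + (n - m)) = 0" using assms by auto
  then have "\<exists>j\<in>{..<k}. (real n - real (m + j)) * (real n + real (m + j) + 1) = 0"
    by (metis mult_zero_left)
  then show ?thesis unfolding deriv_factor_def by (intro prod_zero) auto
qed

lemma deriv_factor_nonneg: "m \<le> n \<Longrightarrow> deriv_factor m k n \<ge> 0"
  by (cases "n < m + k") (simp_all add: deriv_factor_eq deriv_factor_zero)

lemma norm_const_deriv_factor:
  "m + k \<le> n \<Longrightarrow> norm_const (m + k) n * sqrt (deriv_factor m k n) = norm_const m n"
  unfolding real_sqrt_mult[symmetric] by (simp add: deriv_factor_eq)

lemma deriv_factor_le:
  assumes "m \<le> n"
  shows "deriv_factor m k n \<le> (real n + 1/2) ^ (2 * k)"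
proof (cases "m + k \<le> n")
  case True
  have "deriv_factor m k n \<le> (\<Prod>j<k. (real n + 1/2)\<^sup>2)"
    unfolding deriv_factor_def
  proof (intro prod_mono conjI)
    fix j assume j: "j \<in> {..<k}"
    show "0 \<le> (real n - real (m + j)) * (real n + real (m + j) + 1)"
      using True j by (intro mult_nonneg_nonneg) auto
    have "(real n - real (m + j)) * (real n + real (m + j) + 1)
        = (real n + 1/2)\<^sup>2 - (real (m + j) + 1/2)\<^sup>2"
      by (simp add: power2_eq_square algebra_simps)
    then show "(real n - real (m + j)) * (real n + real (m + j) + 1) \<le> (real n + 1/2)\<^sup>2" by simp
  qed
  then show ?thesis by (simp add: power_mult)
next
  case False
  then show ?thesis using assms by (simp add: deriv_factor_zero)
qed

text \<open>
  Factor by factor: with \<open>K = m+k+1\<close>, \<open>x = n\<close> and \<open>y = m+j\<close>, one has \<open>2x+1 \<le> 2K(x-y)\<close> and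
  \<open>2x+1 \<le> 2(x+y+1)\<close>.
\<close>

lemma deriv_factor_ge:
  assumes "m + k \<le> n"
  shows "deriv_factor m k n \<ge> (1 / (4 * (real (m + k) + 1))) ^ k * (2 * real n + 1) ^ (2 * k)"
proof -
  define K where "K = real (m + k) + 1"
  have "(\<Prod>j<k. 1 / (4 * K) * (2 * real n + 1)\<^sup>2) \<le> deriv_factor m k n"
    unfolding deriv_factor_def
  proof (intro prod_mono conjI)
    fix j assume j: "j \<in> {..<k}"
    show "0 \<le> 1 / (4 * K) * (2 * real n + 1)\<^sup>2" by (simp add: K_def)
    define x y where "x = real n" "y = real (m + j)"
    have xy: "y + 1 \<le> x" "y + 2 \<le> K" "0 \<le> y" using assms j by (auto simp: x_y_def K_def)
    have "2 * x + 1 \<le> 2 * K * (x - y)"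
    proof -
      have "(y + 2) * (x - y) \<le> K * (x - y)" using xy by (intro mult_right_mono) auto
      moreover have "(y + 2) * (x - y) - (x + 1/2) = (y + 1) * (x - y - 1) + 1/2"
        by (simp add: algebra_simps)
      moreover have "0 \<le> (y + 1) * (x - y - 1)" using xy by simp
      ultimately show ?thesis by linarith
    qed
    moreover have "2 * x + 1 \<le> 2 * (x + y + 1)" using xy by simp
    ultimately have "(2 * x + 1) * (2 * x + 1) \<le> (2 * K * (x - y)) * (2 * (x + y + 1))"
      using xy by (intro mult_mono) auto
    then show "1 / (4 * K) * (2 * real n + 1)\<^sup>2 \<le> (real n - real (m + j)) * (real n + real (m + j) + 1)"
      using xy unfolding x_y_def[symmetric] by (simp add: field_simps power2_eq_square)
  qed
  then show ?thesis by (simp add: K_def power_mult power_mult_distrib power_divide)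
qed

text \<open>
  For \<open>n \<ge> m+k\<close> the second summand is large enough. For the other \<open>n\<close> it vanishes, but then
  \<open>2n+1 \<le> 2(m+k)+1\<close> and the first summand suffices.
\<close>

lemma norm_equivalence_constants:
  obtains C where "C > 0" "\<And>n. m \<le> n \<Longrightarrow> C * (2 * real n + 1) ^ (2 * k)
      \<le> (real m + 1/2) ^ (2 * k) + deriv_factor m k n"
proof -
  define C1 where "C1 = (1 / (4 * (real (m + k) + 1))) ^ k"
  (* For n < m + k the power (2 n + 1)^(2 k) is at most the denominator of C2. *)
  define C2 where "C2 = (real m + 1/2) ^ (2 * k) / (2 * real (m + k) + 1) ^ (2 * k)"
  have C1: "C1 > 0" and C2: "C2 > 0" by (auto simp: C1_def C2_def intro!: divide_pos_pos zero_less_power)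
  show thesis
  proof (rule that[of "min C1 C2"])
    show "min C1 C2 > 0" using C1 C2 by simp
    fix n assume mn: "m \<le> n"
    show "min C1 C2 * (2 * real n + 1) ^ (2 * k) \<le> (real m + 1/2) ^ (2 * k) + deriv_factor m k n"
    proof (cases "m + k \<le> n")
      case True
      have "min C1 C2 * (2 * real n + 1) ^ (2 * k) \<le> C1 * (2 * real n + 1) ^ (2 * k)"
        by (intro mult_right_mono) auto
      also have "\<dots> \<le> deriv_factor m k n" unfolding C1_def by (rule deriv_factor_ge[OF True])
      also have "\<dots> \<le> (real m + 1/2) ^ (2 * k) + deriv_factor m k n" by simp
      finally show ?thesis .
    next
      case False
      have "min C1 C2 * (2 * real n + 1) ^ (2 * k) \<le> C2 * (2 * real (m + k) + 1) ^ (2 * k)"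
        using False C2 by (intro mult_mono power_mono) auto
      also have "\<dots> = (real m + 1/2) ^ (2 * k)"
      proof -
        have "2 * real (m + k) + 1 \<noteq> 0" by (simp add: add_nonneg_eq_0_iff)
        then show ?thesis unfolding C2_def by simp
      qed
      also have "\<dots> \<le> (real m + 1/2) ^ (2 * k) + deriv_factor m k n"
        using deriv_factor_nonneg[OF mn] by simp
      finally show ?thesis .
    qed
  qed
qed

lemma half_power: "(real n + 1/2) ^ (2 * k) = (2 * real n + 1) ^ (2 * k) / 2 ^ (2 * k)"
  unfolding power_divide[symmetric] by (simp add: field_simps)

section \<open>Orthonormal expansions in square-integrable functions\<close>

definition square_int :: "'a measure \<Rightarrow> ('a \<Rightarrow> real) \<Rightarrow> bool"
  where "square_int M f \<longleftrightarrow> f \<in> borel_measurable M \<and> integrable M (\<lambda>x. (f x)\<^sup>2)"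

lemma square_int_measurable [measurable_dest]: "square_int M f \<Longrightarrow> f \<in> borel_measurable M"
  by (simp add: square_int_def)

lemma square_int_mult:
  assumes "square_int M f" "square_int M g"
  shows "integrable M (\<lambda>x. f x * g x)"
proof (rule Bochner_Integration.integrable_bound)
  show "integrable M (\<lambda>x. (f x)\<^sup>2 + (g x)\<^sup>2)" using assms by (auto simp: square_int_def)
  show "(\<lambda>x. f x * g x) \<in> borel_measurable M" using assms by (auto simp: square_int_def)
  have "\<bar>a * b\<bar> \<le> a\<^sup>2 + b\<^sup>2" for a b :: real
  proof -
    have "2 * (\<bar>a\<bar> * \<bar>b\<bar>) \<le> a\<^sup>2 + b\<^sup>2"
      using zero_le_power2[of "\<bar>a\<bar> - \<bar>b\<bar>"] by (simp add: power2_diff algebra_simps)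
    moreover have "0 \<le> \<bar>a\<bar> * \<bar>b\<bar>" by simp
    ultimately show ?thesis unfolding abs_mult by linarith
  qed
  then show "AE x in M. norm (f x * g x) \<le> norm ((f x)\<^sup>2 + (g x)\<^sup>2)" by
      (simp add: order_trans[OF _ abs_ge_self])
qed

lemma square_int_add: "square_int M f \<Longrightarrow> square_int M g \<Longrightarrow> square_int M (\<lambda>x. f x + g x)"
  using square_int_mult[of M f g] by (auto simp: square_int_def power2_sum mult.assoc)

lemma square_int_cmult: "square_int M f \<Longrightarrow> square_int M (\<lambda>x. c * f x)"
  by (auto simp: square_int_def power_mult_distrib)

lemma square_int_diff: "square_int M f \<Longrightarrow> square_int M g \<Longrightarrow> square_int M (\<lambda>x. f x - g x)"
  using square_int_add[of M f "\<lambda>x. (-1) * g x"] square_int_cmult[of M g "-1"] by simp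

lemma square_int_sum: "(\<And>i. i \<in> I \<Longrightarrow> square_int M (f i)) \<Longrightarrow> square_int M (\<lambda>x. \<Sum>i\<in>I. f i x)"
  by (induction I rule: infinite_finite_induct)
      (auto intro: square_int_add simp: square_int_def[of _ "\<lambda>x. 0"])

lemma (in finite_measure) square_int_const: "square_int M (\<lambda>x. c)"
  by (simp add: square_int_def)

lemma square_int_bound:
  assumes "square_int M g" "f \<in> borel_measurable M" "AE x in M. \<bar>f x\<bar> \<le> \<bar>g x\<bar>"
  shows "square_int M f"
  unfolding square_int_def
proof
  show "integrable M (\<lambda>x. (f x)\<^sup>2)"
    by (rule Bochner_Integration.integrable_bound[of _ "\<lambda>x. (g x)\<^sup>2"])
       (use assms in \<open>auto simp: square_int_def abs_le_square_iff\<close>)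
qed (rule assms)

text \<open>
  The integral of \<open>(t f + g)^2\<close> is a nonnegative quadratic polynomial in \<open>t\<close>; evaluate it at its minimum.
\<close>

lemma square_int_Cauchy_Schwarz:
  assumes f: "square_int M f" and g: "square_int M g"
  shows "(\<integral>x. f x * g x \<partial>M)\<^sup>2 \<le> (\<integral>x. (f x)\<^sup>2 \<partial>M) * (\<integral>x. (g x)\<^sup>2 \<partial>M)"
proof -
  define A B C where "A = (\<integral>x. (f x)\<^sup>2 \<partial>M)" "B = (\<integral>x. f x * g x \<partial>M)" "C = (\<integral>x. (g x)\<^sup>2 \<partial>M)"
  have fi: "integrable M (\<lambda>x. (f x)\<^sup>2)" and gi: "integrable M (\<lambda>x. (g x)\<^sup>2)"
    using assms by (auto simp: square_int_def)
  have q: "0 \<le> t\<^sup>2 * A + 2 * t * B + C" for t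
  proof -
    have "0 \<le> (\<integral>x. (t * f x + g x)\<^sup>2 \<partial>M)" by simp
    also have "\<dots> = (\<integral>x. t\<^sup>2 * (f x)\<^sup>2 + 2 * t * (f x * g x) + (g x)\<^sup>2 \<partial>M)"
      by (simp add: power2_sum power_mult_distrib algebra_simps)
    also have "\<dots> = t\<^sup>2 * A + 2 * t * B + C"
      using fi gi square_int_mult[OF f g] by (simp add: A_B_C_def)
    finally show ?thesis .
  qed
  show ?thesis unfolding A_B_C_def[symmetric]
  proof (cases "A = 0")
    case True
    then have "AE x in M. (f x)\<^sup>2 = 0"
      using integral_nonneg_eq_0_iff_AE[OF fi] by (simp add: A_B_C_def)
    then have "AE x in M. f x * g x = 0" by (rule eventually_mono) simp
    then have "B = 0" unfolding A_B_C_def by (rule integral_eq_zero_AE)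
    then show "B\<^sup>2 \<le> A * C" using True by simp
  next
    case False
    then have "A > 0" by (simp add: A_B_C_def order.not_eq_order_implies_strict)
    then have "0 \<le> C - B\<^sup>2 / A"
      using q[of "- B / A"] by (simp add: power2_eq_square field_simps)
    then show "B\<^sup>2 \<le> A * C" using \<open>A > 0\<close> by (simp add: field_simps)
  qed
qed

text \<open>
  The measure is finite so that convergence in square mean implies convergence in mean, on which the
  proof of the Riesz-Fischer theorem rests.
\<close>

locale orthonormal_sequence = finite_measure M for M :: "'a measure" +
  fixes e :: "nat \<Rightarrow> 'a \<Rightarrow> real"
  assumes square_int_e: "\<And>i. square_int M (e i)"
    and orthonormal: "\<And>i j. (\<integral>x. e i x * e j x \<partial>M) = (if i = j then 1 else 0)"
begin

definition partial_sum :: "(nat \<Rightarrow> real) \<Rightarrow> nat \<Rightarrow> 'a \<Rightarrow> real"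
  where "partial_sum a N x = (\<Sum>i<N. a i * e i x)"

lemma square_int_partial_sum: "square_int M (partial_sum a N)"
  unfolding partial_sum_def[abs_def] by (intro square_int_sum square_int_cmult square_int_e)

lemma integral_partial_sum_mult:
  assumes "square_int M g"
  shows "(\<integral>x. partial_sum a N x * g x \<partial>M) = (\<Sum>i<N. a i * (\<integral>x. e i x * g x \<partial>M))"
  using square_int_mult[OF square_int_e assms] by
      (simp add: partial_sum_def sum_distrib_right mult.assoc)

lemma integral_partial_sum_e: "(\<integral>x. partial_sum a N x * e j x \<partial>M) = (if j < N then a j else 0)"
  by (simp add: integral_partial_sum_mult[OF square_int_e] orthonormal if_distrib cong: if_cong)

lemma integral_partial_sum_sq: "(\<integral>x. (partial_sum a N x)\<^sup>2 \<partial>M) = (\<Sum>i<N. (a i)\<^sup>2)"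
proof -
  have "(\<integral>x. partial_sum a N x * partial_sum a N x \<partial>M)
      = (\<Sum>i<N. a i * (\<integral>x. partial_sum a N x * e i x \<partial>M))"
    using integral_partial_sum_mult[OF square_int_partial_sum, of a N a N] by (simp add: mult.commute)
  then show ?thesis by (simp add: integral_partial_sum_e power2_eq_square)
qed

lemma Bessel:
  assumes u: "square_int M u"
  defines "a \<equiv> \<lambda>i. \<integral>x. u x * e i x \<partial>M"
  shows "summable (\<lambda>i. (a i)\<^sup>2)"
proof (rule summableI_nonneg_bounded)
  fix N
  have ui: "integrable M (\<lambda>x. (u x)\<^sup>2)" and si: "integrable M (\<lambda>x. (partial_sum a N x)\<^sup>2)"
    using u square_int_partial_sum by (auto simp: square_int_def)
  have c: "(\<integral>x. partial_sum a N x * u x \<partial>M) = (\<Sum>i<N. (a i)\<^sup>2)"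
  proof -
    have "(\<integral>x. e i x * u x \<partial>M) = a i" for i by (simp add: a_def mult.commute)
    then show ?thesis by (simp add: integral_partial_sum_mult[OF u] power2_eq_square)
  qed
  have "0 \<le> (\<integral>x. (u x - partial_sum a N x)\<^sup>2 \<partial>M)" by simp
  also have "\<dots> = (\<integral>x. (u x)\<^sup>2 + (partial_sum a N x)\<^sup>2 - 2 * (partial_sum a N x * u x) \<partial>M)"
    by (simp add: power2_diff algebra_simps)
  also have "\<dots> = (\<integral>x. (u x)\<^sup>2 \<partial>M) - (\<Sum>i<N. (a i)\<^sup>2)"
    using ui si square_int_mult[OF square_int_partial_sum u] by (simp add: integral_partial_sum_sq c)
  finally show "(\<Sum>i<N. (a i)\<^sup>2) \<le> (\<integral>x. (u x)\<^sup>2 \<partial>M)" by simp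
qed simp

lemma integral_partial_sum_diff_sq:
  assumes "N \<le> K" "summable (\<lambda>i. (a i)\<^sup>2)"
  shows "(\<integral>x. (partial_sum a K x - partial_sum a N x)\<^sup>2 \<partial>M) \<le> (\<Sum>i. (a (i + N))\<^sup>2)"
proof -
  define b where "b i = (if i < N then 0 else a i)" for i
  have "partial_sum a K x - partial_sum a N x = partial_sum b K x" for x
  proof -
    have "partial_sum a K x = partial_sum a N x + (\<Sum>i\<in>{N..<K}. a i * e i x)"
      using assms(1) unfolding partial_sum_def by
          (simp add: lessThan_atLeast0 sum.atLeastLessThan_concat)
    moreover have "partial_sum b K x = partial_sum b N x + (\<Sum>i\<in>{N..<K}. b i * e i x)"
      using assms(1) unfolding partial_sum_def by
          (simp add: lessThan_atLeast0 sum.atLeastLessThan_concat)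
    moreover have "partial_sum b N x = 0" by (simp add: partial_sum_def b_def)
    moreover have "(\<Sum>i\<in>{N..<K}. b i * e i x) = (\<Sum>i\<in>{N..<K}. a i * e i x)"
      by (intro sum.cong) (auto simp: b_def)
    ultimately show ?thesis by simp
  qed
  then have "(\<integral>x. (partial_sum a K x - partial_sum a N x)\<^sup>2 \<partial>M) = (\<Sum>i<K. (b i)\<^sup>2)"
    by (simp add: integral_partial_sum_sq)
  also have "\<dots> = (\<Sum>i\<in>{N..<K}. (a i)\<^sup>2)"
    by (intro sum.mono_neutral_cong_right) (auto simp: b_def)
  also have "\<dots> = (\<Sum>i<K - N. (a (i + N))\<^sup>2)"
    using assms(1) by (intro sum.reindex_bij_witness[of _ "\<lambda>i. i + N" "\<lambda>i. i - N"]) auto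
  also have "\<dots> \<le> (\<Sum>i. (a (i + N))\<^sup>2)"
    using assms(2) by (intro sum_le_suminf) (auto intro: summable_ignore_initial_segment[where f
        = "\<lambda>i. (a i)\<^sup>2"])
  finally show ?thesis .
qed

text \<open>
  Along a subsequence with rapidly decreasing tails the differences of the partial sums have summable
  \<open>L\<^sup>1\<close> norms, so that the partial sums converge almost everywhere. Fatou's lemma bounds the square
  distance of the limit from every partial sum by the tail of the series.
\<close>

theorem Riesz_Fischer:
  assumes a: "summable (\<lambda>i. (a i)\<^sup>2)"
  shows "\<exists>f. square_int M f \<and> (\<forall>N. (\<integral>x. (f x - partial_sum a N x)\<^sup>2 \<partial>M) \<le> (\<Sum>i. (a (i + N))\<^sup>2))"
proof -
  define tail where "tail N = (\<Sum>i. (a (i + N))\<^sup>2)" for N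
  have tail_lim: "tail \<longlonglongrightarrow> 0"
    unfolding tail_def[abs_def] by (rule suminf_exist_split2[OF a])
  have "\<exists>r. strict_mono r \<and> (\<forall>j. tail (r j) \<le> (1/4) ^ j)"
  proof -
    have "\<exists>n. n > m \<and> tail n \<le> (1/4) ^ j" for m j
    proof -
      have "\<forall>\<^sub>F n in sequentially. tail n < (1/4) ^ j"
        using tail_lim by (rule order_tendstoD) simp
      then show ?thesis
        using eventually_gt_at_top[of m]
        by (metis (mono_tags, lifting) eventually_conj eventually_happens' less_imp_le sequentially_bot)
    qed
    then obtain nx where nx: "\<And>m j. nx m j > m" "\<And>m j. tail (nx m j) \<le> (1/4) ^ j" by metis
    (* Each index is chosen beyond the previous one, so that r is strictly increasing. *)
    define r where "r = rec_nat (nx 0 0) (\<lambda>j m. nx m (Suc j))"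
    have "r (Suc j) > r j" for j by (simp add: r_def nx)
    then have "strict_mono r" by (simp add: strict_mono_Suc_iff)
    moreover have "tail (r j) \<le> (1/4) ^ j" for j
    proof (cases j)
      case 0
      then show ?thesis using nx(2)[of 0 0] by (simp add: r_def)
    next
      case (Suc i)
      then show ?thesis using nx(2)[of "r i" "Suc i"] by (simp add: r_def del: power_Suc)
    qed
    ultimately show ?thesis by blast
  qed
  then obtain r where r: "strict_mono r" and tr: "\<And>j. tail (r j) \<le> (1/4) ^ j" by blast
  have S_meas [measurable]: "partial_sum a N \<in> borel_measurable M" for N
    using square_int_partial_sum square_int_measurable by blast
  define d where "d j x = \<bar>partial_sum a (r (Suc j)) x - partial_sum a (r j) x\<bar>" for j x
  define c where "c = sqrt (measure M (space M))"
  have d_int: "integrable M (d j)" and d_le: "(\<integral>x. d j x \<partial>M) \<le> c * (1/2) ^ j" for j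
  proof -
    have sd: "square_int M (d j)"
      by (rule square_int_bound[OF square_int_diff[OF square_int_partial_sum[of a
          "r (Suc j)"] square_int_partial_sum[of a "r j"]]])
         (auto simp: d_def[abs_def])
    show "integrable M (d j)" using square_int_mult[OF sd square_int_const[of 1]] by simp
    have "(\<integral>x. d j x * 1 \<partial>M)\<^sup>2 \<le> (\<integral>x. (d j x)\<^sup>2 \<partial>M) * (\<integral>x. 1\<^sup>2 \<partial>M)"
      by (rule square_int_Cauchy_Schwarz[OF sd square_int_const])
    also have "(\<integral>x. (d j x)\<^sup>2 \<partial>M) \<le> tail (r j)"
      unfolding d_def power2_abs tail_def
      by (rule integral_partial_sum_diff_sq[OF _ a])
          (use r in \<open>simp add: strict_mono_Suc_iff less_imp_le\<close>)
    also have "\<dots> \<le> (1/4) ^ j" by (rule tr)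
    finally have "(\<integral>x. d j x \<partial>M)\<^sup>2 \<le> (1/4) ^ j * measure M (space M)"
      by (simp add: mult_right_mono)
    also have "\<dots> = (c * (1/2) ^ j)\<^sup>2"
    proof -
      have "((1/2::real) ^ j)\<^sup>2 = ((1/2)\<^sup>2) ^ j" by (simp only: power_mult[symmetric] mult.commute)
      also have "\<dots> = (1/4) ^ j" by (simp add: power2_eq_square)
      finally show ?thesis by (simp add: c_def power_mult_distrib)
    qed
    finally show "(\<integral>x. d j x \<partial>M) \<le> c * (1/2) ^ j"
      by (rule power2_le_imp_le) (simp add: c_def)
  qed
  have d_meas [measurable]: "d j \<in> borel_measurable M" for j
    using d_int by (rule borel_measurable_integrable)
  have "(\<integral>\<^sup>+x. (\<Sum>j. ennreal (d j x)) \<partial>M) = (\<Sum>j. \<integral>\<^sup>+x. ennreal (d j x) \<partial>M)"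
    by (rule nn_integral_suminf) simp
  also have "\<dots> = (\<Sum>j. ennreal (\<integral>x. d j x \<partial>M))"
  proof -
    have "(\<integral>\<^sup>+x. ennreal (d j x) \<partial>M) = ennreal (\<integral>x. d j x \<partial>M)" for j
      by (rule nn_integral_eq_integral[OF d_int]) (simp add: d_def)
    then show ?thesis by (simp only:)
  qed
  also have "\<dots> \<le> (\<Sum>j. ennreal (c * (1/2) ^ j))"
    by (intro suminf_le ennreal_leI d_le) auto
  also have "\<dots> < \<infinity>"
  proof -
    have "summable (\<lambda>j. c * (1/2::real) ^ j)" by (intro summable_mult summable_geometric) simp
    then show ?thesis by (subst suminf_ennreal2) (auto simp: c_def)
  qed
  finally have fin: "(\<integral>\<^sup>+x. (\<Sum>j. ennreal (d j x)) \<partial>M) \<noteq> \<infinity>" by simp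
  have "AE x in M. (\<Sum>j. ennreal (d j x)) \<noteq> \<infinity>"
    by (rule nn_integral_PInf_AE[OF _ fin]) simp
  then have conv: "AE x in M. convergent (\<lambda>j. partial_sum a (r j) x)"
  proof (rule eventually_mono)
    fix x assume "(\<Sum>j. ennreal (d j x)) \<noteq> \<infinity>"
    then have "summable (\<lambda>j. d j x)" by (intro summable_suminf_not_top) (auto simp: d_def)
    then have "summable (\<lambda>j. partial_sum a (r (Suc j)) x - partial_sum a (r j) x)"
      unfolding d_def by (rule summable_rabs_cancel)
    then have "convergent (\<lambda>n. \<Sum>j<n. partial_sum a (r (Suc j)) x - partial_sum a (r j) x)"
      by (simp add: summable_iff_convergent)
    then have "convergent (\<lambda>n. partial_sum a (r n) x - partial_sum a (r 0) x)"
      using sum_lessThan_telescope[of "\<lambda>j. partial_sum a (r j) x"] by simp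
    then show "convergent (\<lambda>n. partial_sum a (r n) x)"
      by (simp only: convergent_diff_const_right_iff)
  qed
  define f where "f x = lim (\<lambda>j. partial_sum a (r j) x)" for x
  have f_meas [measurable]: "f \<in> borel_measurable M"
    unfolding f_def[abs_def] by (rule borel_measurable_lim_metric) (rule S_meas)
  have lim: "AE x in M. (\<lambda>j. partial_sum a (r j) x) \<longlonglongrightarrow> f x"
    using conv by (rule eventually_mono) (simp add: f_def convergent_LIMSEQ_iff)
  have nn: "(\<integral>\<^sup>+x. ennreal ((f x - partial_sum a N x)\<^sup>2) \<partial>M) \<le> ennreal (tail N)" for N
  proof -
    have "(\<integral>\<^sup>+x. ennreal ((f x - partial_sum a N x)\<^sup>2) \<partial>M)
        = (\<integral>\<^sup>+x. liminf (\<lambda>j. ennreal ((partial_sum a (r j) x - partial_sum a N x)\<^sup>2)) \<partial>M)"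
    proof (rule nn_integral_cong_AE, rule eventually_mono[OF lim])
      fix x assume "(\<lambda>j. partial_sum a (r j) x) \<longlonglongrightarrow> f x"
      then have "(\<lambda>j. ennreal ((partial_sum a (r j) x - partial_sum a N x)\<^sup>2))
          \<longlonglongrightarrow> ennreal ((f x - partial_sum a N x)\<^sup>2)"
        by (intro tendsto_intros)
      then show "ennreal ((f x - partial_sum a N x)\<^sup>2)
          = liminf (\<lambda>j. ennreal ((partial_sum a (r j) x - partial_sum a N x)\<^sup>2))"
        by (intro lim_imp_Liminf[symmetric]) auto
    qed
    also have "\<dots> \<le> liminf (\<lambda>j. \<integral>\<^sup>+x. ennreal ((partial_sum a (r j) x - partial_sum a N x)\<^sup>2) \<partial>M)"
      by (rule nn_integral_liminf) simp
    also have "\<dots> \<le> limsup (\<lambda>j. \<integral>\<^sup>+x. ennreal ((partial_sum a (r j) x - partial_sum a N x)\<^sup>2) \<partial>M)"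
      by (rule Liminf_le_Limsup) simp
    also have "\<dots> \<le> ennreal (tail N)"
    proof (rule Limsup_bounded, rule eventually_mono[OF eventually_ge_at_top[of N]])
      fix j assume "N \<le> j"
      then have "N \<le> r j" using seq_suble[OF r, of j] by simp
      have "(\<integral>\<^sup>+x. ennreal ((partial_sum a (r j) x - partial_sum a N x)\<^sup>2) \<partial>M)
          = ennreal (\<integral>x. (partial_sum a (r j) x - partial_sum a N x)\<^sup>2 \<partial>M)"
        using square_int_diff[OF square_int_partial_sum square_int_partial_sum, of a "r j" a N]
        by (intro nn_integral_eq_integral) (auto simp: square_int_def)
      also have "\<dots> \<le> ennreal (tail N)"
        unfolding tail_def by (intro ennreal_leI integral_partial_sum_diff_sq \<open>N \<le> r j\<close> a)
      finally show "(\<integral>\<^sup>+x. ennreal ((partial_sum a (r j) x - partial_sum a N x)\<^sup>2) \<partial>M)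
          \<le> ennreal (tail N)" .
    qed
    finally show ?thesis .
  qed
  have sq: "square_int M (\<lambda>x. f x - partial_sum a N x)" for N
    unfolding square_int_def
  proof
    show "integrable M (\<lambda>x. (f x - partial_sum a N x)\<^sup>2)"
      using le_less_trans[OF nn[of N]] by (intro integrableI_nonneg) auto
  qed simp
  show ?thesis
  proof (intro exI conjI allI)
    show "square_int M f" using square_int_add[OF sq[of 0] square_int_partial_sum[of a 0]] by simp
    fix N
    have "ennreal (\<integral>x. (f x - partial_sum a N x)\<^sup>2 \<partial>M) \<le> ennreal (tail N)"
      using nn[of N] sq[of N] by (subst nn_integral_eq_integral[symmetric]) (auto simp: square_int_def)
    moreover have "0 \<le> tail N" unfolding tail_def
      by (intro suminf_nonneg summable_ignore_initial_segment[where f = "\<lambda>i. (a i)\<^sup>2"] a) simp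
    ultimately show "(\<integral>x. (f x - partial_sum a N x)\<^sup>2 \<partial>M) \<le> (\<Sum>i. (a (i + N))\<^sup>2)"
      by (simp add: tail_def)
  qed
qed

text \<open>
  By the Cauchy-Schwarz inequality, convergence in square mean implies convergence of the integrals
  against any square-integrable function.
\<close>

corollary weak_Riesz_Fischer:
  assumes a: "summable (\<lambda>i. (a i)\<^sup>2)"
  shows "\<exists>f. square_int M f \<and> (\<forall>i. (\<integral>x. f x * e i x \<partial>M) = a i) \<and>
    (\<forall>g. square_int M g \<longrightarrow> (\<lambda>N. \<integral>x. partial_sum a N x * g x \<partial>M) \<longlonglongrightarrow> (\<integral>x. f x * g x \<partial>M))"
proof -
  obtain f where f: "square_int M f" "\<And>N. (\<integral>x. (f x - partial_sum a N x)\<^sup>2 \<partial>M) \<le> (\<Sum>i. (a (i + N))\<^sup>2)"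
    using Riesz_Fischer[OF a] by blast
  have lim: "(\<lambda>N. \<integral>x. partial_sum a N x * g x \<partial>M) \<longlonglongrightarrow> (\<integral>x. f x * g x \<partial>M)" if g: "square_int M g" for g
  proof -
    define D where "D N = (\<integral>x. f x * g x \<partial>M) - (\<integral>x. partial_sum a N x * g x \<partial>M)" for N
    have "(D N)\<^sup>2 \<le> (\<Sum>i. (a (i + N))\<^sup>2) * (\<integral>x. (g x)\<^sup>2 \<partial>M)" for N
    proof -
      have "D N = (\<integral>x. (f x - partial_sum a N x) * g x \<partial>M)"
        using square_int_mult[OF f(1) g] square_int_mult[OF square_int_partial_sum g] by
            (simp add: D_def left_diff_distrib)
      then have "(D N)\<^sup>2 \<le> (\<integral>x. (f x - partial_sum a N x)\<^sup>2 \<partial>M) * (\<integral>x. (g x)\<^sup>2 \<partial>M)"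
        using square_int_Cauchy_Schwarz[OF square_int_diff[OF f(1) square_int_partial_sum] g] by simp
      also have "\<dots> \<le> (\<Sum>i. (a (i + N))\<^sup>2) * (\<integral>x. (g x)\<^sup>2 \<partial>M)"
        by (intro mult_right_mono f) simp
      finally show ?thesis .
    qed
    then have "norm ((D N)\<^sup>2) \<le> (\<Sum>i. (a (i + N))\<^sup>2) * (\<integral>x. (g x)\<^sup>2 \<partial>M)" for N by simp
    then have "(\<lambda>N. (D N)\<^sup>2) \<longlonglongrightarrow> 0"
      by (rule Lim_null_comparison[OF always_eventually[OF allI]])
         (rule tendsto_mult_left_zero[OF suminf_exist_split2[OF a]])
    then have "D \<longlonglongrightarrow> 0" by (subst (asm) power_tendsto_0_iff) simp_all
    from tendsto_diff[OF tendsto_const[of "\<integral>x. f x * g x \<partial>M"] this]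
    show ?thesis by (simp add: D_def)
  qed
  have "(\<integral>x. f x * e j x \<partial>M) = a j" for j
  proof (rule LIMSEQ_unique[OF lim[OF square_int_e]])
    show "(\<lambda>N. \<integral>x. partial_sum a N x * e j x \<partial>M) \<longlonglongrightarrow> a j"
      by (rule tendsto_eventually, rule eventually_mono[OF eventually_gt_at_top[of j]])
         (simp add: integral_partial_sum_e)
  qed
  with f(1) lim show ?thesis by blast
qed

end

locale orthonormal_basis = orthonormal_sequence +
  assumes complete: "\<And>u. square_int M u \<Longrightarrow> (\<And>i. (\<integral>x. u x * e i x \<partial>M) = 0) \<Longrightarrow> AE x in M. u x = 0"
begin

text \<open>
  The Riesz-Fischer sum of the expansion has the same coefficients as \<open>u\<close>, hence equals \<open>u\<close> almost
  everywhere by completeness.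
\<close>

theorem expansion:
  assumes u: "square_int M u" and g: "square_int M g"
  defines "a \<equiv> \<lambda>i. \<integral>x. u x * e i x \<partial>M"
  shows "(\<lambda>N. \<integral>x. partial_sum a N x * g x \<partial>M) \<longlonglongrightarrow> (\<integral>x. u x * g x \<partial>M)"
proof -
  obtain f where f: "square_int M f" "\<And>i. (\<integral>x. f x * e i x \<partial>M) = a i"
    "\<And>g. square_int M g \<Longrightarrow> (\<lambda>N. \<integral>x. partial_sum a N x * g x \<partial>M) \<longlonglongrightarrow> (\<integral>x. f x * g x \<partial>M)"
    using weak_Riesz_Fischer[OF Bessel[OF u]] unfolding a_def by blast
  have "AE x in M. u x - f x = 0"
    using square_int_mult[OF u square_int_e] square_int_mult[OF f(1) square_int_e] f(2)
    by (intro complete square_int_diff u f(1)) (simp add: left_diff_distrib a_def)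
  then have "AE x in M. u x * g x = f x * g x" by (rule eventually_mono) simp
  then have "(\<integral>x. u x * g x \<partial>M) = (\<integral>x. f x * g x \<partial>M)"
    using u f(1) g by (intro integral_cong_AE) (auto simp: square_int_def)
  then show ?thesis using f(3)[OF g] by simp
qed

corollary Parseval:
  assumes u: "square_int M u"
  shows "(\<lambda>i. (\<integral>x. u x * e i x \<partial>M)\<^sup>2) sums (\<integral>x. (u x)\<^sup>2 \<partial>M)"
proof -
  have "(\<integral>x. e i x * u x \<partial>M) = (\<integral>x. u x * e i x \<partial>M)" for i by (simp add: mult.commute)
  then show ?thesis
    using expansion[OF u u] by (simp add: sums_def integral_partial_sum_mult[OF u] power2_eq_square)
qed

end

section \<open>Smooth functions and flat functions\<close>

text \<open>
  Recursion on the order, rather than a condition on all iterated derivatives, makes the closure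
  properties below straightforward inductions.
\<close>

fun differentiable_upto :: "nat \<Rightarrow> real set \<Rightarrow> (real \<Rightarrow> real) \<Rightarrow> bool" where
  "differentiable_upto 0 S f \<longleftrightarrow> True"
| "differentiable_upto (Suc k) S f \<longleftrightarrow> (\<forall>x\<in>S. f field_differentiable at x) \<and> differentiable_upto k S
    (deriv f)"

lemma differentiable_upto_iff:
  "differentiable_upto k S f \<longleftrightarrow> (\<forall>i<k. \<forall>x\<in>S. (deriv ^^ i) f field_differentiable at x)"
proof (induction k arbitrary: f)
  case (Suc k)
  have "differentiable_upto (Suc k) S f \<longleftrightarrow> (\<forall>x\<in>S. f field_differentiable at x)
      \<and> (\<forall>i<k. \<forall>x\<in>S. (deriv ^^ i) (deriv f) field_differentiable at x)"
    by (simp add: Suc)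
  moreover have "(deriv ^^ Suc i) f = (deriv ^^ i) (deriv f)" for i
    by (simp only: funpow_Suc_right o_apply)
  ultimately show ?case by (simp only: All_less_Suc2 funpow_0)
qed simp

lemma differentiable_upto_SucD: "differentiable_upto (Suc k) S f \<Longrightarrow> differentiable_upto k S f"
  by (simp add: differentiable_upto_iff)

lemma differentiable_upto_Un:
  "differentiable_upto k S f \<Longrightarrow> differentiable_upto k T f \<Longrightarrow> differentiable_upto k (S \<union> T) f"
  by (auto simp: differentiable_upto_iff)

lemma differentiable_upto_subset: "differentiable_upto k T f \<Longrightarrow> S \<subseteq> T \<Longrightarrow> differentiable_upto k S f"
  by (auto simp: differentiable_upto_iff)

lemma deriv_cong_open:
  assumes "open S" "x \<in> S" "\<And>y. y \<in> S \<Longrightarrow> f y = g y"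
  shows "deriv f x = (deriv g x :: real)"
  using assms by (intro deriv_cong_ev refl eventually_nhds_in_open[THEN eventually_mono])

lemma differentiable_upto_cong:
  assumes "open S" "\<And>x. x \<in> S \<Longrightarrow> f x = g x" "differentiable_upto k S f"
  shows "differentiable_upto k S g"
  using assms(2,3)
proof (induction k arbitrary: f g)
  case (Suc k)
  have "g field_differentiable at x" if x: "x \<in> S" for x
  proof -
    obtain D where "(f has_field_derivative D) (at x)"
      using Suc.prems(2) x unfolding differentiable_upto.simps field_differentiable_def by blast
    then have "(g has_field_derivative D) (at x)"
      using has_field_derivative_transform_within_open[OF _ assms(1) that, of f D g] Suc.prems(1)
          by blast
    then show ?thesis by (auto simp: field_differentiable_def)
  qed
  moreover have "differentiable_upto k S (deriv g)"
    by (rule Suc.IH[of "deriv f", OF deriv_cong_open[OF assms(1) _ Suc.prems(1)]])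
       (use Suc.prems(2) in simp_all)
  ultimately show ?case by simp
qed simp

lemma differentiable_upto_SucI:
  assumes "open S" "\<And>x. x \<in> S \<Longrightarrow> (f has_real_derivative f' x) (at x)" "differentiable_upto k S f'"
  shows "differentiable_upto (Suc k) S f"
proof -
  have "differentiable_upto k S (deriv f)"
    by (rule differentiable_upto_cong[OF assms(1) _ assms(3)]) (use DERIV_imp_deriv[OF assms(2)] in simp)
  then show ?thesis using assms(2) by (auto simp: field_differentiable_def)
qed

lemma differentiable_upto_Suc_derivative:
  "differentiable_upto (Suc k) S f \<Longrightarrow> x \<in> S \<Longrightarrow> (f has_real_derivative deriv f x) (at x)"
  by (simp add: DERIV_deriv_iff_field_differentiable)

lemma differentiable_upto_const: "open S \<Longrightarrow> differentiable_upto k S (\<lambda>x. c)"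
  by (induction k arbitrary: c) auto

lemma differentiable_upto_add:
  assumes "open S"
  shows "differentiable_upto k S f \<Longrightarrow> differentiable_upto k S g \<Longrightarrow> differentiable_upto k S (\<lambda>x. f x + g x)"
proof (induction k arbitrary: f g)
  case (Suc k)
  show ?case
  proof (rule differentiable_upto_SucI[OF assms, where f' = "\<lambda>x. deriv f x + deriv g x"])
    fix x assume "x \<in> S"
    show "((\<lambda>x. f x + g x) has_real_derivative deriv f x + deriv g x) (at x)"
      by (rule DERIV_add[OF differentiable_upto_Suc_derivative[OF Suc.prems(1) \<open>x \<in> S\<close>]
            differentiable_upto_Suc_derivative[OF Suc.prems(2) \<open>x \<in> S\<close>]])
  next
    show "differentiable_upto k S (\<lambda>x. deriv f x + deriv g x)"
      using Suc.prems by (intro Suc.IH) auto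
  qed
qed simp

lemma differentiable_upto_mult:
  assumes "open S"
  shows "differentiable_upto k S f \<Longrightarrow> differentiable_upto k S g \<Longrightarrow> differentiable_upto k S (\<lambda>x. f x * g x)"
proof (induction k arbitrary: f g)
  case (Suc k)
  show ?case
  proof (rule differentiable_upto_SucI[OF assms, where f' = "\<lambda>x. deriv f x * g x + deriv g x * f x"])
    fix x assume "x \<in> S"
    show "((\<lambda>x. f x * g x) has_real_derivative deriv f x * g x + deriv g x * f x) (at x)"
      by (rule DERIV_mult[OF differentiable_upto_Suc_derivative[OF Suc.prems(1) \<open>x \<in> S\<close>]
            differentiable_upto_Suc_derivative[OF Suc.prems(2) \<open>x \<in> S\<close>]])
  next
    show "differentiable_upto k S (\<lambda>x. deriv f x * g x + deriv g x * f x)"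
      using Suc.prems differentiable_upto_SucD[of k S f] differentiable_upto_SucD[of k S g]
      by (intro differentiable_upto_add[OF assms] Suc.IH) auto
  qed
qed simp

lemma differentiable_upto_compose:
  assumes "open S" "open T"
  shows "differentiable_upto k T f \<Longrightarrow> differentiable_upto k S h \<Longrightarrow> h ` S \<subseteq> T
      \<Longrightarrow> differentiable_upto k S (\<lambda>x. f (h x))"
proof (induction k arbitrary: f)
  case (Suc k)
  show ?case
  proof (rule differentiable_upto_SucI[OF assms(1), where f' = "\<lambda>x. deriv f (h x) * deriv h x"])
    fix x assume x: "x \<in> S"
    show "((\<lambda>x. f (h x)) has_real_derivative deriv f (h x) * deriv h x) (at x)"
      using Suc.prems(3) x
      by (intro DERIV_chain2[OF differentiable_upto_Suc_derivative[OF Suc.prems(1)]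
          differentiable_upto_Suc_derivative[OF Suc.prems(2)]]) auto
  next
    show "differentiable_upto k S (\<lambda>x. deriv f (h x) * deriv h x)"
    proof (rule differentiable_upto_mult[OF assms(1)])
      show "differentiable_upto k S (\<lambda>x. deriv f (h x))"
        using Suc.prems by (intro Suc.IH[OF _ differentiable_upto_SucD]) auto
      show "differentiable_upto k S (deriv h)" using Suc.prems(2) by simp
    qed
  qed
qed simp

lemma differentiable_upto_poly: "open S \<Longrightarrow> differentiable_upto k S (poly p)"
proof (induction k arbitrary: p)
  case (Suc k)
  show ?case by (rule differentiable_upto_SucI[OF Suc.prems, where f' = "poly (pderiv p)"])
      (auto intro: poly_DERIV Suc)
qed simp

lemma differentiable_upto_powr: "differentiable_upto k {0<..} (\<lambda>x. x powr a)"
proof (induction k arbitrary: a)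
  case (Suc k)
  have "open {0::real<..}" by simp
  then show ?case
  proof (rule differentiable_upto_SucI)
    show "((\<lambda>x. x powr a) has_real_derivative a * x powr (a - 1)) (at x)" if "x \<in> {0<..}" for x
      using that by (intro has_real_derivative_powr) auto
    show "differentiable_upto k {0<..} (\<lambda>x. a * x powr (a - 1))"
      by (intro differentiable_upto_mult differentiable_upto_const Suc) auto
  qed
qed simp

text \<open>
  For \<open>p = 1\<close> this is the classical smooth function that vanishes for \<open>x \<le> 0\<close>. Admitting a polynomial
  factor in \<open>1/x\<close> gives a family closed under differentiation.
\<close>

definition flat :: "real poly \<Rightarrow> real \<Rightarrow> real"
  where "flat p x = (if x > 0 then poly p (1 / x) * exp (- (1 / x)) else 0)"

definition flat_deriv :: "real poly \<Rightarrow> real poly"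
  where "flat_deriv p = [:0, 0, 1:] * (p - pderiv p)"

text \<open>
  This decay is what makes the derivative at the origin vanish.
\<close>

lemma poly_exp_decay: "((\<lambda>y. poly p y * exp (- y)) \<longlongrightarrow> (0::real)) at_top"
proof -
  have *: "((\<lambda>y. coeff p i * (y ^ i / exp y)) \<longlongrightarrow> 0) at_top" for i
    by (intro tendsto_mult_right_zero tendsto_power_div_exp_0)
  have "((\<lambda>y. \<Sum>i\<le>degree p. coeff p i * (y ^ i / exp y)) \<longlongrightarrow> (\<Sum>i\<le>degree p. 0)) at_top"
    by (intro tendsto_sum *)
  then show ?thesis by (simp add: poly_altdef sum_distrib_right exp_minus divide_inverse mult.assoc)
qed

lemma flat_DERIV: "(flat p has_real_derivative flat (flat_deriv p) x) (at x)"
proof -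
  consider "x > 0" | "x < 0" | "x = 0" by linarith
  then show ?thesis
  proof cases
    case 1
    have "((\<lambda>x. poly p (1 / x) * exp (- (1 / x))) has_real_derivative flat (flat_deriv p) x) (at x)"
      using 1 by (auto intro!: derivative_eq_intros DERIV_chain2[OF poly_DERIV]
          simp: flat_def flat_deriv_def power2_eq_square field_simps)
    then show ?thesis
      by (rule has_field_derivative_transform_within_open[of _ _ _ "{0<..}"])
          (use 1 in \<open>auto simp: flat_def\<close>)
  next
    case 2
    have "((\<lambda>x. 0) has_real_derivative flat (flat_deriv p) x) (at x)"
      using 2 by (auto simp: flat_def)
    then show ?thesis
      by (rule has_field_derivative_transform_within_open[of _ _ _ "{..<0}"])
          (use 2 in \<open>auto simp: flat_def\<close>)
  next
    case 3
    have "((\<lambda>h. flat p h / h) \<longlongrightarrow> 0) (at 0)"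
    proof (rule filterlim_split_at)
      show "((\<lambda>h. flat p h / h) \<longlongrightarrow> 0) (at_left 0)"
        by (rule tendsto_eventually) (auto simp: flat_def eventually_at_left[of
            "-1"] intro!: exI[of _ "-1"])
      have "((\<lambda>h. poly (p * [:0, 1:]) (inverse h) * exp (- inverse h)) \<longlongrightarrow> 0) (at_right (0::real))"
        by (rule filterlim_compose[OF poly_exp_decay filterlim_inverse_at_top_right])
      then show "((\<lambda>h. flat p h / h) \<longlongrightarrow> 0) (at_right 0)"
        by (rule Lim_transform_eventually)
           (auto simp: flat_def eventually_at_right[of _ 1] divide_inverse intro!: exI[of _ 1])
    qed
    then show ?thesis using 3 by (simp add: DERIV_def flat_def)
  qed
qed

lemma differentiable_upto_flat: "differentiable_upto k UNIV (flat p)"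
proof (induction k arbitrary: p)
  case (Suc k)
  show ?case by (rule differentiable_upto_SucI[OF open_UNIV flat_DERIV Suc])
qed simp

section \<open>Test functions\<close>

lemma weight_pos: "t \<in> {-1<..<1} \<Longrightarrow> 0 < 1 - t\<^sup>2" for t :: real
proof -
  assume "t \<in> {-1<..<1}"
  then have "\<bar>t\<bar> < 1" by auto
  then have "t\<^sup>2 < 1" by (simp only: abs_square_less_1)
  then show ?thesis by simp
qed

lemma test_functions_iff:
  "\<phi> \<in> test_functions \<longleftrightarrow> (\<forall>k. differentiable_upto k UNIV \<phi>) \<and>
     (\<exists>a b. -1 < a \<and> b < 1 \<and> (\<forall>x. x \<notin> {a..b} \<longrightarrow> \<phi> x = 0))"
  unfolding test_functions_def differentiable_upto_iff by auto

lemma test_function_deriv: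
  assumes "\<phi> \<in> test_functions"
  shows "deriv \<phi> \<in> test_functions"
proof -
  obtain a b where ab: "-1 < a" "b < 1" "\<And>x. x \<notin> {a..b} \<Longrightarrow> \<phi> x = 0"
    using assms by (auto simp: test_functions_iff)
  have "differentiable_upto k UNIV (deriv \<phi>)" for k
    using assms differentiable_upto.simps(2)[of k UNIV \<phi>] unfolding test_functions_iff by blast
  moreover have "deriv \<phi> x = 0" if "x \<notin> {a..b}" for x
    using deriv_cong_open[of "- {a..b}" x \<phi> "\<lambda>_. 0"] ab(3) that by (auto simp: open_Compl)
  ultimately show ?thesis using ab unfolding test_functions_iff by blast
qed

lemma test_function_higher_deriv: "\<phi> \<in> test_functions \<Longrightarrow> (deriv ^^ k) \<phi> \<in> test_functions"
  by (induction k) (auto intro: test_function_deriv)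

lemma test_function_DERIV: "\<phi> \<in> test_functions \<Longrightarrow> (\<phi> has_real_derivative deriv \<phi> x) (at x)"
  unfolding test_functions_iff by (blast intro: differentiable_upto_Suc_derivative)

lemma test_function_continuous: "\<phi> \<in> test_functions \<Longrightarrow> continuous_on S \<phi>"
  by (meson test_function_DERIV DERIV_continuous continuous_at_imp_continuous_on)

text \<open>
  Outside the support of the test function the product vanishes identically, so that smoothness of the
  multiplier on \<open>(-1,1)\<close> suffices. This covers all powers of \<open>omega\<close>, positive and negative.
\<close>

lemma test_function_mult:
  assumes \<phi>: "\<phi> \<in> test_functions" and w: "\<And>k. differentiable_upto k {-1<..<1} w"
  shows "(\<lambda>x. w x * \<phi> x) \<in> test_functions"
proof -
  obtain a b where ab: "-1 < a" "b < 1" "\<And>x. x \<notin> {a..b} \<Longrightarrow> \<phi> x = 0"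
    using \<phi> by (auto simp: test_functions_iff)
  have "differentiable_upto k UNIV (\<lambda>x. w x * \<phi> x)" for k
  proof -
    have "differentiable_upto k {-1<..<1} (\<lambda>x. w x * \<phi> x)"
      by (rule differentiable_upto_mult[OF _ w])
          (use \<phi> in \<open>auto simp: test_functions_iff intro: differentiable_upto_subset\<close>)
    moreover have "differentiable_upto k (- {a..b}) (\<lambda>x. w x * \<phi> x)"
      by (rule differentiable_upto_cong[where f = "\<lambda>x. 0"])
          (auto simp: open_Compl ab(3) intro!: differentiable_upto_const)
    ultimately have "differentiable_upto k ({-1<..<1} \<union> - {a..b}) (\<lambda>x. w x * \<phi> x)"
        by (rule differentiable_upto_Un)
    moreover have "{-1<..<1} \<union> - {a..b} = UNIV" using ab by auto
    ultimately show ?thesis by simp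
  qed
  moreover have "w x * \<phi> x = 0" if "x \<notin> {a..b}" for x using ab(3)[OF that] by simp
  ultimately show ?thesis using ab(1,2) unfolding test_functions_iff by blast
qed

lemma differentiable_upto_weight_powr: "differentiable_upto k {-1<..<1} (\<lambda>t. (1 - t\<^sup>2) powr a)"
proof (rule differentiable_upto_compose[of "{-1<..<1}" "{0<..}", OF _ _ differentiable_upto_powr])
  show "differentiable_upto k {-1<..<1} (\<lambda>t. 1 - t\<^sup>2)"
    by (rule differentiable_upto_cong[OF _ _ differentiable_upto_poly[of "{-1<..<1}" k "[:1, 0, -1:]"]])
       (simp_all add: power2_eq_square)
  show "(\<lambda>t. 1 - t\<^sup>2) ` {-1<..<1} \<subseteq> {0::real<..}"
    using weight_pos by auto
qed auto

lemma omega_pos: "t \<in> {-1<..<1} \<Longrightarrow> omega t > 0"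
  using weight_pos by (simp add: omega_def)

lemma omega_power_powr: "t \<in> {-1<..<1} \<Longrightarrow> omega t ^ j = (1 - t\<^sup>2) powr (real j / 2)"
proof -
  assume "t \<in> {-1<..<1}"
  then have "0 < 1 - t\<^sup>2" by (rule weight_pos)
  then show ?thesis
    by (simp add: omega_def powr_half_sqrt[symmetric] powr_realpow[symmetric] powr_powr)
qed

lemma differentiable_upto_omega_power: "differentiable_upto k {-1<..<1} (\<lambda>t. omega t ^ j)"
  by (rule differentiable_upto_cong[OF _ _ differentiable_upto_weight_powr[of k "real j / 2"]])
      (auto simp: omega_power_powr)

lemma differentiable_upto_omega_power_inverse:
  "differentiable_upto k {-1<..<1} (\<lambda>t. 1 / omega t ^ j)"
  by (rule differentiable_upto_cong[OF _ _ differentiable_upto_weight_powr[of k "- (real j / 2)"]])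
     (auto simp: omega_power_powr powr_minus_divide)

section \<open>The fundamental lemma of the calculus of variations\<close>

text \<open>
  The measures with densities \<open>max 0 h\<close> and \<open>max 0 (-h)\<close> agree on all half-lines, hence are equal.
  The function \<open>h\<close> is first replaced by a Borel measurable one.
\<close>

lemma AE_zero_if_half_line_integrals_zero:
  fixes h :: "real \<Rightarrow> real"
  assumes h: "integrable lebesgue h" and z: "\<And>x. (\<integral>t. h t * indicator {x<..} t \<partial>lebesgue) = 0"
  shows "AE t in lebesgue. h t = 0"
proof -
  obtain g where g [measurable]: "g \<in> borel_measurable lborel" and hg: "AE t in lborel. h t = g t"
    using completion_ex_borel_measurable_real[of h lborel] h by (auto dest: borel_measurable_integrable)
  have hgc: "AE t in lebesgue. h t = g t" using hg by (rule AE_completion)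
  have gl [measurable]: "g \<in> borel_measurable lebesgue" using g by (rule measurable_completion)
  have gi: "integrable lborel g"
    using h hgc gl borel_measurable_integrable[OF h] integrable_cong_AE[of h lebesgue g]
        integrable_completion[OF g] by simp
  have gz: "(\<integral>t. g t * indicator {x<..} t \<partial>lborel) = 0" for x
  proof -
    have "(\<integral>t. g t * indicator {x<..} t \<partial>lborel) = (\<integral>t. g t * indicator {x<..} t \<partial>lebesgue)"
      by (rule integral_completion[symmetric]) measurable
    also have "\<dots> = (\<integral>t. h t * indicator {x<..} t \<partial>lebesgue)"
      using hgc borel_measurable_integrable[OF h]
      by (intro integral_cong_AE borel_measurable_times borel_measurable_indicator gl) auto
    finally show ?thesis using z by simp
  qed
  define P Q where "P = density lborel (\<lambda>t. ennreal (max 0 (g t)))"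
      "Q = density lborel (\<lambda>t. ennreal (max 0 (- g t)))"
  have int: "integrable lborel (\<lambda>t. max 0 (g t) * indicator {x<..} t)"
    "integrable lborel (\<lambda>t. max 0 (- g t) * indicator {x<..} t)" for x
    by (rule Bochner_Integration.integrable_bound[OF gi]; auto simp: indicator_def)+
  have P: "emeasure P {x<..} = ennreal (\<integral>t. max 0 (g t) * indicator {x<..} t \<partial>lborel)" for x
    unfolding P_Q_def
    by (subst emeasure_density)
       (auto simp: nn_integral_eq_integral[OF int(1), symmetric] ennreal_mult' ennreal_indicator)
  have Q: "emeasure Q {x<..} = ennreal (\<integral>t. max 0 (- g t) * indicator {x<..} t \<partial>lborel)" for x
    unfolding P_Q_def
    by (subst emeasure_density)
       (auto simp: nn_integral_eq_integral[OF int(2), symmetric] ennreal_mult' ennreal_indicator)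
  have "P = Q"
  proof (rule measure_eqI_lessThan)
    fix x
    have "(\<integral>t. max 0 (g t) * indicator {x<..} t \<partial>lborel)
        - (\<integral>t. max 0 (- g t) * indicator {x<..} t \<partial>lborel)
        = (\<integral>t. g t * indicator {x<..} t \<partial>lborel)"
      unfolding Bochner_Integration.integral_diff[OF int, symmetric]
      by (intro Bochner_Integration.integral_cong) (auto simp: indicator_def max_def)
    then show "emeasure P {x<..} = emeasure Q {x<..}" unfolding P Q gz by simp
    show "emeasure P {x<..} < \<infinity>" unfolding P by simp
  qed (simp_all add: P_Q_def)
  then have "AE t in lborel. ennreal (max 0 (g t)) = ennreal (max 0 (- g t))"
    unfolding P_Q_def by (subst (asm) sigma_finite_measure.density_unique_iff[OF
        sigma_finite_lborel]) auto
  then have "AE t in lborel. g t = 0"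
    by (rule eventually_mono) (auto simp: max_def split: if_splits)
  then have "AE t in lborel. h t = 0" using hg by eventually_elim simp
  then show ?thesis by (rule AE_completion)
qed

lemma integrable_mu_iff: "integrable mu f \<longleftrightarrow> integrable lebesgue (\<lambda>t. f t * indicator {-1<..<1} t)"
  for f :: "real \<Rightarrow> real"
  by (simp add: integrable_restrict_space mult.commute)

lemma integral_mu_eq: "(\<integral>t. f t \<partial>mu) = (\<integral>t. f t * indicator {-1<..<1} t \<partial>lebesgue)"
  for f :: "real \<Rightarrow> real"
  by (simp add: integral_restrict_space mult.commute)

lemma locally_integrableD:
  assumes "locally_integrable g" "-1 < a" "b < 1"
  shows "integrable mu (\<lambda>t. g t * indicator {a..b} t)"
proof -
  have "integrable lebesgue (\<lambda>t. g t * indicator {a..b} t)"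
    using assms by (auto simp: locally_integrable_def integrable_restrict_space mult.commute)
  also have "(\<lambda>t. g t * indicator {a..b} t) = (\<lambda>t. g t * indicator {a..b} t * indicator {-1<..<1} t)"
    using assms by (auto simp: indicator_def fun_eq_iff)
  finally show ?thesis unfolding integrable_mu_iff .
qed

lemma flat_1_bounds: "0 \<le> flat 1 x" "flat 1 x \<le> 1"
  by (auto simp: flat_def)

text \<open>
  These functions approximate the indicator function of \<open>(c,d)\<close> pointwise and boundedly as \<open>n\<close> grows.
\<close>

lemma bump_test_function:
  assumes "-1 < c" "d < 1" "n > 0"
  shows "(\<lambda>x. flat 1 (real n * (x - c)) * flat 1 (real n * (d - x))) \<in> test_functions"
proof -
  have "differentiable_upto k UNIV (\<lambda>x. flat 1 (real n * (x - c)) * flat 1 (real n * (d - x)))" for k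
  proof (rule differentiable_upto_mult)
    show "differentiable_upto k UNIV (\<lambda>x. flat 1 (real n * (x - c)))"
      by (rule differentiable_upto_compose[OF _ _ differentiable_upto_flat
          differentiable_upto_cong[OF _ _
              differentiable_upto_poly[of UNIV k "[:- real n * c, real n:]"]]])
         (simp_all add: algebra_simps)
    show "differentiable_upto k UNIV (\<lambda>x. flat 1 (real n * (d - x)))"
      by (rule differentiable_upto_compose[OF _ _ differentiable_upto_flat
          differentiable_upto_cong[OF _ _
              differentiable_upto_poly[of UNIV k "[:real n * d, - real n:]"]]])
         (simp_all add: algebra_simps)
  qed simp
  moreover have "flat 1 (real n * (x - c)) * flat 1 (real n * (d - x)) = 0" if "x \<notin> {c..d}" for x
    using that assms(3) by (auto simp: flat_def zero_less_mult_iff)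
  ultimately show ?thesis unfolding test_functions_iff using assms by blast
qed

lemma flat_1_limit: "(\<lambda>n. flat 1 (real n * x)) \<longlonglongrightarrow> indicator {0<..} x"
proof (cases "x > 0")
  case True
  have "(\<lambda>n. exp (- (inverse (real n) * (1 / x)))) \<longlonglongrightarrow> exp (- (0 * (1 / x)))"
    by (intro tendsto_intros lim_inverse_n)
  then have "(\<lambda>n. flat 1 (real n * x)) \<longlonglongrightarrow> exp (- (0 * (1 / x)))"
    by (rule Lim_transform_eventually)
       (use True in \<open>auto simp: flat_def field_simps intro!: eventually_mono[OF
           eventually_gt_at_top[of 0]]\<close>)
  then show ?thesis using True by simp
next
  case False
  then have "flat 1 (real n * x) = 0" for n by (auto simp: flat_def zero_less_mult_iff)
  then show ?thesis using False by simp
qed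

text \<open>
  Dominated convergence along the bump functions shows that \<open>g\<close> integrates to zero over every interval
  that stays away from the end points. Restricted to the intervals \<open>(-c,c)\<close> with \<open>c < 1\<close>, \<open>g\<close> then has
  vanishing integrals over half-lines.
\<close>

theorem fundamental_lemma_of_variations:
  assumes g: "locally_integrable g" and z: "\<And>\<phi>. \<phi> \<in> test_functions \<Longrightarrow> (\<integral>t. g t * \<phi> t \<partial>mu) = 0"
  shows "AE t in mu. g t = 0"
proof -
  have interval: "(\<integral>t. g t * indicator {c<..<d} t \<partial>mu) = 0" if cd: "-1 < c" "d < 1" for c d
  proof -
    define \<phi> where "\<phi> n x = flat 1 (real (Suc n) * (x - c)) * flat 1 (real (Suc n) * (d - x))" for n x
    have test: "\<phi> n \<in> test_functions" for n
      unfolding \<phi>_def[abs_def] using cd by (intro bump_test_function) auto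
    have gi: "integrable mu (\<lambda>t. g t * indicator {c..d} t)" using locally_integrableD[OF g cd] .
    have eq: "g t * \<phi> n t = g t * indicator {c..d} t * \<phi> n t" for n t
      by (auto simp: \<phi>_def flat_def indicator_def zero_less_mult_iff)
    have gm [measurable]: "(\<lambda>t. g t * indicator {c..d} t) \<in> borel_measurable mu"
      using gi by (rule borel_measurable_integrable)
    have \<phi>m [measurable]: "\<phi> n \<in> borel_measurable mu" for n
      using test_function_continuous[OF test[of n], of "{-1<..<1}"]
      by (simp add: continuous_imp_measurable_on_sets_lebesgue)
    have "(\<lambda>n. \<integral>t. g t * indicator {c..d} t * \<phi> n t \<partial>mu) \<longlonglongrightarrow> (\<integral>t. g t * indicator {c<..<d} t \<partial>mu)"
    proof (rule integral_dominated_convergence[where w = "\<lambda>t. \<bar>g t * indicator {c..d} t\<bar>"])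
      have "(\<lambda>t. (g t * indicator {c..d} t) * indicator {c<..<d} t) \<in> borel_measurable mu"
        using cd by (intro borel_measurable_times gm borel_measurable_indicator)
           (auto simp: sets_restrict_space_iff)
      moreover have "(\<lambda>t. (g t * indicator {c..d} t) * indicator {c<..<d} t)
          = (\<lambda>t. g t * indicator {c<..<d} t)"
        by (auto simp: indicator_def)
      ultimately show "(\<lambda>t. g t * indicator {c<..<d} t) \<in> borel_measurable mu" by simp
      have "(\<lambda>n. g t * indicator {c..d} t * \<phi> n t)
          \<longlonglongrightarrow> g t * indicator {c..d} t * (indicator {0<..} (t - c) * indicator {0<..} (d - t))" for t
        unfolding \<phi>_def by (intro tendsto_intros LIMSEQ_Suc[OF flat_1_limit])
      moreover have "indicator {c..d} t * (indicator {0<..} (t - c) * indicator {0<..} (d - t))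
          = (indicator {c<..<d} t :: real)" for t
        by (auto simp: indicator_def)
      ultimately show "AE t in mu. (\<lambda>n. g t * indicator {c..d} t * \<phi> n t) \<longlonglongrightarrow> g t * indicator {c<..<d} t"
        by (simp add: mult.assoc)
      have "\<bar>\<phi> n t\<bar> \<le> 1" for n t
        unfolding \<phi>_def abs_mult by (intro mult_le_one) (auto simp: flat_1_bounds)
      then show "AE t in mu. norm (g t * indicator {c..d} t * \<phi> n t) \<le> \<bar>g t * indicator {c..d} t\<bar>" for n
        by (simp add: abs_mult[of "_ * _" "\<phi> n _"] mult_left_le)
    qed (use gi in auto)
    moreover have "(\<integral>t. g t * indicator {c..d} t * \<phi> n t \<partial>mu) = 0" for n
      using z[OF test[of n]] by (simp only: eq)
    ultimately show ?thesis by (simp add: LIMSEQ_const_iff)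
  qed
  (* Symmetric intervals exhausting (-1,1); the shift by 2 keeps c 0 positive. *)
  define c where "c j = 1 - 1 / real (j + 2)" for j :: nat
  have c: "0 < c j" "c j < 1" for j by (simp_all add: c_def field_simps)
  have "AE t in lebesgue. g t * indicator {- c j<..<c j} t = 0" for j
  proof (rule AE_zero_if_half_line_integrals_zero)
    have i1: "integrable lebesgue (\<lambda>t. g t * indicator {- c j..c j} t * indicator {-1<..<1} t)"
      using locally_integrableD[OF g, of "- c j" "c j"] c[of j] by (simp add: integrable_mu_iff)
    have i2: "integrable lebesgue (\<lambda>t. indicator {- c j<..<c j} t *\<^sub>R (g t
        * indicator {- c j..c j} t * indicator {-1<..<1} t))"
      by (intro integrable_mult_indicator i1) auto
    have eq: "(\<lambda>t. indicator {- c j<..<c j} t *\<^sub>R (g t * indicator {- c j..c j} t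
        * indicator {-1<..<1} t)) = (\<lambda>t. g t * indicator {- c j<..<c j} t)"
      using c[of j] by (auto simp: indicator_def fun_eq_iff)
    show "integrable lebesgue (\<lambda>t. g t * indicator {- c j<..<c j} t)" using i2 unfolding eq .
    fix x
    have "(\<integral>t. g t * indicator {- c j<..<c j} t * indicator {x<..} t \<partial>lebesgue)
        = (\<integral>t. g t * indicator {max x (- c j)<..<c j} t * indicator {-1<..<1} t \<partial>lebesgue)"
      using c[of j] by (intro Bochner_Integration.integral_cong) (auto simp: indicator_def)
    also have "\<dots> = (\<integral>t. g t * indicator {max x (- c j)<..<c j} t \<partial>mu)" by (simp add: integral_mu_eq)
    also have "\<dots> = 0" using c[of j] by (intro interval) auto
    finally show "(\<integral>t. g t * indicator {- c j<..<c j} t * indicator {x<..} t \<partial>lebesgue) = 0" .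
  qed
  then have "AE t in lebesgue. \<forall>j. g t * indicator {- c j<..<c j} t = 0"
    unfolding AE_all_countable by blast
  then have "AE t in lebesgue. t \<in> {-1<..<1} \<longrightarrow> g t = 0"
  proof (rule eventually_mono, intro impI)
    fix t :: real assume *: "\<forall>j. g t * indicator {- c j<..<c j} t = 0" and "t \<in> {-1<..<1}"
    then have "0 < 1 - \<bar>t\<bar>" by auto
    then obtain j where "inverse (real (Suc j)) < 1 - \<bar>t\<bar>" using reals_Archimedean by blast
    moreover have "1 / real (j + 2) \<le> inverse (real (Suc j))" by (simp add: field_simps)
    ultimately have "\<bar>t\<bar> < c j" by (simp add: c_def)
    then have "t \<in> {- c j<..<c j}" by auto
    with * show "g t = 0" by (metis indicator_simps(1) mult.right_neutral)
  qed
  then show ?thesis by (simp add: AE_restrict_space_iff)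
qed

section \<open>Completeness of the associated Legendre functions\<close>

text \<open>
  Polynomials of degrees \<open>0, 1, 2, \<dots>\<close> span all polynomials. Stated for linear functionals because it is
  applied to integration against a fixed function.
\<close>

lemma linear_functional_zero_of_degree_basis:
  fixes L :: "real poly \<Rightarrow> real" and b :: "nat \<Rightarrow> real poly"
  assumes add: "\<And>p q. L (p + q) = L p + L q" and smult: "\<And>c p. L (smult c p) = c * L p"
    and deg: "\<And>i. degree (b i) = i" and nz: "\<And>i. b i \<noteq> 0" and zero: "\<And>i. L (b i) = 0"
  shows "L p = 0"
proof (induction "degree p" arbitrary: p rule: less_induct)
  case less
  define c where "c = lead_coeff p / lead_coeff (b (degree p))"
  define q where "q = p - smult c (b (degree p))"
  have lc: "lead_coeff (b (degree p)) \<noteq> 0" using nz by simp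
  have "L q = 0"
  proof (cases "degree p = 0")
    case True
    then have "q = 0"
      using deg[of 0] lc unfolding q_def c_def
      by (intro poly_eqI) (metis (no_types, lifting) coeff_diff coeff_eq_0 coeff_0 coeff_smult deg
          diff_self
          eq_divide_eq gr0I less_irrefl mult_zero_right)
    then show ?thesis using smult[of 0 q] by simp
  next
    case False
    have "degree q \<le> degree p" unfolding q_def
      by (metis degree_diff_le degree_smult_le deg order_refl)
    moreover have "coeff q (degree p) = 0"
      using lc by (simp add: q_def c_def deg)
    ultimately have "degree q < degree p"
      using False by (metis (no_types) le_neq_implies_less leading_coeff_0_iff degree_0)
    then show ?thesis by (rule less)
  qed
  moreover have "L p = L (q + smult c (b (degree p)))" by (simp add: q_def)
  ultimately show ?case by (simp only: add smult zero)
qed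

lemma finite_measure_mu: "finite_measure mu"
  by (rule finite_measure_lebesgue_on) simp

lemma L2_iff_square_int: "u \<in> L2 \<longleftrightarrow> square_int mu u"
  by (simp add: L2_def square_int_def)

lemma continuous_measurable_mu:
  "continuous_on {-1<..<1} g \<Longrightarrow> g \<in> borel_measurable mu" for g :: "real \<Rightarrow> real"
  by (rule continuous_imp_measurable_on_sets_lebesgue) auto

lemma continuous_bounded_interval:
  assumes "continuous_on {-1..1::real} (g :: real \<Rightarrow> real)"
  obtains B where "B > 0" "\<And>t. t \<in> {-1<..<1} \<Longrightarrow> \<bar>g t\<bar> \<le> B"
proof -
  have "bounded (g ` {-1..1})"
    using assms by (intro compact_imp_bounded compact_continuous_image) auto
  then obtain B where "B > 0" "\<forall>x\<in>g ` {-1..1}. norm x \<le> B" using bounded_pos by blast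
  then show thesis by (intro that[of B]) auto
qed

lemma square_int_continuous:
  assumes "continuous_on {-1..1} (g :: real \<Rightarrow> real)"
  shows "square_int mu g"
proof -
  obtain B where "B > 0" "\<And>t. t \<in> {-1<..<1} \<Longrightarrow> \<bar>g t\<bar> \<le> B"
    by (rule continuous_bounded_interval[OF assms]) blast
  then show ?thesis
    by (intro square_int_bound[OF finite_measure.square_int_const[OF finite_measure_mu, of B]]
        continuous_measurable_mu continuous_on_subset[OF assms]) auto
qed

lemma square_int_integrable_mu: "square_int mu u \<Longrightarrow> integrable mu u"
  using square_int_mult[of mu u "\<lambda>_. 1"] finite_measure.square_int_const[OF finite_measure_mu, of 1]
      by simp

lemma integrable_mult_continuous:
  fixes v g :: "real \<Rightarrow> real"
  assumes v: "integrable mu v" and g: "continuous_on {-1..1} g"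
  shows "integrable mu (\<lambda>t. v t * g t)"
proof -
  obtain B where B: "B > 0" "\<And>t. t \<in> {-1<..<1} \<Longrightarrow> \<bar>g t\<bar> \<le> B"
    by (rule continuous_bounded_interval[OF g]) blast
  show ?thesis
  proof (rule Bochner_Integration.integrable_bound[OF integrable_mult_right[OF v, of B]])
    show "(\<lambda>t. v t * g t) \<in> borel_measurable mu"
      by (intro borel_measurable_times[OF borel_measurable_integrable[OF v]]
          continuous_measurable_mu continuous_on_subset[OF g]) auto
    show "AE t in mu. norm (v t * g t) \<le> norm (B * v t)"
      using B by (intro AE_I2) (auto simp: abs_mult mult.commute intro!: mult_right_mono)
  qed
qed

lemma continuous_omega_power: "continuous_on S (\<lambda>t. omega t ^ m)"
  unfolding omega_def by (intro continuous_intros)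

lemma square_int_assoc_Legendre: "square_int mu (assoc_Legendre m n)"
  by (rule square_int_continuous)
     (auto simp: assoc_Legendre_eq[abs_def] intro!: continuous_intros continuous_omega_power)

lemma locally_integrable_integrable:
  assumes "integrable mu v"
  shows "locally_integrable v"
  unfolding locally_integrable_def
proof (intro allI impI)
  fix a b :: real assume ab: "-1 < a \<and> b < 1"
  have "integrable lebesgue (\<lambda>t. indicator {a..b} t *\<^sub>R (v t * indicator {-1<..<1} t))"
    using assms by (intro integrable_mult_indicator) (auto simp: integrable_mu_iff)
  also have "(\<lambda>t. indicator {a..b} t *\<^sub>R (v t * indicator {-1<..<1} t))
      = (\<lambda>t. indicator {a..b} t *\<^sub>R v t)"
    using ab by (auto simp: indicator_def fun_eq_iff)
  finally show "integrable (lebesgue_on {a..b}) v" by (simp add: integrable_restrict_space)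
qed

text \<open>
  By the theorem of Weierstrass the integrals against test functions vanish as well, as these are
  continuous on \<open>[-1,1]\<close>.
\<close>

lemma AE_zero_if_moments_zero:
  assumes v: "integrable mu v" and z: "\<And>p. (\<integral>t. v t * poly p t \<partial>mu) = 0"
  shows "AE t in mu. v t = 0"
proof (rule fundamental_lemma_of_variations[OF locally_integrable_integrable[OF v]])
  fix \<phi> assume \<phi>: "\<phi> \<in> test_functions"
  define I where "I = (\<integral>t. \<bar>v t\<bar> \<partial>mu)"
  have I: "I \<ge> 0" by (simp add: I_def)
  have "\<bar>\<integral>t. v t * \<phi> t \<partial>mu\<bar> \<le> e" if e: "e > 0" for e
  proof -
    have "e / (I + 1) > 0" using e I by simp
    then obtain g where g: "real_polynomial_function g" "\<And>x. x \<in> {-1..1} \<Longrightarrow> \<bar>\<phi> x - g x\<bar> < e / (I + 1)"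
      using Stone_Weierstrass_real_polynomial_function[of "{-1..1}" \<phi> "e / (I + 1)"]
        test_function_continuous[OF \<phi>] by auto
    obtain a n where "g = (\<lambda>x. \<Sum>i\<le>n. a i * x ^ i)"
      using g(1) unfolding real_polynomial_function_iff_sum by blast
    then have gp: "g = poly (\<Sum>i\<le>n. monom (a i) i)"
      by (simp add: poly_sum poly_monom fun_eq_iff)
    have i: "integrable mu (\<lambda>t. v t * \<phi> t)" "integrable mu (\<lambda>t. v t * g t)"
      using test_function_continuous[OF \<phi>] gp
      by (auto intro!: integrable_mult_continuous[OF v] continuous_intros)
    have "(\<integral>t. v t * \<phi> t \<partial>mu) = (\<integral>t. v t * \<phi> t - v t * g t \<partial>mu)"
      using i z[of "\<Sum>i\<le>n. monom (a i) i"] by (simp flip: gp)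
    also have "\<bar>\<dots>\<bar> \<le> (\<integral>t. \<bar>v t * \<phi> t - v t * g t\<bar> \<partial>mu)"
      by (rule integral_abs_bound)
    also have "\<dots> \<le> (\<integral>t. \<bar>v t\<bar> * (e / (I + 1)) \<partial>mu)"
    proof (rule integral_mono)
      show "integrable mu (\<lambda>t. \<bar>v t * \<phi> t - v t * g t\<bar>)" using i by auto
      show "integrable mu (\<lambda>t. \<bar>v t\<bar> * (e / (I + 1)))" using v by auto
      fix t assume "t \<in> space mu"
      then have "\<bar>\<phi> t - g t\<bar> \<le> e / (I + 1)" using g(2)[of t] by simp
      then show "\<bar>v t * \<phi> t - v t * g t\<bar> \<le> \<bar>v t\<bar> * (e / (I + 1))"
        unfolding right_diff_distrib[symmetric] abs_mult by (rule mult_left_mono) simp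
    qed
    also have "\<dots> = I * (e / (I + 1))" by (simp add: I_def)
    also have "\<dots> \<le> e" using e I by (simp add: field_simps)
    finally show ?thesis .
  qed
  then show "(\<integral>t. v t * \<phi> t \<partial>mu) = 0"
    using field_le_epsilon[of "\<bar>\<integral>t. v t * \<phi> t \<partial>mu\<bar>" 0] by simp
qed

text \<open>
  A function orthogonal to all \<open>assoc_Legendre m (m + i)\<close>, multiplied by \<open>omega^m\<close>, is orthogonal to the
  \<open>m\<close>-th derivatives of the Legendre polynomials. These have the degrees \<open>0, 1, 2, \<dots>\<close>, hence all
  moments vanish.
\<close>

lemma assoc_Legendre_basis: "orthonormal_basis mu (\<lambda>i. assoc_Legendre m (m + i))"
proof -
  interpret finite_measure mu by (rule finite_measure_mu)
  show ?thesis
  proof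
    show "square_int mu (assoc_Legendre m (m + i))" for i by (rule square_int_assoc_Legendre)
    show "(\<integral>x. assoc_Legendre m (m + i) x * assoc_Legendre m (m + j) x \<partial>mu) = (if i
        = j then 1 else 0)" for i j
      by (simp add: assoc_Legendre_orthonormal)
  next
    fix u assume u: "square_int mu u" and z: "\<And>i. (\<integral>x. u x * assoc_Legendre m (m + i) x \<partial>mu) = 0"
    define v where "v t = u t * omega t ^ m" for t
    have v: "integrable mu v"
      unfolding v_def[abs_def]
      by (intro integrable_mult_continuous square_int_integrable_mu u continuous_omega_power)
    define L where "L p = (\<integral>t. v t * poly p t \<partial>mu)" for p
    have vp: "integrable mu (\<lambda>t. v t * poly p t)" for p
      by (intro integrable_mult_continuous v continuous_intros)
    have "L p = 0" for p
    proof (rule linear_functional_zero_of_degree_basis[of L "\<lambda>i. Legendre_D m (m + i)"])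
      show "L (p + q) = L p + L q" for p q
        using vp by (simp add: L_def distrib_left)
      show "L (smult c p) = c * L p" for c p
        by (simp add: L_def mult.left_commute[of _ c])
      show "degree (Legendre_D m (m + i)) = i" for i by (simp add: degree_Legendre_D)
      show "Legendre_D m (m + i) \<noteq> 0" for i
      proof
        assume "Legendre_D m (m + i) = 0"
        then have "assoc_Legendre m (m + i) t = 0" for t by (simp add: assoc_Legendre_eq)
        then show False using assoc_Legendre_orthonormal[of m "m + i" "m + i"] by simp
      qed
      fix i
      have "norm_const m (m + i) * L (Legendre_D m (m + i)) = (\<integral>x. u x * assoc_Legendre m (m + i) x \<partial>mu)"
        unfolding L_def v_def integral_mult_right_zero[symmetric]
        by (rule Bochner_Integration.integral_cong) (simp_all add: assoc_Legendre_eq mult_ac)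
      also have "\<dots> = 0" by (rule z)
      finally have "norm_const m (m + i) * L (Legendre_D m (m + i)) = 0" .
      then show "L (Legendre_D m (m + i)) = 0" using norm_const_pos[where m = m and n = "m + i"]
          by (metis less_irrefl mult_eq_0_iff)
    qed
    then have "AE t in mu. v t = 0" using AE_zero_if_moments_zero[OF v] by (simp add: L_def)
    moreover have "AE t in mu. t \<in> {-1<..<1}" by (rule AE_I2) simp
    ultimately show "AE t in mu. u t = 0"
      by eventually_elim (use omega_pos in \<open>force simp: v_def\<close>)
  qed
qed

section \<open>Cutoff functions with controlled derivatives\<close>

abbreviation weight :: "real \<Rightarrow> real" where "weight t \<equiv> 1 - t\<^sup>2"

text \<open>
  A sequence is of weight \<open>d\<close> if it is \<open>O((1-t^2)^d)\<close> uniformly in \<open>n\<close>, and converges pointwise: the two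
  ingredients of a dominated convergence argument.
\<close>

definition weighted_bound :: "real \<Rightarrow> (nat \<Rightarrow> real \<Rightarrow> real) \<Rightarrow> (real \<Rightarrow> real) \<Rightarrow> bool"
  where "weighted_bound d g G \<longleftrightarrow> (\<exists>C. \<forall>n. \<forall>t\<in>{-1<..<1}. \<bar>g n t\<bar> \<le> C * weight t powr d)
    \<and> (\<forall>t\<in>{-1<..<1}. (\<lambda>n. g n t) \<longlonglongrightarrow> G t)"

text \<open>
  Each of the first \<open>k\<close> derivatives lowers the weight by one. Polynomials have weight \<open>0\<close> and
  powers \<open>(1-t^2)^j\<close> have weight \<open>j\<close> in this sense, and weights add up in products. The whole estimate
  of the cutoff procedure is thus reduced to the weights of its factors, without an explicit Leibniz
  formula.
\<close>

fun weighted_conv :: "nat \<Rightarrow> real \<Rightarrow> (nat \<Rightarrow> real \<Rightarrow> real) \<Rightarrow> (real \<Rightarrow> real) \<Rightarrow> bool" where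
  "weighted_conv 0 d g G \<longleftrightarrow> weighted_bound d g G"
| "weighted_conv (Suc k) d g G \<longleftrightarrow> weighted_bound d g G \<and> (\<exists>g' G'.
     (\<forall>n. \<forall>t\<in>{-1<..<1}. (g n has_real_derivative g' n t) (at t)) \<and>
     (\<forall>t\<in>{-1<..<1}. (G has_real_derivative G' t) (at t)) \<and> weighted_conv k (d - 1) g' G')"

lemma weighted_conv_SucD: "weighted_conv (Suc k) d g G \<Longrightarrow> weighted_conv k d g G"
proof (induction k arbitrary: d g G)
  case (Suc k)
  from Suc.prems obtain g' G' where
    "weighted_bound d g G" "\<forall>n. \<forall>t\<in>{-1<..<1}. (g n has_real_derivative g' n t) (at t)"
    "\<forall>t\<in>{-1<..<1}. (G has_real_derivative G' t) (at t)" "weighted_conv (Suc k) (d - 1) g' G'"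
    unfolding weighted_conv.simps(2)[of "Suc k"] by blast
  with Suc.IH[of "d - 1" g' G'] show ?case unfolding weighted_conv.simps(2)[of k] by blast
qed simp

lemma weighted_conv_SucI:
  assumes "weighted_bound d g G" "\<And>n t. t \<in> {-1<..<1} \<Longrightarrow> (g n has_real_derivative g' n t) (at t)"
    "\<And>t. t \<in> {-1<..<1} \<Longrightarrow> (G has_real_derivative G' t) (at t)" "weighted_conv k (d - 1) g' G'"
  shows "weighted_conv (Suc k) d g G"
  unfolding weighted_conv.simps using assms by blast

lemma weighted_conv_SucE:
  assumes "weighted_conv (Suc k) d g G"
  obtains g' G' where "weighted_bound d g G" "\<And>n t. t \<in> {-1<..<1}
      \<Longrightarrow> (g n has_real_derivative g' n t) (at t)"
    "\<And>t. t \<in> {-1<..<1} \<Longrightarrow> (G has_real_derivative G' t) (at t)" "weighted_conv k (d - 1) g' G'"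
  using assms unfolding weighted_conv.simps by blast

lemma weighted_boundI:
  assumes "\<And>n t. t \<in> {-1<..<1} \<Longrightarrow> \<bar>g n t\<bar> \<le> C * weight t powr d"
    "\<And>t. t \<in> {-1<..<1} \<Longrightarrow> (\<lambda>n. g n t) \<longlonglongrightarrow> G t"
  shows "weighted_bound d g G"
  unfolding weighted_bound_def using assms by blast

lemma weighted_boundE:
  assumes "weighted_bound d g G"
  obtains C where "C \<ge> 0" "\<And>n t. t \<in> {-1<..<1} \<Longrightarrow> \<bar>g n t\<bar> \<le> C * weight t powr d"
    "\<And>t. t \<in> {-1<..<1} \<Longrightarrow> (\<lambda>n. g n t) \<longlonglongrightarrow> G t"
proof -
  obtain C where C: "\<And>n t. t \<in> {-1<..<1} \<Longrightarrow> \<bar>g n t\<bar> \<le> C * weight t powr d"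
    and l: "\<And>t. t \<in> {-1<..<1} \<Longrightarrow> (\<lambda>n. g n t) \<longlonglongrightarrow> G t"
    using assms unfolding weighted_bound_def by blast
  have "\<bar>g n t\<bar> \<le> \<bar>C\<bar> * weight t powr d" if "t \<in> {-1<..<1}" for n t
    by (rule order_trans[OF C[OF that]]) (intro mult_right_mono, auto)
  from that[OF _ this l] show thesis by simp
qed

lemma weighted_bound_weaken:
  assumes "weighted_bound d g G" "d' \<le> d"
  shows "weighted_bound d' g G"
proof -
  obtain C where C: "C \<ge> 0" "\<And>n t. t \<in> {-1<..<1} \<Longrightarrow> \<bar>g n t\<bar> \<le> C * weight t powr d"
    "\<And>t. t \<in> {-1<..<1} \<Longrightarrow> (\<lambda>n. g n t) \<longlonglongrightarrow> G t" by (rule weighted_boundE[OF assms(1)]) blast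
  show ?thesis
  proof (rule weighted_boundI[where C = C])
    fix n and t :: real assume t: "t \<in> {-1<..<1}"
    have "weight t powr d \<le> weight t powr d'"
      using weight_pos[OF t] assms(2) by (intro powr_mono') auto
    then show "\<bar>g n t\<bar> \<le> C * weight t powr d'"
      using C(1) by (intro order_trans[OF C(2)[OF t]] mult_left_mono)
  qed (rule C(3))
qed

lemma weighted_conv_weaken: "weighted_conv k d g G \<Longrightarrow> d' \<le> d \<Longrightarrow> weighted_conv k d' g G"
proof (induction k arbitrary: d d' g G)
  case 0
  then show ?case using weighted_bound_weaken by simp
next
  case (Suc k)
  obtain g' G' where w: "weighted_bound d g G" "\<And>n t. t \<in> {-1<..<1}
      \<Longrightarrow> (g n has_real_derivative g' n t) (at t)"
    "\<And>t. t \<in> {-1<..<1} \<Longrightarrow> (G has_real_derivative G' t) (at t)" "weighted_conv k (d - 1) g' G'"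
    using Suc.prems(1) by (rule weighted_conv_SucE) blast
  show ?case
    by (rule weighted_conv_SucI[OF weighted_bound_weaken[OF w(1) Suc.prems(2)] w(2,3) Suc.IH[OF w(4)]])
       (use Suc.prems(2) in auto)
qed

lemma weighted_conv_add:
  "weighted_conv k d g G \<Longrightarrow> weighted_conv k d h H
      \<Longrightarrow> weighted_conv k d (\<lambda>n t. g n t + h n t) (\<lambda>t. G t + H t)"
proof (induction k arbitrary: d g G h H)
  have b: "weighted_bound d (\<lambda>n t. g n t + h n t) (\<lambda>t. G t + H t)" if g: "weighted_bound d g G"
      and h: "weighted_bound d h H" for d g G h H
  proof -
    obtain C where C: "C \<ge> 0" "\<And>n t. t \<in> {-1<..<1} \<Longrightarrow> \<bar>g n t\<bar> \<le> C * weight t powr d"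
      "\<And>t. t \<in> {-1<..<1} \<Longrightarrow> (\<lambda>n. g n t) \<longlonglongrightarrow> G t" by (rule weighted_boundE[OF g]) blast
    obtain D where D: "D \<ge> 0" "\<And>n t. t \<in> {-1<..<1} \<Longrightarrow> \<bar>h n t\<bar> \<le> D * weight t powr d"
      "\<And>t. t \<in> {-1<..<1} \<Longrightarrow> (\<lambda>n. h n t) \<longlonglongrightarrow> H t" by (rule weighted_boundE[OF h]) blast
    show ?thesis
    proof (rule weighted_boundI[where C = "C + D"])
      fix n and t :: real assume "t \<in> {-1<..<1}"
      then show "\<bar>g n t + h n t\<bar> \<le> (C + D) * weight t powr d"
        using C(2)[of t n] D(2)[of t n] by (simp add: distrib_right)
    qed (intro tendsto_add C(3) D(3))
  qed
  {
    case 0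
    then show ?case using b by simp
  next
    case (Suc k)
    obtain g' G' where g: "weighted_bound d g G" "\<And>n t. t \<in> {-1<..<1}
        \<Longrightarrow> (g n has_real_derivative g' n t) (at t)"
      "\<And>t. t \<in> {-1<..<1} \<Longrightarrow> (G has_real_derivative G' t) (at t)" "weighted_conv k (d - 1) g' G'"
      using Suc.prems(1) by (rule weighted_conv_SucE) blast
    obtain h' H' where h: "weighted_bound d h H" "\<And>n t. t \<in> {-1<..<1}
        \<Longrightarrow> (h n has_real_derivative h' n t) (at t)"
      "\<And>t. t \<in> {-1<..<1} \<Longrightarrow> (H has_real_derivative H' t) (at t)" "weighted_conv k (d - 1) h' H'"
      using Suc.prems(2) by (rule weighted_conv_SucE) blast
    show ?case
      by (rule weighted_conv_SucI[OF b[OF g(1) h(1)] _ _ Suc.IH[OF g(4) h(4)]]) (intro DERIV_add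
          g(2,3) h(2,3); assumption)+
  }
qed

lemma weighted_bound_mult:
  assumes g: "weighted_bound d g G" and h: "weighted_bound e h H"
  shows "weighted_bound (d + e) (\<lambda>n t. g n t * h n t) (\<lambda>t. G t * H t)"
proof -
  obtain C where C: "C \<ge> 0" "\<And>n t. t \<in> {-1<..<1} \<Longrightarrow> \<bar>g n t\<bar> \<le> C * weight t powr d"
    "\<And>t. t \<in> {-1<..<1} \<Longrightarrow> (\<lambda>n. g n t) \<longlonglongrightarrow> G t" by (rule weighted_boundE[OF g]) blast
  obtain D where D: "D \<ge> 0" "\<And>n t. t \<in> {-1<..<1} \<Longrightarrow> \<bar>h n t\<bar> \<le> D * weight t powr e"
    "\<And>t. t \<in> {-1<..<1} \<Longrightarrow> (\<lambda>n. h n t) \<longlonglongrightarrow> H t" by (rule weighted_boundE[OF h]) blast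
  show ?thesis
  proof (rule weighted_boundI[where C = "C * D"])
    fix n and t :: real assume t: "t \<in> {-1<..<1}"
    have "\<bar>g n t\<bar> * \<bar>h n t\<bar> \<le> (C * weight t powr d) * (D * weight t powr e)"
      using C(1) by (intro mult_mono C(2) D(2) t) auto
    then show "\<bar>g n t * h n t\<bar> \<le> C * D * weight t powr (d + e)"
      by (simp add: abs_mult powr_add mult_ac)
  qed (intro tendsto_mult C(3) D(3))
qed

lemma weighted_conv_mult:
  "weighted_conv k d g G \<Longrightarrow> weighted_conv k e h H
      \<Longrightarrow> weighted_conv k (d + e) (\<lambda>n t. g n t * h n t) (\<lambda>t. G t * H t)"
proof (induction k arbitrary: d e g G h H)
  case 0
  then show ?case using weighted_bound_mult by simp
next
  case (Suc k)
  obtain g' G' where g: "weighted_bound d g G" "\<And>n t. t \<in> {-1<..<1}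
      \<Longrightarrow> (g n has_real_derivative g' n t) (at t)"
    "\<And>t. t \<in> {-1<..<1} \<Longrightarrow> (G has_real_derivative G' t) (at t)" "weighted_conv k (d - 1) g' G'"
    using Suc.prems(1) by (rule weighted_conv_SucE) blast
  obtain h' H' where h: "weighted_bound e h H" "\<And>n t. t \<in> {-1<..<1}
      \<Longrightarrow> (h n has_real_derivative h' n t) (at t)"
    "\<And>t. t \<in> {-1<..<1} \<Longrightarrow> (H has_real_derivative H' t) (at t)" "weighted_conv k (e - 1) h' H'"
    using Suc.prems(2) by (rule weighted_conv_SucE) blast
  have 1: "weighted_conv k (d + e - 1) (\<lambda>n t. g' n t * h n t) (\<lambda>t. G' t * H t)"
    using Suc.IH[OF g(4) weighted_conv_SucD[OF Suc.prems(2)]] by (simp add: algebra_simps)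
  have 2: "weighted_conv k (d + e - 1) (\<lambda>n t. h' n t * g n t) (\<lambda>t. H' t * G t)"
    using Suc.IH[OF h(4) weighted_conv_SucD[OF Suc.prems(1)]] by (simp add: algebra_simps)
  show ?case
    by (rule weighted_conv_SucI[OF weighted_bound_mult[OF g(1) h(1)] _ _ weighted_conv_add[OF 1 2]])
       (intro DERIV_mult g(2,3) h(2,3); assumption)+
qed

lemma weighted_conv_poly: "weighted_conv k 0 (\<lambda>_. poly p) (poly p)"
proof (induction k arbitrary: p)
  have b: "weighted_bound 0 (\<lambda>_. poly p) (poly p)" for p
  proof -
    have "continuous_on {-1..1} (poly p)" by (rule continuous_intros)
    then obtain B where "B > 0" "\<And>t. t \<in> {-1<..<1} \<Longrightarrow> \<bar>poly p t\<bar> \<le> B"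
      by (rule continuous_bounded_interval) blast
    then show ?thesis using weight_pos by (intro weighted_boundI[where C = B]) force+
  qed
  {
    case 0
    then show ?case using b by simp
  next
    case (Suc k)
    show ?case
      by (rule weighted_conv_SucI[OF b _ _ weighted_conv_weaken[OF Suc[of "pderiv p"]]])
          (auto intro: poly_DERIV)
  }
qed

lemma weighted_conv_weight_poly: "weighted_conv k 1 (\<lambda>_. poly weight_poly) (poly weight_poly)"
proof (cases k)
  have b: "weighted_bound 1 (\<lambda>_. poly weight_poly) (poly weight_poly)"
  proof (rule weighted_boundI[where C = 1])
    fix t :: real assume "t \<in> {-1<..<1}"
    then show "\<bar>poly weight_poly t\<bar> \<le> 1 * weight t powr 1"
      using weight_pos[of t] unfolding poly_weight_poly by simp
  qed simp
  {
    case 0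
    then show ?thesis using b by simp
  next
    case (Suc l)
    show ?thesis unfolding Suc
      by (rule weighted_conv_SucI[OF b, where g' = "\<lambda>_. poly (pderiv weight_poly)" and G'
          = "poly (pderiv weight_poly)"])
         (use weighted_conv_poly[of l "pderiv weight_poly"] in \<open>simp_all only: poly_DERIV diff_self\<close>)
  }
qed

lemma weighted_conv_weight_poly_power:
  "weighted_conv k (real j) (\<lambda>_. poly (weight_poly ^ j)) (poly (weight_poly ^ j))"
proof (induction j)
  case 0
  show ?case using weighted_conv_poly[of k 1] by (simp only: power_0 of_nat_0)
next
  case (Suc j)
  have "weighted_conv k (1 + real j) (\<lambda>n t. poly weight_poly t
      * poly (weight_poly ^ j) t) (\<lambda>t. poly weight_poly t * poly (weight_poly ^ j) t)"
    by (rule weighted_conv_mult[OF weighted_conv_weight_poly Suc])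
  then show ?case by (simp only: power_Suc poly_mult[abs_def] of_nat_Suc add.commute)
qed

lemma higher_deriv_cong_open:
  assumes "open S" "\<And>x. x \<in> S \<Longrightarrow> f x = (g x :: real)"
  shows "x \<in> S \<Longrightarrow> (deriv ^^ k) f x = (deriv ^^ k) g x"
proof (induction k arbitrary: x)
  case (Suc k)
  show ?case using deriv_cong_open[OF assms(1) Suc.prems Suc.IH] by simp
qed (simp add: assms(2))

lemma weighted_conv_cong_limit:
  assumes "weighted_conv k d g G" "\<And>t. t \<in> {-1<..<1} \<Longrightarrow> G t = H t"
  shows "weighted_conv k d g H"
proof (cases k)
  case 0
  then show ?thesis using assms by (simp add: weighted_bound_def)
next
  case (Suc l)
  obtain g' G' where w: "weighted_bound d g G" "\<And>n t. t \<in> {-1<..<1}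
      \<Longrightarrow> (g n has_real_derivative g' n t) (at t)"
    "\<And>t. t \<in> {-1<..<1} \<Longrightarrow> (G has_real_derivative G' t) (at t)" "weighted_conv l (d - 1) g' G'"
    using assms(1) unfolding Suc by (rule weighted_conv_SucE) blast
  have "weighted_bound d g H" using w(1) assms(2) by (simp add: weighted_bound_def)
  moreover have "(H has_real_derivative G' t) (at t)" if "t \<in> {-1<..<1}" for t
    by (rule has_field_derivative_transform_within_open[OF w(3)[OF that] _ that]) (use assms(2) in auto)
  ultimately show ?thesis unfolding Suc using w(2,4) by (intro weighted_conv_SucI)
qed

lemma weighted_conv_higher_deriv:
  "weighted_conv k d g G \<Longrightarrow> weighted_bound (d - real k) (\<lambda>n. (deriv ^^ k) (g n)) ((deriv ^^ k) G)"
proof (induction k arbitrary: d g G)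
  case (Suc k)
  obtain g' G' where w: "weighted_bound d g G" "\<And>n t. t \<in> {-1<..<1}
      \<Longrightarrow> (g n has_real_derivative g' n t) (at t)"
    "\<And>t. t \<in> {-1<..<1} \<Longrightarrow> (G has_real_derivative G' t) (at t)" "weighted_conv k (d - 1) g' G'"
    using Suc.prems by (rule weighted_conv_SucE) blast
  have eq: "(deriv ^^ Suc k) (g n) t = (deriv ^^ k) (g' n) t" "(deriv ^^ Suc k) G t = (deriv ^^ k) G' t"
    if "t \<in> {-1<..<1}" for n t
    unfolding funpow_Suc_right o_apply
    using DERIV_imp_deriv[OF w(2)] DERIV_imp_deriv[OF w(3)] that
    by (auto intro!: higher_deriv_cong_open[of "{-1<..<1}"])
  have "weighted_bound (d - 1 - real k) (\<lambda>n. (deriv ^^ k) (g' n)) ((deriv ^^ k) G')"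
      by (rule Suc.IH[OF w(4)])
  then show ?case
    unfolding weighted_bound_def using eq by (simp add: diff_diff_eq del: funpow.simps)
qed simp

text \<open>
  The cutoff proper is \<open>cutoff 0 1\<close>; it tends to \<open>1\<close> and vanishes where \<open>1-t^2 \<le> 1/(n+1)\<close>. The other
  members of the family arise from it by differentiation, \<open>i\<close> counting the derivatives. The polynomial in
  the flat function is divisible by the \<open>i\<close>-th power of the variable because each differentiation of
  \<open>exp (-1/x)\<close> produces a factor \<open>1/x^2\<close>.
\<close>

definition cutoff :: "nat \<Rightarrow> real poly \<Rightarrow> nat \<Rightarrow> real \<Rightarrow> real"
  where "cutoff i q n t = real (Suc n) ^ i * flat ([:0, 1:] ^ i * q) (real (Suc n) * weight t - 1)"

lemma poly_exp_bounded: obtains C where "C \<ge> 0" "\<And>y. y \<ge> 0 \<Longrightarrow> \<bar>poly p y * exp (- y)\<bar> \<le> (C :: real)"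
proof -
  have "\<forall>\<^sub>F y in at_top. dist (poly p y * exp (- y)) 0 < 1"
    using poly_exp_decay[of p] by (rule tendstoD) simp
  then obtain Y where Y: "\<And>y. y \<ge> Y \<Longrightarrow> \<bar>poly p y * exp (- y)\<bar> < 1"
    by (auto simp: eventually_at_top_linorder dist_real_def)
  have "bounded ((\<lambda>y. poly p y * exp (- y)) ` {0..Y})"
    by (intro compact_imp_bounded compact_continuous_image continuous_intros) auto
  then obtain B where "\<forall>z\<in>(\<lambda>y. poly p y * exp (- y)) ` {0..Y}. norm z \<le> B"
    unfolding bounded_iff by blast
  then have B: "\<bar>poly p y * exp (- y)\<bar> \<le> B" if "y \<in> {0..Y}" for y using that by auto
  show thesis
  proof (rule that[of "max 1 B"])
    fix y :: real assume "y \<ge> 0"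
    then show "\<bar>poly p y * exp (- y)\<bar> \<le> max 1 B"
      using B[of y] Y[of y] by (cases "y \<le> Y") (auto simp: le_max_iff_disj)
  qed simp
qed

text \<open>
  With \<open>N = n+1\<close>, the factor \<open>N^i\<close> from the chain rule and the factor \<open>y^i\<close> from the flat
  function combine by \<open>N (1-t^2) y = 1+y\<close> to a power of the weight
      and a function of \<open>y\<close> that is bounded on the half-line.
\<close>

lemma cutoff_eq:
  assumes "t \<in> {-1<..<1}" "real (Suc n) * weight t > 1"
  defines "y \<equiv> 1 / (real (Suc n) * weight t - 1)"
  shows "cutoff i q n t = weight t powr (- real i) * (poly ([:1, 1:] ^ i * q) y * exp (- y))"
proof -
  define N where "N = real (Suc n)"
  have s: "weight t > 0" by (rule weight_pos[OF assms(1)])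
  have x: "N * weight t - 1 > 0" using assms(2) by (simp add: N_def)
  have y: "y > 0" "N * weight t * y = 1 + y"
    using x unfolding y_def[folded N_def] by (simp_all add: field_simps)
  have "weight t powr (- real i) * (1 + y) ^ i = (N * y) ^ i"
  proof -
    have "(1 + y) ^ i = weight t ^ i * (N * y) ^ i"
      by (simp only: y(2)[symmetric] power_mult_distrib mult_ac)
    then show ?thesis using s by (simp add: powr_minus powr_realpow del: right_diff_distrib)
  qed
  then have e: "weight t powr (- real i) * ((1 + y) ^ i * c) = N ^ i * (y ^ i * c)" for c
    by (simp only: power_mult_distrib mult.assoc[symmetric])
  have "cutoff i q n t = N ^ i * (poly ([:0, 1:] ^ i * q) y * exp (- y))"
    using x unfolding cutoff_def flat_def N_def[symmetric] y_def[folded N_def] by simp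
  also have "\<dots> = N ^ i * (y ^ i * (poly q y * exp (- y)))"
    by (simp add: poly_power mult_ac)
  also have "\<dots> = weight t powr (- real i) * (poly ([:1, 1:] ^ i * q) y * exp (- y))"
    unfolding e[symmetric] by (simp add: poly_power mult_ac)
  finally show ?thesis .
qed

lemma weighted_bound_cutoff:
  "weighted_bound (- real i) (cutoff i q) (\<lambda>t. poly q 0 * weight t powr (- real i))"
proof -
  obtain C where C: "C \<ge> 0" "\<And>y. y \<ge> 0 \<Longrightarrow> \<bar>poly ([:1, 1:] ^ i * q) y * exp (- y)\<bar> \<le> C"
    by (rule poly_exp_bounded[of "[:1, 1:] ^ i * q"]) blast
  show ?thesis
  proof (rule weighted_boundI[where C = C])
    fix n and t :: real assume t: "t \<in> {-1<..<1}"
    show "\<bar>cutoff i q n t\<bar> \<le> C * weight t powr (- real i)"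
    proof (cases "real (Suc n) * weight t > 1")
      case True
      have "\<bar>cutoff i q n t\<bar> \<le> weight t powr (- real i) * C"
        unfolding cutoff_eq[OF t True] abs_mult[of "_ powr _"]
        using C(2)[of "1 / (real (Suc n) * weight t - 1)"] True by (intro mult_mono) auto
      then show ?thesis by (simp add: mult.commute)
    next
      case False
      then show ?thesis using C(1) by (simp add: cutoff_def flat_def)
    qed
  next
    fix t :: real assume t: "t \<in> {-1<..<1}"
    have s: "weight t > 0" by (rule weight_pos[OF t])
    have inf: "filterlim (\<lambda>n. real (Suc n) * weight t - 1) at_top sequentially"
      using s by real_asymp
    have lim: "(\<lambda>n. 1 / (real (Suc n) * weight t - 1)) \<longlonglongrightarrow> 0"
      by (rule real_tendsto_divide_at_top[OF tendsto_const inf])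
    have "(\<lambda>n. weight t powr (- real i) * (poly ([:1, 1:] ^ i * q) (1 / (real (Suc n) * weight t
        - 1)) * exp (- (1 / (real (Suc n) * weight t - 1)))))
        \<longlonglongrightarrow> weight t powr (- real i) * (poly ([:1, 1:] ^ i * q) 0 * exp (- 0))"
      by (intro tendsto_intros lim tendsto_compose[OF _ lim] isCont_tendsto_compose[OF _ lim]
          poly_isCont)
    moreover have "\<forall>\<^sub>F n in sequentially. real (Suc n) * weight t > 1"
      using filterlim_at_top_dense[THEN iffD1, OF inf, rule_format, of 0]
      by (rule eventually_mono) simp
    ultimately have "(\<lambda>n. cutoff i q n t) \<longlonglongrightarrow> weight t powr (- real i) * (poly ([:1, 1:] ^ i * q) 0
        * exp (- 0))"
      by (elim Lim_transform_eventually) (auto elim!: eventually_mono simp: cutoff_eq[OF t])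
    then show "(\<lambda>n. cutoff i q n t) \<longlonglongrightarrow> poly q 0 * weight t powr (- real i)"
      by (simp add: poly_mult poly_power mult.commute)
  qed
qed

text \<open>
  The quotient of \<open>flat_deriv (x^i q)\<close> by \<open>x^(i+1)\<close>.
\<close>

definition cutoff_next :: "nat \<Rightarrow> real poly \<Rightarrow> real poly"
  where "cutoff_next i q = [:0, 1:] * q - smult (real i) q - [:0, 1:] * pderiv q"

lemma flat_deriv_cutoff: "flat_deriv ([:0, 1:] ^ i * q) = [:0, 1:] ^ Suc i * cutoff_next i q"
proof (rule poly_eqI_eval)
  fix x :: real
  have "x * (real i * x ^ (i - 1)) = real i * x ^ i" by (cases i) auto
  then have "poly (pderiv ([:0, 1:] ^ i)) x * x = real i * x ^ i"
    by (simp add: pderiv_power pderiv_pCons mult.commute)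
  note h = this
  define D Q Q' where "D = poly (pderiv ([:0, 1:] ^ i)) x" "Q = poly q x" "Q' = poly (pderiv q) x"
  have "poly (flat_deriv ([:0, 1:] ^ i * q)) x = x * x * (x ^ i * Q - (D * Q + x ^ i * Q'))"
    by (simp add: flat_deriv_def pderiv_mult D_Q_Q'_def algebra_simps)
  also have "\<dots> = x * x * x ^ i * Q - x * (D * x) * Q - x * x * x ^ i * Q'"
    by (simp add: algebra_simps)
  also have "D * x = real i * x ^ i" unfolding D_Q_Q'_def by (rule h)
  also have "x * x * x ^ i * Q - x * (real i * x ^ i) * Q - x * x * x ^ i * Q'
      = poly ([:0, 1:] ^ Suc i * cutoff_next i q) x"
    by (simp add: cutoff_next_def D_Q_Q'_def algebra_simps)
  finally show "poly (flat_deriv ([:0, 1:] ^ i * q)) x = poly ([:0, 1:] ^ Suc i * cutoff_next i q) x" .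
qed

lemma cutoff_DERIV:
  "(cutoff i q n has_real_derivative poly [:0, -2:] t * cutoff (Suc i) (cutoff_next i q) n t) (at t)"
proof -
  have "((\<lambda>t. real (Suc n) * weight t - 1) has_real_derivative real (Suc n) * (- 2 * t)) (at t)"
    by (auto intro!: derivative_eq_intros)
  from DERIV_cmult[OF DERIV_chain2[OF flat_DERIV this], of "real (Suc n) ^ i" "[:0, 1:] ^ i * q"]
  have D: "(cutoff i q n has_real_derivative real (Suc n) ^ i *
      (flat ([:0, 1:] ^ Suc i * cutoff_next i q) (real (Suc n) * weight t
          - 1) * (real (Suc n) * (- 2 * t)))) (at t)"
    unfolding cutoff_def[abs_def] flat_deriv_cutoff .
  show ?thesis
  proof (rule DERIV_cong[OF D])
    have "poly [:0, -2:] t = -2 * t" by simp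
    then show "real (Suc n) ^ i * (flat ([:0, 1:] ^ Suc i * cutoff_next i q) (real (Suc n)
        * weight t - 1) *
        (real (Suc n) * (- 2 * t))) = poly [:0, -2:] t * cutoff (Suc i) (cutoff_next i q) n t"
      by (simp only: cutoff_def power_Suc mult_ac)
  qed
qed

text \<open>
  The limit \<open>q(0) (1-t^2)^(-i)\<close> is compatible with differentiation because the value at \<open>0\<close> of
  \<open>cutoff_next i q\<close> is \<open>-i q(0)\<close>. For \<open>i = 0\<close> and \<open>q = 1\<close> the limit is the constant \<open>1\<close>.
\<close>

lemma weighted_conv_cutoff:
  "weighted_conv k (- real i) (cutoff i q) (\<lambda>t. poly q 0 * weight t powr (- real i))"
proof (induction k arbitrary: i q)
  case 0
  then show ?case using weighted_bound_cutoff by simp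
next
  case (Suc k)
  have "weighted_conv k (0 + (- real (Suc i))) (\<lambda>n t. poly [:0, -2:] t
      * cutoff (Suc i) (cutoff_next i q) n t)
     (\<lambda>t. poly [:0, -2:] t * (poly (cutoff_next i q) 0 * weight t powr (- real (Suc i))))"
    by (rule weighted_conv_mult[OF weighted_conv_poly Suc])
  moreover have "0 + (- real (Suc i)) = - real i - 1" by simp
  ultimately have w: "weighted_conv k (- real i
      - 1) (\<lambda>n t. poly [:0, -2:] t * cutoff (Suc i) (cutoff_next i q) n t)
     (\<lambda>t. poly [:0, -2:] t * (poly (cutoff_next i q) 0 * weight t powr (- real (Suc i))))"
    by (simp only:)
  show ?case
  proof (rule weighted_conv_SucI[OF weighted_bound_cutoff _ _ w])
    fix t :: real assume t: "t \<in> {-1<..<1}"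
    have "((\<lambda>t. poly q 0 * weight t powr (- real i)) has_real_derivative
       poly q 0 * (- real i * weight t powr (- real i - 1) * (- 2 * t))) (at t)"
      using weight_pos[OF t] by (auto intro!: derivative_eq_intros simp: powr_diff)
    moreover have "- real (Suc i) = - real i - 1" by simp
    ultimately show "((\<lambda>t. poly q 0 * weight t powr (- real i)) has_real_derivative
       poly [:0, -2:] t * (poly (cutoff_next i q) 0 * weight t powr (- real (Suc i)))) (at t)"
      by (simp only:) (simp add: cutoff_next_def mult_ac)
  qed (rule cutoff_DERIV)
qed

lemma cutoff_test_function: "(\<lambda>t. cutoff 0 1 n t * poly p t) \<in> test_functions"
proof -
  define N where "N = real (Suc n)"
  have "differentiable_upto k UNIV (\<lambda>t. cutoff 0 1 n t * poly p t)" for k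
  proof (rule differentiable_upto_mult[OF open_UNIV _ differentiable_upto_poly[OF open_UNIV]])
    have "differentiable_upto k UNIV (\<lambda>t. flat 1 (poly [:N - 1, 0, - N:] t))"
      by (rule differentiable_upto_compose[OF _ _ differentiable_upto_flat
          differentiable_upto_poly]) auto
    also have "(\<lambda>t. flat 1 (poly [:N - 1, 0, - N:] t)) = cutoff 0 1 n"
      by (simp add: cutoff_def fun_eq_iff N_def power2_eq_square algebra_simps)
    finally show "differentiable_upto k UNIV (cutoff 0 1 n)" .
  qed
  (* For t beyond b one has N (1 - t^2) - 1 \<le> 0. *)
  moreover define b where "b = sqrt (1 - 1 / N)"
  have N: "N \<ge> 1" by (simp add: N_def)
  have "b < 1" using N by (simp add: b_def)
  have "cutoff 0 1 n t * poly p t = 0" if "t \<notin> {-b..b}" for t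
  proof -
    have "b < \<bar>t\<bar>" using that by auto
    then have "1 - 1 / N < t\<^sup>2" unfolding b_def by (metis real_sqrt_abs real_sqrt_less_iff)
    then have "N * weight t - 1 \<le> 0" using N by (simp add: field_simps)
    then show ?thesis unfolding cutoff_def flat_def N_def[symmetric] by simp
  qed
  moreover have "-1 < - b" using \<open>b < 1\<close> by simp
  ultimately show ?thesis unfolding test_functions_iff using \<open>b < 1\<close> by blast
qed

section \<open>Weak derivatives and their Legendre coefficients\<close>

abbreviation Legendre_coef :: "nat \<Rightarrow> (real \<Rightarrow> real) \<Rightarrow> nat \<Rightarrow> real"
  where "Legendre_coef m u n \<equiv> \<integral>t. u t * assoc_Legendre m n t \<partial>mu"

text \<open>
  Repeated integration by parts; the boundary terms vanish with the test function.
\<close>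

lemma poly_test_by_parts:
  assumes "\<phi> \<in> test_functions"
  shows "(\<integral>t. poly p t * (deriv ^^ k) \<phi> t \<partial>mu) = (-1) ^ k * (\<integral>t. poly ((pderiv ^^ k) p) t * \<phi> t \<partial>mu)"
proof (induction k arbitrary: p)
  case (Suc k)
  define \<psi> where "\<psi> = (deriv ^^ k) \<phi>"
  have \<psi>: "\<psi> \<in> test_functions" unfolding \<psi>_def by (rule test_function_higher_deriv[OF assms])
  note \<psi>' = test_function_deriv[OF \<psi>]
  have \<psi>0: "\<psi> 1 = 0" "\<psi> (-1) = 0" using \<psi> by (auto simp: test_functions_iff)
  have "(\<integral>t. poly (pderiv p) t * \<psi> t + deriv \<psi> t * poly p t \<partial>mu) = poly p 1 * \<psi> 1 - poly p (-1) * \<psi> (-1)"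
    by (rule mu_FTC(2)[of "\<lambda>t. poly p t * \<psi> t"])
       (auto intro!: DERIV_mult poly_DERIV test_function_DERIV[OF \<psi>] continuous_intros
         test_function_continuous[OF \<psi>] test_function_continuous[OF \<psi>'])
  moreover have "integrable mu (\<lambda>t. poly (pderiv p) t * \<psi> t)" "integrable mu (\<lambda>t. deriv \<psi> t * poly p t)"
    by (auto intro!: square_int_mult square_int_continuous continuous_intros
        test_function_continuous[OF \<psi>] test_function_continuous[OF \<psi>'])
  ultimately have "(\<integral>t. poly p t * deriv \<psi> t \<partial>mu) = - (\<integral>t. poly (pderiv p) t * \<psi> t \<partial>mu)"
    by (simp add: \<psi>0 mult.commute)
  also have "(\<integral>t. poly (pderiv p) t * \<psi> t \<partial>mu)
      = (-1) ^ k * (\<integral>t. poly ((pderiv ^^ k) (pderiv p)) t * \<phi> t \<partial>mu)"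
    unfolding \<psi>_def by (rule Suc)
  also have "deriv \<psi> = (deriv ^^ Suc k) \<phi>" by (simp add: \<psi>_def)
  also have "(pderiv ^^ k) (pderiv p) = (pderiv ^^ Suc k) p" by (simp only: funpow_Suc_right o_apply)
  finally show ?case by simp
qed simp

lemma higher_deriv_poly: "(deriv ^^ k) (poly p) = poly ((pderiv ^^ k) p)" for p :: "real poly"
proof (induction k)
  case (Suc k)
  have "deriv (poly q) = poly (pderiv q)" for q :: "real poly"
    by (intro ext DERIV_imp_deriv poly_DERIV)
  then show ?case by (simp add: Suc)
qed simp

lemma weight_power_cancel:
  assumes "t \<in> {-1<..<1}"
  shows "weight t powr real m = omega t ^ m * omega t ^ m"
proof -
  have "weight t powr real m = weight t ^ m" by (rule powr_realpow[OF weight_pos[OF assms]])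
  also have "\<dots> = poly (weight_poly ^ m) t" by (simp only: poly_power poly_weight_poly)
  also have "\<dots> = omega t ^ m * omega t ^ m" by (rule omega_pow2[OF assms, symmetric])
  finally show ?thesis .
qed

lemma omega_le_1:
  assumes "t \<in> {-1<..<1}"
  shows "omega t ^ m \<le> 1"
proof (rule power_le_one)
  show "0 \<le> omega t" using omega_pos[OF assms] by simp
  show "omega t \<le> 1" unfolding omega_def real_sqrt_le_1_iff by simp
qed

text \<open>
  The defining identity of \<open>f\<close> is extended from test functions to the function \<open>omega^(m+k) p\<close>,
      which does
  not have compact support, by cutting off and passing to the limit on both sides.
\<close>

lemma X_integration_by_parts:
  assumes u: "u \<in> L2" and f: "f \<in> L2"
    and rep: "represented_by (distr_mult (\<lambda>t. omega t ^ (m + k)) (weighted_deriv m k u)) f"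
  shows "(\<integral>t. f t * (omega t ^ (m + k) * poly p t) \<partial>mu)
    = (-1) ^ k * (\<integral>t. u t / omega t ^ m * poly ((pderiv ^^ k) (weight_poly ^ (m + k) * p)) t \<partial>mu)"
proof -
  define j where "j = m + k"
  define cut where "cut = cutoff 0 1"
  define G where "G = poly (weight_poly ^ j * p)"
  have um [measurable]: "u \<in> borel_measurable mu" and fm [measurable]: "f \<in> borel_measurable mu"
    using u f by (auto simp: L2_def)
  have ui: "integrable mu u" and fi: "integrable mu f"
    using u f by (simp_all add: L2_iff_square_int square_int_integrable_mu)
  have wc: "weighted_conv k (real j) (\<lambda>n t. cut n t * G t) G"
  proof -
    have "weighted_conv k (- real 0 + (real j
        + 0)) (\<lambda>n t. cut n t * (poly (weight_poly ^ j) t * poly p t))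
        (\<lambda>t. poly 1 0 * weight t powr (- real 0) * (poly (weight_poly ^ j) t * poly p t))"
      unfolding cut_def by (intro weighted_conv_mult weighted_conv_cutoff
          weighted_conv_weight_poly_power weighted_conv_poly)
    then have w: "weighted_conv k (real j) (\<lambda>n t. cut n t * G t)
        (\<lambda>t. poly 1 0 * weight t powr (- real 0) * G t)"
      by (simp add: G_def del: poly_power poly_pCons)
    show ?thesis
    proof (rule weighted_conv_cong_limit[OF w])
      fix t :: real assume "t \<in> {-1<..<1}"
      then show "poly 1 0 * weight t powr (- real 0) * G t = G t" using weight_pos[of t] by simp
    qed
  qed
  from weighted_conv_higher_deriv[OF wc] obtain C where C: "C \<ge> 0"
    and bd: "\<And>n t. t \<in> {-1<..<1} \<Longrightarrow> \<bar>(deriv ^^ k) (\<lambda>t. cut n t * G t) t\<bar>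
        \<le> C * weight t powr (real j - real k)"
    and lim: "\<And>t. t \<in> {-1<..<1} \<Longrightarrow> (\<lambda>n. (deriv ^^ k) (\<lambda>t. cut n t * G t) t) \<longlonglongrightarrow> (deriv ^^ k) G t"
    by (rule weighted_boundE) blast
  define \<phi> where "\<phi> n t = omega t ^ j * (cut n t * poly p t)" for n t
  have test: "\<phi> n \<in> test_functions" for n
    unfolding \<phi>_def[abs_def] cut_def by (intro test_function_mult cutoff_test_function
        differentiable_upto_omega_power)
  have test2: "(\<lambda>t. cut n t * G t) \<in> test_functions" for n
    unfolding G_def cut_def by (rule cutoff_test_function)
  have G_eq: "omega t ^ j * \<phi> n t = cut n t * G t" if "t \<in> {-1<..<1}" for n t
    using omega_pow2[OF that, of j] by (simp add: \<phi>_def G_def mult.assoc[symmetric] del: poly_power)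
  have eq: "(-1) ^ k * (\<integral>t. u t / omega t ^ m * (deriv ^^ k) (\<lambda>t. cut n t * G t) t \<partial>mu)
      = (\<integral>t. f t * \<phi> n t \<partial>mu)" for n
  proof -
    have "(\<integral>t. u t / omega t ^ m * (deriv ^^ k) (\<lambda>t. cut n t * G t) t \<partial>mu)
        = (\<integral>t. u t / omega t ^ m * (deriv ^^ k) (\<lambda>t. omega t ^ j * \<phi> n t) t \<partial>mu)"
      by (rule Bochner_Integration.integral_cong[OF refl], rule arg_cong2[where f = "(*)", OF refl],
          rule higher_deriv_cong_open[of "{-1<..<1}"]) (simp_all add: G_eq)
    then show ?thesis
      using rep test[of n]
      by (simp add: represented_by_def distr_mult_def weighted_deriv_def distr_deriv_def
          distr_of_def j_def)
  qed
  have om [measurable]: "(\<lambda>t. omega t ^ i) \<in> borel_measurable mu" for i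
    by (rule continuous_measurable_mu[OF continuous_omega_power])
  have pm: "poly q \<in> borel_measurable mu" for q
    by (rule continuous_measurable_mu[OF continuous_on_poly_real])
  have tm: "\<psi> \<in> borel_measurable mu" if "\<psi> \<in> test_functions" for \<psi>
    by (rule continuous_measurable_mu[OF test_function_continuous[OF that]])
  have L1: "(\<lambda>n. \<integral>t. u t / omega t ^ m * (deriv ^^ k) (\<lambda>t. cut n t * G t) t \<partial>mu)
      \<longlonglongrightarrow> (\<integral>t. u t / omega t ^ m * (deriv ^^ k) G t \<partial>mu)"
  proof (rule integral_dominated_convergence[where w = "\<lambda>t. C * \<bar>u t\<bar>"])
    show "(\<lambda>t. u t / omega t ^ m * (deriv ^^ k) G t) \<in> borel_measurable mu"
      unfolding G_def higher_deriv_poly by (intro borel_measurable_times borel_measurable_divide um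
          om pm)
    show "(\<lambda>t. u t / omega t ^ m * (deriv ^^ k) (\<lambda>t. cut n t * G t) t) \<in> borel_measurable mu" for n
      by (intro borel_measurable_times borel_measurable_divide um om tm test_function_higher_deriv test2)
    show "integrable mu (\<lambda>t. C * \<bar>u t\<bar>)" using ui by auto
    show "AE t in mu. (\<lambda>n. u t / omega t ^ m * (deriv ^^ k) (\<lambda>t. cut n t * G t) t)
        \<longlonglongrightarrow> u t / omega t ^ m * (deriv ^^ k) G t"
      by (intro AE_I2 tendsto_mult tendsto_const lim) simp
    show "AE t in mu. norm (u t / omega t ^ m * (deriv ^^ k) (\<lambda>t. cut n t * G t) t) \<le> C * \<bar>u t\<bar>" for n
    proof (rule AE_I2)
      fix t assume "t \<in> space mu"
      then have t: "t \<in> {-1<..<1}" by simp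
      have o: "omega t ^ m > 0" using omega_pos[OF t] by simp
      have "\<bar>(deriv ^^ k) (\<lambda>t. cut n t * G t) t\<bar> \<le> C * (omega t ^ m * omega t ^ m)"
        using bd[OF t, of n] weight_power_cancel[OF t, of m] by (simp add: j_def)
      then have "\<bar>u t\<bar> / omega t ^ m * \<bar>(deriv ^^ k) (\<lambda>t. cut n t * G t) t\<bar>
          \<le> \<bar>u t\<bar> / omega t ^ m * (C * (omega t ^ m * omega t ^ m))"
        using o by (intro mult_left_mono) auto
      also have "\<dots> = C * \<bar>u t\<bar> * omega t ^ m" using o by (simp add: field_simps)
      also have "\<dots> \<le> C * \<bar>u t\<bar>" using C omega_le_1[OF t] by (intro mult_left_le) auto
      finally show "norm (u t / omega t ^ m * (deriv ^^ k) (\<lambda>t. cut n t * G t) t) \<le> C * \<bar>u t\<bar>"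
        using o by (simp add: abs_mult)
    qed
  qed
  have "weighted_bound (- real 0) cut (\<lambda>t. poly 1 0 * weight t powr (- real 0))"
    unfolding cut_def by (rule weighted_bound_cutoff)
  then obtain D where D: "D \<ge> 0" "\<And>n t. t \<in> {-1<..<1} \<Longrightarrow> \<bar>cut n t\<bar> \<le> D * weight t powr (- real 0)"
    "\<And>t. t \<in> {-1<..<1} \<Longrightarrow> (\<lambda>n. cut n t) \<longlonglongrightarrow> poly 1 0 * weight t powr (- real 0)"
    by (rule weighted_boundE) blast
  have D1: "\<bar>cut n t\<bar> \<le> D" "(\<lambda>n. cut n t) \<longlonglongrightarrow> 1" if "t \<in> {-1<..<1}" for n t
    using D(2)[OF that, of n] D(3)[OF that] weight_pos[OF that] by simp_all
  have cont: "continuous_on {-1..1} (\<lambda>t. omega t ^ j * poly p t)"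
    by (intro continuous_intros continuous_omega_power)
  have i: "integrable mu (\<lambda>t. f t * (omega t ^ j * poly p t))"
    by (rule integrable_mult_continuous[OF fi cont])
  have L2: "(\<lambda>n. \<integral>t. f t * \<phi> n t \<partial>mu) \<longlonglongrightarrow> (\<integral>t. f t * (omega t ^ j * poly p t) \<partial>mu)"
  proof (rule integral_dominated_convergence[where w = "\<lambda>t. D * \<bar>f t * (omega t ^ j * poly p t)\<bar>"])
    show "(\<lambda>t. f t * (omega t ^ j * poly p t)) \<in> borel_measurable mu"
      using i by (rule borel_measurable_integrable)
    show "(\<lambda>t. f t * \<phi> n t) \<in> borel_measurable mu" for n by (intro borel_measurable_times fm tm test)
    show "integrable mu (\<lambda>t. D * \<bar>f t * (omega t ^ j * poly p t)\<bar>)" using i by auto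
    show "AE t in mu. (\<lambda>n. f t * \<phi> n t) \<longlonglongrightarrow> f t * (omega t ^ j * poly p t)"
    proof (rule AE_I2)
      fix t assume "t \<in> space mu"
      then have "(\<lambda>n. f t * (omega t ^ j * (cut n t * poly p t))) \<longlonglongrightarrow> f t * (omega t ^ j * (1 * poly p t))"
        by (intro tendsto_intros D1) simp
      then show "(\<lambda>n. f t * \<phi> n t) \<longlonglongrightarrow> f t * (omega t ^ j * poly p t)" by (simp add: \<phi>_def)
    qed
    show "AE t in mu. norm (f t * \<phi> n t) \<le> D * \<bar>f t * (omega t ^ j * poly p t)\<bar>" for n
    proof (rule AE_I2)
      fix t assume "t \<in> space mu"
      then have "\<bar>cut n t\<bar> * \<bar>f t * (omega t ^ j * poly p t)\<bar> \<le> D * \<bar>f t * (omega t ^ j * poly p t)\<bar>"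
        by (intro mult_right_mono D1) auto
      then show "norm (f t * \<phi> n t) \<le> D * \<bar>f t * (omega t ^ j * poly p t)\<bar>"
        by (simp add: \<phi>_def abs_mult mult_ac)
    qed
  qed
  have "(\<integral>t. f t * (omega t ^ j * poly p t) \<partial>mu)
      = (-1) ^ k * (\<integral>t. u t / omega t ^ m * (deriv ^^ k) G t \<partial>mu)"
    by (rule LIMSEQ_unique[OF L2]) (use tendsto_mult_left[OF L1, of "(-1) ^ k"] in \<open>simp only: eq\<close>)
  then show ?thesis by (simp only: j_def G_def higher_deriv_poly)
qed

text \<open>
  With \<open>p\<close> the derivative of order \<open>m+k\<close> of a Legendre polynomial, the right-hand side of the preceding
  identity is evaluated by the self-adjoint equation. The two signs \<open>(-1)^k\<close> cancel, and the change of
  normalization absorbs one of the two square roots of \<open>deriv_factor m k n\<close>.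
\<close>

lemma X_coefficients:
  assumes u: "u \<in> L2" and f: "f \<in> L2"
    and rep: "represented_by (distr_mult (\<lambda>t. omega t ^ (m + k)) (weighted_deriv m k u)) f"
    and n: "m + k \<le> n"
  shows "Legendre_coef (m + k) f n = sqrt (deriv_factor m k n) * Legendre_coef m u n"
proof -
  let ?r = "deriv_factor m k n"
  have r: "?r \<ge> 0" using n by (intro deriv_factor_nonneg) simp
  have "(\<integral>t. f t * (omega t ^ (m + k) * poly (Legendre_D (m + k) n) t) \<partial>mu)
      = (-1) ^ k * (\<integral>t. u t / omega t ^ m * poly (smult ((-1) ^ k * ?r) (weight_poly ^ m
          * Legendre_D m n)) t \<partial>mu)"
    using X_integration_by_parts[OF u f rep, of "Legendre_D (m + k) n"]
    unfolding higher_pderiv_weighted_Legendre_D .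
  also have "(\<integral>t. u t / omega t ^ m * poly (smult ((-1) ^ k * ?r) (weight_poly ^ m
      * Legendre_D m n)) t \<partial>mu)
      = (\<integral>t. (-1) ^ k * ?r * (u t * (omega t ^ m * poly (Legendre_D m n) t)) \<partial>mu)"
  proof (rule Bochner_Integration.integral_cong[OF refl])
    fix t assume "t \<in> space mu"
    then have t: "t \<in> {-1<..<1}" by simp
    have "u t / omega t ^ m * poly (smult c (weight_poly ^ m * q)) t
        = c * (u t * (omega t ^ m * poly q t))" for c q
      unfolding poly_smult poly_mult omega_pow2[OF t, symmetric] using omega_pos[OF t] by simp
    then show "u t / omega t ^ m * poly (smult ((-1) ^ k * ?r) (weight_poly ^ m * Legendre_D m n)) t
        = (-1) ^ k * ?r * (u t * (omega t ^ m * poly (Legendre_D m n) t))" .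
  qed
  also have "(-1) ^ k * \<dots> = ?r * (\<integral>t. u t * (omega t ^ m * poly (Legendre_D m n) t) \<partial>mu)"
  proof -
    have "(-1) ^ k * ((-1) ^ k * ?r * x) = ?r * x" for x by (cases "even k") simp_all
    then show ?thesis unfolding integral_mult_right_zero .
  qed
  finally have *: "(\<integral>t. f t * (omega t ^ (m + k) * poly (Legendre_D (m + k) n) t) \<partial>mu)
      = ?r * (\<integral>t. u t * (omega t ^ m * poly (Legendre_D m n) t) \<partial>mu)" .
  have Legendre_coef: "Legendre_coef j v n = norm_const j n * (\<integral>t. v t * (omega t ^ j
      * poly (Legendre_D j n) t) \<partial>mu)" for j v
    unfolding integral_mult_right_zero[symmetric]
    by (rule Bochner_Integration.integral_cong) (simp_all add: assoc_Legendre_eq mult_ac)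
  have "Legendre_coef (m + k) f n = norm_const (m
      + k) n * sqrt ?r * sqrt ?r * (\<integral>t. u t * (omega t ^ m * poly (Legendre_D m n) t) \<partial>mu)"
    unfolding Legendre_coef * using r by simp
  also have "norm_const (m + k) n * sqrt ?r = norm_const m n" by (rule norm_const_deriv_factor[OF n])
  finally show ?thesis by (simp only: Legendre_coef mult_ac)
qed

text \<open>
  Parseval's identity for \<open>f\<close> in the basis of order \<open>m+k\<close>, whose index starts at \<open>m+k\<close>; the terms
      added to
  start at \<open>m\<close> are zero.
\<close>

lemma X_Parseval:
  assumes u: "u \<in> L2" and f: "f \<in> L2"
    and rep: "represented_by (distr_mult (\<lambda>t. omega t ^ (m + k)) (weighted_deriv m k u)) f"
  shows "(\<lambda>i. deriv_factor m k (m + i) * (Legendre_coef m u (m + i))\<^sup>2) sums (\<integral>t. (f t)\<^sup>2 \<partial>mu)"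
proof -
  interpret orthonormal_basis mu "\<lambda>i. assoc_Legendre (m + k) (m + k + i)"
    by (rule assoc_Legendre_basis)
  have "(\<lambda>i. (Legendre_coef (m + k) f (m + k + i))\<^sup>2) sums (\<integral>t. (f t)\<^sup>2 \<partial>mu)"
    using f by (intro Parseval) (simp add: L2_iff_square_int)
  also have "(\<lambda>i. (Legendre_coef (m + k) f (m + k + i))\<^sup>2)
      = (\<lambda>i. deriv_factor m k (m + (i + k)) * (Legendre_coef m u (m + (i + k)))\<^sup>2)"
  proof
    fix i
    have i: "m + (i + k) = m + k + i" by simp
    have c: "Legendre_coef (m + k) f (m + k + i)
        = sqrt (deriv_factor m k (m + k + i)) * Legendre_coef m u (m + k + i)"
      by (rule X_coefficients[OF u f rep]) simp
    have "deriv_factor m k (m + k + i) \<ge> 0" by (intro deriv_factor_nonneg) simp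
    then show "(Legendre_coef (m + k) f (m + k + i))\<^sup>2
        = deriv_factor m k (m + (i + k)) * (Legendre_coef m u (m + (i + k)))\<^sup>2"
      unfolding c i power_mult_distrib by (simp only: real_sqrt_pow2)
  qed
  finally have "(\<lambda>i. deriv_factor m k (m + (i + k)) * (Legendre_coef m u (m + (i
      + k)))\<^sup>2) sums (\<integral>t. (f t)\<^sup>2 \<partial>mu)" .
  then show ?thesis
    by (subst (asm) sums_zero_iff_shift[where f
        = "\<lambda>i. deriv_factor m k (m + i) * (Legendre_coef m u (m + i))\<^sup>2"])
       (simp_all add: deriv_factor_zero)
qed

lemma integrable_mult_test:
  assumes "locally_integrable g" "\<phi> \<in> test_functions"
  shows "integrable mu (\<lambda>t. g t * \<phi> t)"
proof -
  obtain a b where ab: "-1 < a" "b < 1" "\<And>x. x \<notin> {a..b} \<Longrightarrow> \<phi> x = 0"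
    using assms(2) by (auto simp: test_functions_iff)
  have "integrable mu (\<lambda>t. g t * indicator {a..b} t * \<phi> t)"
    by (rule integrable_mult_continuous[OF locally_integrableD[OF assms(1) ab(1,2)]
        test_function_continuous[OF assms(2)]])
  also have "(\<lambda>t. g t * indicator {a..b} t * \<phi> t) = (\<lambda>t. g t * \<phi> t)"
    using ab(3) by (auto simp: indicator_def fun_eq_iff)
  finally show ?thesis .
qed

lemma locally_integrable_divide_omega:
  assumes "integrable mu f"
  shows "locally_integrable (\<lambda>t. f t / omega t ^ j)"
  unfolding locally_integrable_def
proof (intro allI impI)
  fix a b :: real assume ab: "-1 < a \<and> b < 1"
  define c where "c = max \<bar>a\<bar> \<bar>b\<bar>"
  show "integrable (lebesgue_on {a..b}) (\<lambda>t. f t / omega t ^ j)"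
  proof (cases "a \<le> b")
    case False
    then show ?thesis by simp
  next
    case True
    have cont: "continuous_on {a..b} (\<lambda>t. 1 / omega t ^ j)"
    proof (intro continuous_on_divide continuous_on_const continuous_omega_power ballI)
      fix t assume "t \<in> {a..b}"
      then have "omega t > 0" using ab by (intro omega_pos) auto
      then show "omega t ^ j \<noteq> 0" by simp
    qed
    then have "bounded ((\<lambda>t. 1 / omega t ^ j) ` {a..b})"
      by (intro compact_imp_bounded compact_continuous_image) auto
    then obtain B where "\<forall>z\<in>(\<lambda>t. 1 / omega t ^ j) ` {a..b}. norm z \<le> B" unfolding bounded_iff by blast
    then have B: "\<bar>1 / omega t ^ j\<bar> \<le> B" if "t \<in> {a..b}" for t using that by auto
    have fi: "integrable (lebesgue_on {a..b}) f"
      using locally_integrable_integrable[OF assms] ab unfolding locally_integrable_def by blast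
    have "integrable (lebesgue_on {a..b}) (\<lambda>t. f t * (1 / omega t ^ j))"
    proof (rule Bochner_Integration.integrable_bound[OF integrable_mult_right[OF fi, of B]])
      show "(\<lambda>t. f t * (1 / omega t ^ j)) \<in> borel_measurable (lebesgue_on {a..b})"
        by (intro borel_measurable_times[OF borel_measurable_integrable[OF fi]]
            continuous_imp_measurable_on_sets_lebesgue cont) auto
      show "AE t in lebesgue_on {a..b}. norm (f t * (1 / omega t ^ j)) \<le> norm (B * f t)"
      proof (rule AE_I2)
        fix t assume "t \<in> space (lebesgue_on {a..b})"
        then have "\<bar>1 / omega t ^ j\<bar> \<le> \<bar>B\<bar>" using B[of t] by simp
        then show "norm (f t * (1 / omega t ^ j)) \<le> norm (B * f t)"
          unfolding real_norm_def abs_mult mult.commute[of "\<bar>f t\<bar>"] by (rule mult_right_mono) simp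
      qed
    qed
    then show ?thesis by simp
  qed
qed

lemma represented_by_AE_unique:
  assumes g: "represented_by T g" and h: "represented_by T h"
  shows "AE t in mu. g t = h t"
proof -
  have gl: "locally_integrable g" and hl: "locally_integrable h"
    using g h by (auto simp: represented_by_def)
  have "locally_integrable (\<lambda>t. g t - h t)"
    using gl hl by (auto simp: locally_integrable_def)
  moreover have "(\<integral>t. (g t - h t) * \<phi> t \<partial>mu) = 0" if \<phi>: "\<phi> \<in> test_functions" for \<phi>
  proof -
    have "(\<integral>t. g t * \<phi> t \<partial>mu) = (\<integral>t. h t * \<phi> t \<partial>mu)"
      using g h \<phi> by (simp add: represented_by_def distr_of_def)
    then show ?thesis
      using integrable_mult_test[OF gl \<phi>] integrable_mult_test[OF hl \<phi>] by (simp add: left_diff_distrib)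
  qed
  ultimately have "AE t in mu. g t - h t = 0" by (rule fundamental_lemma_of_variations)
  then show ?thesis by simp
qed

text \<open>
  Since \<open>omega\<close> is smooth and positive on \<open>(-1,1)\<close>, a test function may be divided by \<open>omega^(m+k)\<close>.
\<close>

lemma represented_by_weighted_deriv:
  assumes f: "f \<in> L2"
    and rep: "represented_by (distr_mult (\<lambda>t. omega t ^ (m + k)) (weighted_deriv m k u)) f"
  shows "represented_by (weighted_deriv m k u) (\<lambda>t. f t / omega t ^ (m + k))"
  unfolding represented_by_def
proof (intro conjI ballI)
  show "locally_integrable (\<lambda>t. f t / omega t ^ (m + k))"
    using f by (intro locally_integrable_divide_omega square_int_integrable_mu)
        (simp add: L2_iff_square_int)
  fix \<phi> assume \<phi>: "\<phi> \<in> test_functions"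
  define \<psi> where "\<psi> t = 1 / omega t ^ (m + k) * \<phi> t" for t
  have \<psi>: "\<psi> \<in> test_functions"
    unfolding \<psi>_def[abs_def] by (intro test_function_mult \<phi> differentiable_upto_omega_power_inverse)
  have "weighted_deriv m k u \<phi> = weighted_deriv m k u (\<lambda>t. omega t ^ (m + k) * \<psi> t)"
    unfolding weighted_deriv_def distr_deriv_def distr_of_def
  proof (intro arg_cong2[where f = "(*)", OF refl] Bochner_Integration.integral_cong[OF refl])
    fix t assume "t \<in> space mu"
    then show "(deriv ^^ k) \<phi> t = (deriv ^^ k) (\<lambda>t. omega t ^ (m + k) * \<psi> t) t"
    proof (intro higher_deriv_cong_open[of "{-1<..<1}"])
      fix t :: real assume "t \<in> {-1<..<1}"
      then show "\<phi> t = omega t ^ (m + k) * \<psi> t" using omega_pos[of t] by (simp add: \<psi>_def)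
    qed simp_all
  qed
  also have "\<dots> = distr_of f \<psi>" using rep \<psi> by (simp add: represented_by_def distr_mult_def)
  also have "\<dots> = distr_of (\<lambda>t. f t / omega t ^ (m + k)) \<phi>" by (simp add: distr_of_def \<psi>_def)
  finally show "weighted_deriv m k u \<phi> = distr_of (\<lambda>t. f t / omega t ^ (m + k)) \<phi>" .
qed

text \<open>
  Lebesgue measure is complete.
\<close>

lemma borel_measurable_mu_AE:
  fixes f g :: "real \<Rightarrow> real"
  assumes f: "f \<in> borel_measurable mu" and ae: "AE t in mu. f t = g t"
  shows "g \<in> borel_measurable mu"
proof -
  have "(\<lambda>t. if t \<in> {-1<..<1} then f t else 0) \<in> borel_measurable lebesgue"
    by (rule borel_measurable_if_I[OF f]) simp
  moreover have "AE t in lebesgue. (if t \<in> {-1<..<1} then f t else 0)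
      = (if t \<in> {-1<..<1} then g t else 0)"
    using ae by (simp add: AE_restrict_space_iff)
  ultimately have "(\<lambda>t. if t \<in> {-1<..<1} then g t else 0) \<in> borel_measurable lebesgue"
    by (rule borel_measurable_AE)
  then show ?thesis by (simp add: borel_measurable_if_D)
qed

text \<open>
  The function chosen in \<open>distr_fun\<close> agrees almost everywhere with \<open>f / omega^(m+k)\<close>.
\<close>

lemma energy_derivative_part:
  assumes f: "f \<in> L2"
    and rep: "represented_by (distr_mult (\<lambda>t. omega t ^ (m + k)) (weighted_deriv m k u)) f"
  shows "(\<integral>t. omega t ^ (2 * (m + k)) * \<bar>distr_fun (weighted_deriv m k u) t\<bar>\<^sup>2 \<partial>mu) = (\<integral>t. (f t)\<^sup>2 \<partial>mu)"
proof -
  define g where "g = distr_fun (weighted_deriv m k u)"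
  have r: "represented_by (weighted_deriv m k u) (\<lambda>t. f t / omega t ^ (m + k))"
    by (rule represented_by_weighted_deriv[OF f rep])
  have g: "represented_by (weighted_deriv m k u) g"
    unfolding g_def distr_fun_def by (rule someI[of "represented_by (weighted_deriv m k u)", OF r])
  have "AE t in mu. g t = f t / omega t ^ (m + k)" by (rule represented_by_AE_unique[OF g r])
  moreover have "AE t in mu. t \<in> {-1<..<1}" by (rule AE_I2) simp
  ultimately have ae: "AE t in mu. (f t)\<^sup>2 = omega t ^ (2 * (m + k)) * \<bar>g t\<bar>\<^sup>2"
  proof eventually_elim
    case (elim t)
    then show ?case using omega_pos[of t]
      by (simp add: power_divide power_mult[symmetric] mult.commute[of _ 2])
  qed
  have fm: "(\<lambda>t. (f t)\<^sup>2) \<in> borel_measurable mu" using f by (auto simp: L2_def)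
  have "(\<lambda>t. omega t ^ (2 * (m + k)) * \<bar>g t\<bar>\<^sup>2) \<in> borel_measurable mu"
    by (rule borel_measurable_mu_AE[OF fm ae])
  then show ?thesis
    unfolding g_def[symmetric] using ae fm by (intro integral_cong_AE) auto
qed

section \<open>Norms and inclusions\<close>

text \<open>
  Sums over \<open>n \<ge> m\<close> are rewritten as series in \<open>i = n - m\<close>, and real powers with even natural exponents
  as ordinary powers.
\<close>

lemma H_space_iff:
  fixes m k :: nat
  assumes u: "u \<in> L2"
  defines "b \<equiv> \<lambda>i. (2 * real (m + i) + 1) ^ (2 * k) * (Legendre_coef m u (m + i))\<^sup>2"
  shows "u \<in> H_space m (real k) \<longleftrightarrow> summable b"
    and "u \<in> H_space m (real k) \<Longrightarrow> (H_norm m (real k) u)\<^sup>2 = suminf b"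
proof -
  define B where "B n = (2 * real n + 1) powr (2 * real k) * \<bar>L2_inner u (assoc_Legendre m n)\<bar>\<^sup>2" for n
  have B: "B (m + i) = b i" for i
  proof -
    have "(2 * real (m + i) + 1) powr (2 * real k) = (2 * real (m + i) + 1) powr real (2 * k)" by simp
    also have "\<dots> = (2 * real (m + i) + 1) ^ (2 * k)" by (rule powr_realpow) simp
    finally show ?thesis by (simp add: B_def b_def L2_inner_def)
  qed
  have bij: "bij_betw (\<lambda>i. m + i) UNIV {m..}"
    by (rule bij_betw_byWitness[where f' = "\<lambda>n. n - m"]) auto
  have b0: "b i \<ge> 0" for i by (simp add: b_def)
  have "B summable_on {m..} \<longleftrightarrow> (\<lambda>i. B (m + i)) summable_on UNIV"
    by (rule summable_on_reindex_bij_betw[OF bij, symmetric])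
  also have "\<dots> \<longleftrightarrow> summable b" unfolding B by (rule summable_on_UNIV_nonneg_real_iff[OF b0])
  finally have s: "B summable_on {m..} \<longleftrightarrow> summable b" .
  show iff: "u \<in> H_space m (real k) \<longleftrightarrow> summable b"
    using u s by (simp add: H_space_def B_def[abs_def])
  assume "u \<in> H_space m (real k)"
  then have sb: "summable b" by (simp add: iff)
  have "infsum B {m..} = infsum (\<lambda>i. B (m + i)) UNIV"
    by (rule infsum_reindex_bij_betw[OF bij, symmetric])
  also have "\<dots> = suminf b"
    unfolding B by (rule infsumI[OF sums_nonneg_imp_has_sum[OF summable_sums[OF sb] b0]])
  finally have "infsum B {m..} = suminf b" .
  moreover have "suminf b \<ge> 0" by (rule suminf_nonneg[OF sb b0])
  ultimately show "(H_norm m (real k) u)\<^sup>2 = suminf b"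
    by (simp add: H_norm_def B_def[abs_def])
qed

text \<open>
  The Riesz-Fischer sum \<open>f\<close> of the formally differentiated expansion is the weak derivative sought:
      tested
  with \<open>\<phi>\<close>, the partial sums of both expansions agree term by term after integration by parts.
\<close>

lemma H_subset_X: "H_space m (real k) \<subseteq> X_space m k"
proof
  fix u assume uH: "u \<in> H_space m (real k)"
  then have u: "u \<in> L2" by (simp add: H_space_def)
  then have us: "square_int mu u" by (simp add: L2_iff_square_int)
  define r where "r i = deriv_factor m k (m + i)" for i
  have r0: "r i \<ge> 0" for i by (simp add: r_def deriv_factor_nonneg)
  define a where "a i = Legendre_coef m u (m + i)" for i
  have "summable (\<lambda>i. (2 * real (m + i) + 1) ^ (2 * k) * (a i)\<^sup>2)"
    using uH H_space_iff(1)[OF u] by (simp add: a_def)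
  then have sr: "summable (\<lambda>i. r i * (a i)\<^sup>2)"
  proof (rule summable_comparison_test[rotated], intro exI allI impI)
    fix i
    have "r i \<le> (real (m + i) + 1/2) ^ (2 * k)"
      unfolding r_def by (rule deriv_factor_le) auto
    also have "\<dots> \<le> (2 * real (m + i) + 1) ^ (2 * k)" by (intro power_mono) auto
    finally show "norm (r i * (a i)\<^sup>2) \<le> (2 * real (m + i) + 1) ^ (2 * k) * (a i)\<^sup>2"
      using r0[of i] by (simp add: mult_right_mono)
  qed
  define c where "c i = sqrt (r (i + k)) * a (i + k)" for i
  have "summable (\<lambda>i. (c i)\<^sup>2)"
    using summable_ignore_initial_segment[OF sr, of k] r0 by (simp add: c_def power_mult_distrib)
  interpret U: orthonormal_basis mu "\<lambda>i. assoc_Legendre m (m + i)" by (rule assoc_Legendre_basis)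
  interpret F: orthonormal_basis mu "\<lambda>i. assoc_Legendre (m + k) (m + k + i)"
      by (rule assoc_Legendre_basis)
  obtain f where f: "square_int mu f" and flim:
    "\<And>g. square_int mu g \<Longrightarrow> (\<lambda>N. \<integral>x. F.partial_sum c N x * g x \<partial>mu) \<longlonglongrightarrow> (\<integral>x. f x * g x \<partial>mu)"
    using F.weak_Riesz_Fischer[OF \<open>summable (\<lambda>i. (c i)\<^sup>2)\<close>] by blast
  have "represented_by (distr_mult (\<lambda>t. omega t ^ (m + k)) (weighted_deriv m k u)) f"
    unfolding represented_by_def
  proof (intro conjI ballI)
    show "locally_integrable f" by (intro locally_integrable_integrable square_int_integrable_mu f)
    fix \<phi> assume \<phi>: "\<phi> \<in> test_functions"
    define \<psi> where "\<psi> t = omega t ^ (m + k) * \<phi> t" for t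
    have \<psi>: "\<psi> \<in> test_functions"
      unfolding \<psi>_def[abs_def] by (intro test_function_mult \<phi> differentiable_upto_omega_power)
    (* Up to the sign (-1)^k, the weak derivative of u
        / omega^m tested with \<psi> is the integral of u against D. *)
    define D where "D t = 1 / omega t ^ m * (deriv ^^ k) \<psi> t" for t
    have D: "D \<in> test_functions"
      unfolding D_def[abs_def] by (intro test_function_mult test_function_higher_deriv \<psi>
          differentiable_upto_omega_power_inverse)
    have term_eq: "(-1) ^ k * (a i * (\<integral>t. assoc_Legendre m (m + i) t * D t \<partial>mu)) =
        (if i < k then 0 else sqrt (r i) * a i * (\<integral>t. assoc_Legendre (m + k) (m + i) t * \<phi> t \<partial>mu))" for i
    proof -
      have "(\<integral>t. assoc_Legendre m (m + i) t * D t \<partial>mu)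
          = (\<integral>t. norm_const m (m + i) * (poly (Legendre_D m (m + i)) t * (deriv ^^ k) \<psi> t) \<partial>mu)"
      proof (rule Bochner_Integration.integral_cong[OF refl])
        fix t assume "t \<in> space mu"
        then have "omega t > 0" by (intro omega_pos) simp
        moreover have "c * o' * p * (1 / o' * d) = c * (p * d)" if "o' > 0" for c o' p d :: real
          using that by simp
        ultimately show "assoc_Legendre m (m + i) t * D t
            = norm_const m (m + i) * (poly (Legendre_D m (m + i)) t * (deriv ^^ k) \<psi> t)"
          unfolding assoc_Legendre_eq D_def by simp
      qed
      also have "\<dots> = norm_const m (m + i) * ((-1) ^ k * (\<integral>t. poly ((pderiv ^^ k) (Legendre_D m (m
          + i))) t * \<psi> t \<partial>mu))"
        unfolding integral_mult_right_zero poly_test_by_parts[OF \<psi>] ..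
      also have "(pderiv ^^ k) (Legendre_D m (m + i)) = Legendre_D (m + k) (m + i)"
        by (simp only: funpow_add o_apply add.commute[of m k])
      finally have e: "(-1) ^ k * (a i * (\<integral>t. assoc_Legendre m (m + i) t * D t \<partial>mu))
          = a i * (norm_const m (m + i) * (\<integral>t. poly (Legendre_D (m + k) (m + i)) t * \<psi> t \<partial>mu))"
        by (simp flip: power_mult_distrib mult.assoc)
      show ?thesis
      proof (cases "i < k")
        case True
        then have "Legendre_D (m + k) (m + i) = 0" by (intro Legendre_D_eq_0) simp
        then show ?thesis using e True by simp
      next
        case False
        then have n: "m + k \<le> m + i" by simp
        have "norm_const m (m + i) * (\<integral>t. poly (Legendre_D (m + k) (m + i)) t * \<psi> t \<partial>mu)
            = sqrt (r i) * (\<integral>t. norm_const (m + k) (m + i) * (poly (Legendre_D (m + k) (m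
                + i)) t * \<psi> t) \<partial>mu)"
          unfolding norm_const_deriv_factor[OF n, symmetric] r_def integral_mult_right_zero by
              (simp only: mult_ac)
        also have "(\<integral>t. norm_const (m + k) (m + i) * (poly (Legendre_D (m + k) (m + i)) t * \<psi> t) \<partial>mu)
            = (\<integral>t. assoc_Legendre (m + k) (m + i) t * \<phi> t \<partial>mu)"
          by (simp only: assoc_Legendre_eq \<psi>_def mult_ac)
        finally show ?thesis using e False by simp
      qed
    qed
    have "(\<lambda>N. \<integral>x. U.partial_sum a N x * D x \<partial>mu) \<longlonglongrightarrow> (\<integral>x. u x * D x \<partial>mu)"
      using U.expansion[OF us square_int_continuous[OF test_function_continuous[OF D]]]
      by (simp only: a_def[abs_def])
    (* The first k terms are polynomials annihilated by k derivatives; hence the shift by k. *)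
    from tendsto_mult_left[OF LIMSEQ_ignore_initial_segment[OF this, of k], of "(-1) ^ k"]
    have lim1: "(\<lambda>N. (-1) ^ k * (\<integral>x. U.partial_sum a (N + k) x * D x \<partial>mu))
        \<longlonglongrightarrow> (-1) ^ k * (\<integral>x. u x * D x \<partial>mu)" .
    have "(-1) ^ k * (\<integral>x. U.partial_sum a (N + k) x * D x \<partial>mu)
        = (\<integral>x. F.partial_sum c N x * \<phi> x \<partial>mu)" for N
    proof -
      have "(-1) ^ k * (\<integral>x. U.partial_sum a (N + k) x * D x \<partial>mu)
          = (\<Sum>i<N + k. if i < k then 0 else sqrt (r i) * a i * (\<integral>t. assoc_Legendre (m + k) (m
              + i) t * \<phi> t \<partial>mu))"
        unfolding U.integral_partial_sum_mult[OF square_int_continuous[OF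
            test_function_continuous[OF D]]]
          sum_distrib_left term_eq ..
      also have "\<dots> = (\<Sum>i<N. sqrt (r (i + k)) * a (i + k) * (\<integral>t. assoc_Legendre (m + k) (m + (i
          + k)) t * \<phi> t \<partial>mu))"
        by (induction N) simp_all
      also have "\<dots> = (\<integral>x. F.partial_sum c N x * \<phi> x \<partial>mu)"
      proof -
        have "m + (i + k) = m + k + i" for i by simp
        then show ?thesis
          unfolding F.integral_partial_sum_mult[OF square_int_continuous[OF
              test_function_continuous[OF \<phi>]]]
          by (simp only: c_def)
      qed
      finally show ?thesis .
    qed
    with lim1 have "(\<lambda>N. \<integral>x. F.partial_sum c N x * \<phi> x \<partial>mu) \<longlonglongrightarrow> (-1) ^ k * (\<integral>x. u x * D x \<partial>mu)" by simp
    from LIMSEQ_unique[OF this flim[OF square_int_continuous[OF test_function_continuous[OF \<phi>]]]]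
    have "(-1) ^ k * (\<integral>x. u x * D x \<partial>mu) = (\<integral>x. f x * \<phi> x \<partial>mu)" .
    then show "distr_mult (\<lambda>t. omega t ^ (m + k)) (weighted_deriv m k u) \<phi> = distr_of f \<phi>"
      unfolding distr_mult_def weighted_deriv_def distr_deriv_def distr_of_def D_def \<psi>_def by simp
  qed
  then show "u \<in> X_space m k" using u f by (auto simp: X_space_def L2_iff_square_int)
qed

text \<open>
  Parseval's identities for \<open>u\<close> and for \<open>f\<close>, added up, express the energy as a series; comparison with it
  yields membership in \<open>H_space\<close>.
\<close>

lemma X_subset_H_energy:
  assumes "u \<in> X_space m k"
  shows "u \<in> H_space m (real k)"
    and "(\<lambda>i. ((real m + 1/2) ^ (2 * k) + deriv_factor m k (m + i)) * (Legendre_coef m u (m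
        + i))\<^sup>2) sums energy m k u"
proof -
  obtain f where u: "u \<in> L2" and f: "f \<in> L2"
    and rep: "represented_by (distr_mult (\<lambda>t. omega t ^ (m + k)) (weighted_deriv m k u)) f"
    using assms by (auto simp: X_space_def)
  interpret U: orthonormal_basis mu "\<lambda>i. assoc_Legendre m (m + i)" by (rule assoc_Legendre_basis)
  have 1: "(\<lambda>i. (Legendre_coef m u (m + i))\<^sup>2) sums (\<integral>t. (u t)\<^sup>2 \<partial>mu)"
    using u by (intro U.Parseval) (simp add: L2_iff_square_int)
  have "(\<lambda>i. (real m + 1/2) ^ (2 * k) * (Legendre_coef m u (m + i))\<^sup>2 + deriv_factor m k (m
      + i) * (Legendre_coef m u (m + i))\<^sup>2)
      sums ((real m + 1/2) ^ (2 * k) * (\<integral>t. (u t)\<^sup>2 \<partial>mu) + (\<integral>t. (f t)\<^sup>2 \<partial>mu))"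
    by (intro sums_add sums_mult 1 X_Parseval[OF u f rep])
  then show e: "(\<lambda>i. ((real m + 1/2) ^ (2 * k) + deriv_factor m k (m + i)) * (Legendre_coef m u (m
      + i))\<^sup>2) sums energy m k u"
    unfolding energy_def energy_derivative_part[OF f rep] by (simp add: distrib_right)
  obtain C where C: "C > 0" "\<And>n. m \<le> n \<Longrightarrow> C * (2 * real n + 1) ^ (2 * k)
      \<le> (real m + 1/2) ^ (2 * k) + deriv_factor m k n"
    by (rule norm_equivalence_constants[of m k]) blast
  have "summable (\<lambda>i. C * ((2 * real (m + i) + 1) ^ (2 * k) * (Legendre_coef m u (m + i))\<^sup>2))"
  proof (rule summable_comparison_test[OF _ sums_summable[OF e]], intro exI allI impI)
    fix i
    show "norm (C * ((2 * real (m + i) + 1) ^ (2 * k) * (Legendre_coef m u (m + i))\<^sup>2))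
        \<le> ((real m + 1/2) ^ (2 * k) + deriv_factor m k (m + i)) * (Legendre_coef m u (m + i))\<^sup>2"
      using mult_right_mono[OF C(2)[of "m + i"], of "(Legendre_coef m u (m + i))\<^sup>2"] C(1)
      by (simp only: real_norm_def abs_mult power_abs[symmetric] abs_of_pos le_add1 mult.assoc
          zero_le_power2) simp
  qed
  then have "summable (\<lambda>i. (2 * real (m + i) + 1) ^ (2 * k) * (Legendre_coef m u (m + i))\<^sup>2)"
    using C(1) by (simp only: summable_cmult_iff) simp
  then show "u \<in> H_space m (real k)" using H_space_iff(1)[OF u] by blast
qed

theorem theorem5p1:
  fixes m k :: nat
  assumes "k \<ge> 1"
  shows "H_space m (real k) = X_space m k \<and>
    (\<exists>C>0. \<forall>u\<in>H_space m (real k).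
      C * (H_norm m (real k) u)^2 \<le> energy m k u \<and>
      energy m k u \<le> 2 powr (1 - 2 * real k) * (H_norm m (real k) u)^2)"
proof
  show HX: "H_space m (real k) = X_space m k"
    using H_subset_X X_subset_H_energy(1) by blast
  obtain C where C: "C > 0" "\<And>n. m \<le> n \<Longrightarrow> C * (2 * real n + 1) ^ (2 * k)
      \<le> (real m + 1/2) ^ (2 * k) + deriv_factor m k n"
    by (rule norm_equivalence_constants[of m k]) blast
  have "C * (H_norm m (real k) u)\<^sup>2 \<le> energy m k u \<and>
      energy m k u \<le> 2 powr (1 - 2 * real k) * (H_norm m (real k) u)\<^sup>2" if uH:
          "u \<in> H_space m (real k)" for u
  proof -
    define A where "A i = (Legendre_coef m u (m + i))\<^sup>2" for i
    define w where "w i = (2 * real (m + i) + 1) ^ (2 * k)" for i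
    define q where "q i = (real m + 1/2) ^ (2 * k) + deriv_factor m k (m + i)" for i
    have u: "u \<in> L2" using uH by (simp add: H_space_def)
    have "summable (\<lambda>i. w i * A i)" using H_space_iff(1)[OF u] uH by (simp add: w_def A_def)
    then have h: "(\<lambda>i. w i * A i) sums (H_norm m (real k) u)\<^sup>2"
      using H_space_iff(2)[OF u uH] by (simp add: w_def A_def sums_iff)
    have e: "(\<lambda>i. q i * A i) sums energy m k u"
      using X_subset_H_energy(2) uH HX by (simp add: q_def A_def)
    have A: "A i \<ge> 0" for i by (simp add: A_def)
    have "C * w i \<le> q i" for i unfolding w_def q_def by (rule C(2)) simp
    then have "C * (w i * A i) \<le> q i * A i" for i
      using mult_right_mono[OF _ A] by (simp only: mult.assoc[symmetric])
    then have lower: "C * (H_norm m (real k) u)\<^sup>2 \<le> energy m k u"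
      by (rule sums_le[OF _ sums_mult[OF h] e])
    have p: "2 powr (1 - 2 * real k) = 2 / 2 ^ (2 * k)"
    proof -
      have "2 powr (1 - 2 * real k) = 2 / 2 powr real (2 * k)" by (simp add: powr_diff)
      then show ?thesis by (subst (asm) powr_realpow) simp_all
    qed
    have "q i \<le> 2 powr (1 - 2 * real k) * w i" for i
    proof -
      have "(real m + 1/2) ^ (2 * k) \<le> (real (m + i) + 1/2) ^ (2 * k)" by (intro power_mono) auto
      moreover have "deriv_factor m k (m + i) \<le> (real (m + i) + 1/2) ^ (2 * k)"
        by (rule deriv_factor_le) auto
      ultimately have "q i \<le> 2 * (real (m + i) + 1/2) ^ (2 * k)" unfolding q_def by linarith
      also have "\<dots> = 2 powr (1 - 2 * real k) * w i"
        unfolding half_power p w_def by simp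
      finally show ?thesis .
    qed
    then have "q i * A i \<le> 2 powr (1 - 2 * real k) * (w i * A i)" for i
      using mult_right_mono[OF _ A] by (simp only: mult.assoc[symmetric])
    then have "energy m k u \<le> 2 powr (1 - 2 * real k) * (H_norm m (real k) u)\<^sup>2"
      by (rule sums_le[OF _ e sums_mult[OF h]])
    with lower show ?thesis by blast
  qed
  with C(1) show "\<exists>C>0. \<forall>u\<in>H_space m (real k). C * (H_norm m (real k) u)^2 \<le> energy m k u \<and>
      energy m k u \<le> 2 powr (1 - 2 * real k) * (H_norm m (real k) u)^2" by blast
qed

end
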